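(* Fix $N\in\mathbb{N}$, $a_-,a_+\in\mathbb{R}$ with $a_-<a_+$, and $\theta=\beta/2>0$. Let $V(z)$ be a holomorphic function in a complex neighborhood $U$ of $[a_-,a_+]$ which is real-valued on $[a_-,a_+]$. Let $k\in\{1,\dots,N\}$ and let $(Y^N,\dots,Y^k)$ be a random vector in $\mathbb{R}^N\times\cdots\times\mathbb{R}^k$ whose distribution has the density $f_{N,k}$ given in the context. For $z\in\mathbb{C}\setminus[a_-,a_+]$ and $j\in\{k,\dots,N\}$ put $$\mathcal{G}^j(z)=\sum_{i=1}^j\frac{1}{z-Y^j_i}.$$ Let $m_k,\dots,m_N\in\mathbb{Z}_{\geq 0}$, $\mathfrak{M}=\{(r,f): r\in\{k,\dots,N\},\ f\in\{1,\dots,m_r\}\}$, and let $v^r_f\in\mathbb{C}\setminus[a_-,a_+]$ for $(r,f)\in\mathfrak{M}$. For $J\subseteq\mathfrak{M}$ and a bounded complex random variable $\xi$ let $\kappa(\xi;J)$ denote the joint cumulant of $\xi$ and the random variables $\mathcal{G}^r(v^r_f)$, $(r,f)\in J$. Then for $v\in\mathbb{C}\setminus[a_-,a_+]$ $$\oint_\Gamma \frac{(z-a_-)(z-a_+)}{2\pi \mathrm{i}\,(z-v)}\left[\frac{\kappa(\mathfrak{S}(z);\mathfrak{M})}{2}+\sum_{(r,f)\in\mathfrak{M}}\frac{\kappa(\mathcal{G}^r(z);\mathfrak{M}\setminus\{(r,f)\})}{(z-v^r_f)^2}\right]dz=0,$$ where $$\mathfrak{S}(z)=-2N\theta\,\partial_zV(z)\,\mathcal{G}^N(z)+\theta\,\partial_z\mathcal{G}^N(z)+\theta[\mathcal{G}^N(z)]^2+(\theta-2)\,\partial_z\mathcal{G}^k(z)+\theta[\mathcal{G}^k(z)]^2$$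 $$\qquad+\sum_{j=k+1}^N\Big(-(\theta+1)\,\partial_z\mathcal{G}^j(z)+(1-\theta)[\mathcal{G}^j(z)-\mathcal{G}^{j-1}(z)]^2+(1-\theta)\,\partial_z\mathcal{G}^{j-1}(z)\Big),$$ and $\Gamma$ is a positively oriented contour which encloses the segment $[a_-,a_+]$, is contained in $U$, and excludes the points $\{v^r_f:(r,f)\in\mathfrak{M}\}$ and $v$.
   Context: Density. For $y=(y^N,\dots,y^k)\in\mathbb{R}^N\times\cdots\times\mathbb{R}^k$ with $y^j=(y^j_1,\dots,y^j_j)$, $$f_{N,k}(y)=Z^{-1}\,\mathbf{1}_{\mathcal{G}_{N,k}}(y)\,\mathbf{1}\{a_-<y^N_1,\ y^N_N<a_+\}\prod_{1\leq i<j\leq N}(y^N_j-y^N_i)\prod_{1\leq i<j\leq k}(y^k_j-y^k_i)^{2\theta-1}$$ $$\times\prod_{j=k}^{N-1}\left(\prod_{1\leq a<b\leq j}(y^j_b-y^j_a)^{2-2\theta}\prod_{a=1}^j\prod_{b=1}^{j+1}|y^j_a-y^{j+1}_b|^{\theta-1}\right)\prod_{i=1}^N e^{-N\theta V(y^N_i)},$$ where $Z\in(0,\infty)$ is the normalization constant and $\mathcal{G}_{N,k}$ is the set of $y$ with $y^j_1<\cdots<y^j_j$ for all $j\in\{k,\dots,N\}$ and $y^j_i<y^{j-1}_i<y^j_{i+1}$ for all $j\in\{k+1,\dots,N\}$, $i\in\{1,\dots,j-1\}$. Joint cumulants. For bounded complex random variables $X_1,\dots,X_n$ the joint cumulant is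 $$\frac{\partial^n}{\partial z_1\cdots\partial z_n}\log\mathbb{E}\Big[\exp\Big(\sum_{i=1}^n z_iX_i\Big)\Big]\Big|_{z_1=\cdots=z_n=0};$$ it is symmetric in its arguments, and for $n=1$ equals $\mathbb{E}[X_1]$. In particular $\kappa(\xi;\emptyset)=\mathbb{E}[\xi]$.
   Formalization: "Γ is contained in U" is read as including the region Γ encloses (winding number 0 about every point outside U); with only the curve in U the claim fails, e.g. U = ℂ∖{c}, V = 1/(z−c), and Γ enclosing both the segment and c. *)

theory Defs
  imports "HOL-Probability.Probability" "HOL-Complex_Analysis.Complex_Analysis"
begin

text \<open>
  A point of \<open>\<real>\<^sup>N \<times> \<dots> \<times> \<real>\<^sup>k\<close> is a function \<open>y\<close> on the pairs \<open>(j, i)\<close> below, with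
  \<open>y (j, i)\<close> in the role of the \<open>i\<close>-th coordinate of the level \<open>j\<close>.
\<close>

definition array_index :: "nat \<Rightarrow> nat \<Rightarrow> (nat \<times> nat) set" where
  "array_index k N = (SIGMA j:{k..N}. {1..j})"

abbreviation array_lebesgue :: "nat \<Rightarrow> nat \<Rightarrow> (nat \<times> nat \<Rightarrow> real) measure" where
  "array_lebesgue k N \<equiv> \<Pi>\<^sub>M p\<in>array_index k N. (lborel :: real measure)"

definition interlacing :: "nat \<Rightarrow> nat \<Rightarrow> (nat \<times> nat \<Rightarrow> real) \<Rightarrow> bool" where
  "interlacing k N y \<longleftrightarrow>
     (\<forall>j\<in>{k..N}. \<forall>i\<in>{1..<j}. y (j, i) < y (j, i + 1)) \<and>
     (\<forall>j\<in>{k+1..N}. \<forall>i\<in>{1..j-1}. y (j, i) < y (j - 1, i) \<and> y (j - 1, i) < y (j, i + 1))"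

text \<open>
  All bases of \<open>powr\<close> are positive where the leading indicators do not vanish. There all the
  \<open>y (N, i)\<close> lie strictly between \<open>am\<close> and \<open>ap\<close>, where the potential is real; the values of
  \<open>V\<close> elsewhere do not affect the weight.
\<close>

definition array_weight ::
  "nat \<Rightarrow> nat \<Rightarrow> real \<Rightarrow> real \<Rightarrow> real \<Rightarrow> (complex \<Rightarrow> complex) \<Rightarrow> (nat \<times> nat \<Rightarrow> real) \<Rightarrow> real" where
  "array_weight N k am ap \<theta> V y =
     of_bool (interlacing k N y) * of_bool (am < y (N, 1) \<and> y (N, N) < ap) *
     (\<Prod>j=1..N. \<Prod>i=1..<j. y (N, j) - y (N, i)) *
     (\<Prod>j=1..k. \<Prod>i=1..<j. (y (k, j) - y (k, i)) powr (2 * \<theta> - 1)) *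
     (\<Prod>j=k..<N.
        (\<Prod>b=1..j. \<Prod>a=1..<b. (y (j, b) - y (j, a)) powr (2 - 2 * \<theta>)) *
        (\<Prod>a=1..j. \<Prod>b=1..j+1. \<bar>y (j, a) - y (j + 1, b)\<bar> powr (\<theta> - 1))) *
     (\<Prod>i=1..N. exp (- real N * \<theta> * Re (V (complex_of_real (y (N, i))))))"

text \<open>
  If the weight were not integrable, the normalization constant and the density would be \<open>0\<close>,
  and no random vector would have this density.
\<close>

definition array_norm_const ::
  "nat \<Rightarrow> nat \<Rightarrow> real \<Rightarrow> real \<Rightarrow> real \<Rightarrow> (complex \<Rightarrow> complex) \<Rightarrow> real" where
  "array_norm_const N k am ap \<theta> V = (LINT y|array_lebesgue k N. array_weight N k am ap \<theta> V y)"

definition array_density ::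
  "nat \<Rightarrow> nat \<Rightarrow> real \<Rightarrow> real \<Rightarrow> real \<Rightarrow> (complex \<Rightarrow> complex) \<Rightarrow> (nat \<times> nat \<Rightarrow> real) \<Rightarrow> real" where
  "array_density N k am ap \<theta> V y =
     array_weight N k am ap \<theta> V y / array_norm_const N k am ap \<theta> V"

text \<open>The derivative in the variables \<open>z 0, \<dots>, z (n - 1)\<close>, once in each.\<close>

primrec mixed_partial :: "nat \<Rightarrow> ((nat \<Rightarrow> complex) \<Rightarrow> complex) \<Rightarrow> (nat \<Rightarrow> complex) \<Rightarrow> complex" where
  "mixed_partial 0 F z = F z"
| "mixed_partial (Suc n) F z = deriv (\<lambda>w. mixed_partial n F (z(n := w))) (z n)"

text \<open>
  The principal branch is the right one: for \<open>z\<close> near \<open>0\<close> the expectation is near \<open>1\<close>.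
\<close>

definition joint_cumulant :: "'w measure \<Rightarrow> ('w \<Rightarrow> complex) list \<Rightarrow> complex" where
  "joint_cumulant M Xs =
     mixed_partial (length Xs)
       (\<lambda>z. Ln (LINT \<omega>|M. exp (\<Sum>i<length Xs. z i * (Xs ! i) \<omega>))) (\<lambda>_. 0)"

text \<open>
  The joint cumulant of \<open>\<xi>\<close> and the \<open>X p\<close> with \<open>p\<close> in the finite set \<open>J\<close>. Joint cumulants are
  symmetric in their arguments, so that the enumeration of \<open>J\<close> is immaterial.
\<close>

definition cumulant_with ::
  "'w measure \<Rightarrow> ('i \<Rightarrow> 'w \<Rightarrow> complex) \<Rightarrow> ('w \<Rightarrow> complex) \<Rightarrow> 'i set \<Rightarrow> complex" where
  "cumulant_with M X \<xi> J =
     joint_cumulant M (\<xi> # map X (SOME ps. distinct ps \<and> set ps = J))"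

definition array_stieltjes :: "('w \<Rightarrow> nat \<times> nat \<Rightarrow> real) \<Rightarrow> nat \<Rightarrow> complex \<Rightarrow> 'w \<Rightarrow> complex" where
  "array_stieltjes Y j z \<omega> = (\<Sum>i=1..j. 1 / (z - complex_of_real (Y \<omega> (j, i))))"

definition loop_observable ::
  "nat \<Rightarrow> nat \<Rightarrow> real \<Rightarrow> (complex \<Rightarrow> complex) \<Rightarrow> ('w \<Rightarrow> nat \<times> nat \<Rightarrow> real) \<Rightarrow>
     complex \<Rightarrow> 'w \<Rightarrow> complex" where
  "loop_observable N k \<theta> V Y z \<omega> =
     (let t = complex_of_real \<theta>;
          G = (\<lambda>j. array_stieltjes Y j z \<omega>);
          dG = (\<lambda>j. deriv (\<lambda>\<zeta>. array_stieltjes Y j \<zeta> \<omega>) z)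
      in - 2 * of_nat N * t * deriv V z * G N + t * dG N + t * (G N)\<^sup>2
         + (t - 2) * dG k + t * (G k)\<^sup>2
         + (\<Sum>j=k+1..N. - (t + 1) * dG j + (1 - t) * (G j - G (j - 1))\<^sup>2 + (1 - t) * dG (j - 1)))"

end

theory Submission
  imports Defs
begin

text \<open>
  Put \<open>H(z) = (z - a\<^sub>-) (z - a\<^sub>+) / (z - v)\<close>. On \<open>[a\<^sub>-, a\<^sub>+]\<close> the real and imaginary parts \<open>h\<close> of
  \<open>H\<close> vanish at both ends, so for small \<open>t\<close> the map \<open>x \<mapsto> x + t h(x)\<close> is an increasing bijection of
  the interval. Applied to all particles of all levels at once it preserves the interlacing, and
  the weight is multiplied by a factor that is smooth in \<open>t\<close>, uniformly in the configuration:
  \<open>y\<^sub>a - y\<^sub>b\<close> is multiplied by \<open>1 + t (h(y\<^sub>a) - h(y\<^sub>b)) / (y\<^sub>a - y\<^sub>b)\<close>. Differentiating the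
  substitution rule at \<open>t = 0\<close> therefore gives a Ward identity without boundary terms, for every
  \<open>\<theta>\<close>. By Cauchy's formula the difference quotients of \<open>H\<close> are contour integrals of
  \<open>H(z) / ((z - y\<^sub>a) (z - y\<^sub>b))\<close>, which turns the Ward identity into the vanishing of the contour
  integral of \<open>H(z)\<close> times mixed moments of the loop observable and of the Stieltjes transforms. Cumulants
  are determined by moments through a triangular recursion that this identity is compatible with.
\<close>

section \<open>Parameter integrals of holomorphic functions\<close>

text \<open>Exponents of the weight can be negative, so the weight may blow up where particles meet,
  and its logarithmic derivative has poles \<open>1 / (y_a - y_b)\<close> there. Integration by
  parts would need integrability and boundary estimates at these collisions. Transporting the
  configuration avoids them: the weight itself is never differentiated, only its quotient after and
  before the flow, in which every singular factor has cancelled.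

  The flow has to move real particles, so the Ward identity is proved for real fields and extended
  to \<open>H\<close> by complex linearity. A product of Stieltjes transforms is carried along as a
  test function; its derivative along the field produces the terms with
  \<open>1 / (z - v p)^2\<close> of the loop equation.

  With the moments \<open>b\<close> of the Stieltjes transforms held fixed, the cumulant recursion
  is linear in the moments \<open>a\<close> that contain the observable. Hence it commutes with
  contour integration in \<open>z\<close> and turns the family of moment identities, one for each
  subset of the indices, into one cumulant identity.\<close>

lemma holomorphic_second_order_remainder:
  fixes f :: "complex \<Rightarrow> complex"
  assumes "open S" and hol: "f holomorphic_on S" and sub: "cball z r \<subseteq> S" and "0 < r"
    and bd: "\<And>w. w \<in> cball z r \<Longrightarrow> norm (f w) \<le> B" and u: "norm u \<le> r / 2"
  shows "norm (f (z + u) - f z - u * deriv f z) \<le> 8 * B / r\<^sup>2 * (norm u)\<^sup>2"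
proof -
  define T where "T = cball z (r / 2)"
  have TS: "cball x (r / 2) \<subseteq> cball z r" if "x \<in> T" for x
    using that unfolding T_def by (metis cball_subset_cball_iff dist_commute field_sum_of_halves
        mem_cball add_le_cancel_right)
  have "T \<subseteq> S" using sub \<open>0 < r\<close> unfolding T_def by (auto simp: subset_iff)
  have der: "((deriv ^^ i) f has_field_derivative (deriv ^^ Suc i) f x) (at x within T)"
    if "x \<in> T" for i x
  proof -
    have "(deriv ^^ i) f holomorphic_on S"
      using hol \<open>open S\<close> by (rule holomorphic_higher_deriv)
    then show ?thesis
      using \<open>open S\<close> \<open>T \<subseteq> S\<close> that holomorphic_derivI[of "(deriv ^^ i) f" S x] DERIV_subset
      by fastforce
  qed
  have "norm (f (z + u) - (\<Sum>i\<le>1. (deriv ^^ i) f z * ((z + u) - z) ^ i / fact i))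
      \<le> (8 * B / r\<^sup>2) * norm ((z + u) - z) ^ Suc 1 / fact 1"
  proof (rule complex_Taylor[where f = "\<lambda>i. (deriv ^^ i) f" and S = T and n = 1, simplified funpow_0])
    show "convex T" by (simp add: T_def)
    show "norm ((deriv ^^ Suc 1) f x) \<le> 8 * B / r\<^sup>2" if "x \<in> T" for x
    proof -
      \<comment> \<open>Cauchy's estimate on a disc of radius \<open>r / 2\<close> about a point of
        the half-size disc gives \<open>2 B / (r / 2)^2\<close>, the source of the 8. The constant
        depends on \<open>B\<close> and \<open>r\<close> alone; this uniformity is what all later
        expansions rest on.\<close>
      have "norm ((deriv ^^ 2) f x) \<le> fact 2 * B / (r / 2) ^ 2"
      proof (rule Cauchy_inequality)
        show "f holomorphic_on ball x (r / 2)"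
          using TS[OF that] sub hol by (meson ball_subset_cball holomorphic_on_subset subset_trans)
        show "continuous_on (cball x (r / 2)) f"
          using TS[OF that] sub hol by (meson holomorphic_on_imp_continuous_on holomorphic_on_subset subset_trans)
        show "norm (f y) \<le> B" if "norm (x - y) = r / 2" for y
          using bd TS[OF \<open>x \<in> T\<close>] that by (metis dist_norm mem_cball order_refl subset_iff)
      qed (use \<open>0 < r\<close> in auto)
      then show ?thesis by (simp add: numeral_2_eq_2 field_simps)
    qed
    show "z \<in> T" "z + u \<in> T" using u \<open>0 < r\<close> by (auto simp: T_def dist_norm)
  qed (use der in auto)
  then show ?thesis by (simp add: power2_eq_square algebra_simps)
qed

lemma has_field_derivative_if_quadratic_remainder:
  fixes F :: "'a::real_normed_field \<Rightarrow> 'a"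
  assumes "0 < r" and rem: "\<And>u. norm u \<le> r \<Longrightarrow> norm (F (z + u) - F z - u * D) \<le> C * (norm u)\<^sup>2"
  shows "(F has_field_derivative D) (at z)"
proof -
  have "((\<lambda>h. (F (z + h) - F z) / h - D) \<longlongrightarrow> 0) (at 0)"
  proof (rule Lim_null_comparison)
    show "\<forall>\<^sub>F h in at 0. norm ((F (z + h) - F z) / h - D) \<le> C * norm h"
    proof (rule eventually_at_ball'[OF \<open>0 < r\<close>, THEN eventually_mono])
      fix h :: 'a assume h: "h \<in> ball 0 r \<and> h \<noteq> 0 \<and> h \<in> UNIV"
      then have "(F (z + h) - F z) / h - D = (F (z + h) - F z - h * D) / h"
        by (simp add: field_simps)
      then show "norm ((F (z + h) - F z) / h - D) \<le> C * norm h"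
        using rem[of h] h by (simp add: norm_divide divide_simps power2_eq_square ac_simps)
    qed
    show "((\<lambda>h::'a. C * norm h) \<longlongrightarrow> 0) (at 0)"
      by (auto intro!: tendsto_eq_intros)
  qed
  then show ?thesis
    by (simp add: DERIV_def LIM_zero_iff)
qed

text \<open>The quadratic remainder bound is the same for all \<open>\<omega>\<close>, so it
  survives integration and gives the derivative without dominated convergence. The derivative is
  measurable as the limit of difference quotients along a sequence inside the disc.\<close>

lemma (in finite_measure)
  fixes f :: "complex \<Rightarrow> 'a \<Rightarrow> complex"
  assumes "open S" and hol: "\<And>\<omega>. \<omega> \<in> space M \<Longrightarrow> (\<lambda>z. f z \<omega>) holomorphic_on S"
    and meas: "\<And>z. z \<in> S \<Longrightarrow> f z \<in> borel_measurable M"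
    and sub: "cball z r \<subseteq> S" and "0 < r"
    and bd: "\<And>w \<omega>. w \<in> cball z r \<Longrightarrow> \<omega> \<in> space M \<Longrightarrow> norm (f w \<omega>) \<le> B"
  shows borel_measurable_deriv_parameter: "(\<lambda>\<omega>. deriv (\<lambda>w. f w \<omega>) z) \<in> borel_measurable M"
    and has_field_derivative_integral_parameter:
      "((\<lambda>w. LINT \<omega>|M. f w \<omega>) has_field_derivative (LINT \<omega>|M. deriv (\<lambda>w. f w \<omega>) z)) (at z)"
proof -
  have zS: "z \<in> S" using sub \<open>0 < r\<close> by auto
  define s where "s n = complex_of_real (r / (real n + 2))" for n
  have s: "norm (s n) \<le> r" "s n \<noteq> 0" for n
  proof -
    have "norm (s n) = r / (real n + 2)" using \<open>0 < r\<close> by (simp add: s_def del: of_real_divide)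
    also have "\<dots> \<le> r / 1" using \<open>0 < r\<close> by (intro divide_left_mono) auto
    finally show "norm (s n) \<le> r" by simp
    show "s n \<noteq> 0"
      using \<open>0 < r\<close> unfolding s_def of_real_eq_0_iff by (simp add: add_nonneg_eq_0_iff)
  qed
  have sS: "z + s n \<in> S" for n
    using s[of n] sub by (auto simp: dist_norm subset_iff)
  have s0: "s \<longlonglongrightarrow> 0"
  proof -
    have "(\<lambda>n. r / (real n + 2)) \<longlonglongrightarrow> 0" by real_asymp
    then show ?thesis unfolding s_def by (metis of_real_0 tendsto_of_real)
  qed
  show m: "(\<lambda>\<omega>. deriv (\<lambda>w. f w \<omega>) z) \<in> borel_measurable M"
  proof (rule borel_measurable_LIMSEQ_metric)
    show "(\<lambda>\<omega>. (f (z + s n) \<omega> - f z \<omega>) / s n) \<in> borel_measurable M" for n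
      using meas[OF sS] meas[OF zS] by measurable
    fix \<omega> assume "\<omega> \<in> space M"
    then have "((\<lambda>h. (f (z + h) \<omega> - f z \<omega>) / h) \<longlongrightarrow> deriv (\<lambda>w. f w \<omega>) z) (at 0)"
      using holomorphic_derivI[OF hol \<open>open S\<close> zS, of \<omega> UNIV] by (simp add: DERIV_def)
    moreover have "filterlim s (at 0) sequentially"
      using s0 s by (simp add: filterlim_at)
    ultimately show "(\<lambda>n. (f (z + s n) \<omega> - f z \<omega>) / s n) \<longlonglongrightarrow> deriv (\<lambda>w. f w \<omega>) z"
      by (rule filterlim_compose)
  qed
  have dbd: "norm (deriv (\<lambda>w. f w \<omega>) z) \<le> B / r" if "\<omega> \<in> space M" for \<omega>
  proof -
    have "norm ((deriv ^^ 1) (\<lambda>w. f w \<omega>) z) \<le> fact 1 * B / r ^ 1"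
    proof (rule Cauchy_inequality)
      show "(\<lambda>w. f w \<omega>) holomorphic_on ball z r"
        using sub hol[OF that] by (meson ball_subset_cball holomorphic_on_subset subset_trans)
      show "continuous_on (cball z r) (\<lambda>w. f w \<omega>)"
        using sub hol[OF that] by (meson holomorphic_on_imp_continuous_on holomorphic_on_subset)
    qed (use bd that \<open>0 < r\<close> in \<open>auto simp: dist_norm\<close>)
    then show ?thesis by simp
  qed
  have int: "integrable M (f w)" if "w \<in> cball z r" for w
    using that sub by (intro integrable_const_bound[where B = B] AE_I2 bd meas) auto
  have dint: "integrable M (\<lambda>\<omega>. deriv (\<lambda>w. f w \<omega>) z)"
    by (rule integrable_const_bound[where B = "B / r"]) (use dbd m in auto)
  show "((\<lambda>w. LINT \<omega>|M. f w \<omega>) has_field_derivative (LINT \<omega>|M. deriv (\<lambda>w. f w \<omega>) z)) (at z)"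
  proof (rule has_field_derivative_if_quadratic_remainder)
    show "0 < r / 2" using \<open>0 < r\<close> by simp
    fix u :: complex assume u: "norm u \<le> r / 2"
    have uc: "z + u \<in> cball z r" "z \<in> cball z r"
      using u \<open>0 < r\<close> by (auto simp: dist_norm)
    have "(LINT \<omega>|M. f (z + u) \<omega>) - (LINT \<omega>|M. f z \<omega>) - u * (LINT \<omega>|M. deriv (\<lambda>w. f w \<omega>) z)
      = (LINT \<omega>|M. f (z + u) \<omega> - f z \<omega> - u * deriv (\<lambda>w. f w \<omega>) z)"
      using int[OF uc(1)] int[OF uc(2)] dint by simp
    also have "norm \<dots> \<le> (LINT \<omega>|M. 8 * B / r\<^sup>2 * (norm u)\<^sup>2)"
    proof (rule order_trans[OF integral_norm_bound integral_mono])
      show "norm (f (z + u) \<omega> - f z \<omega> - u * deriv (\<lambda>w. f w \<omega>) z) \<le> 8 * B / r\<^sup>2 * (norm u)\<^sup>2"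
        if "\<omega> \<in> space M" for \<omega>
        by (rule holomorphic_second_order_remainder[OF \<open>open S\<close> hol[OF that] sub \<open>0 < r\<close> _ u])
          (use bd that in auto)
    qed (use int[OF uc(1)] int[OF uc(2)] dint in auto)
    finally show "norm ((LINT \<omega>|M. f (z + u) \<omega>) - (LINT \<omega>|M. f z \<omega>)
        - u * (LINT \<omega>|M. deriv (\<lambda>w. f w \<omega>) z))
      \<le> (8 * B / r\<^sup>2 * measure M (space M)) * (norm u)\<^sup>2"
      by (simp add: ac_simps)
  qed
qed

text \<open>The function is the limit of its sections over the countable grids \<open>\<lfloor>n t\<rfloor> / n\<close>.\<close>

lemma borel_measurable_pair_continuous_fst:
  fixes F :: "real \<Rightarrow> 'a \<Rightarrow> 'b::metric_space"
  assumes meas: "\<And>t. F t \<in> borel_measurable M"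
    and cont: "\<And>\<omega>. \<omega> \<in> space M \<Longrightarrow> continuous_on UNIV (\<lambda>t. F t \<omega>)"
  shows "(\<lambda>(t, \<omega>). F t \<omega>) \<in> borel_measurable (borel \<Otimes>\<^sub>M M)"
proof -
  define G where "G n = (\<lambda>p. F (real_of_int \<lfloor>real (Suc n) * fst p\<rfloor> / real (Suc n)) (snd p))"
    for n :: nat
  have "(\<lambda>p. F (fst p) (snd p)) \<in> borel_measurable (borel \<Otimes>\<^sub>M M)"
  proof (rule borel_measurable_LIMSEQ_metric)
    fix n
    show "G n \<in> borel_measurable (borel \<Otimes>\<^sub>M M)"
      unfolding G_def
    proof (rule measurable_compose_countable[where
          f = "\<lambda>i p. F (real_of_int i / real (Suc n)) (snd p)"])
      show "(\<lambda>p. F (real_of_int i / real (Suc n)) (snd p)) \<in> borel_measurable (borel \<Otimes>\<^sub>M M)" for i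
        using meas by (rule measurable_compose[OF measurable_snd])
      show "(\<lambda>p::real \<times> 'a. \<lfloor>real (Suc n) * fst p\<rfloor>) \<in> borel \<Otimes>\<^sub>M M \<rightarrow>\<^sub>M count_space UNIV"
        by measurable
    qed
  next
    fix p :: "real \<times> 'a" assume "p \<in> space (borel \<Otimes>\<^sub>M M)"
    then have "snd p \<in> space M" by (auto simp: space_pair_measure)
    then have "isCont (\<lambda>t. F t (snd p)) (fst p)"
      using cont by (simp add: continuous_on_eq_continuous_at)
    moreover have "(\<lambda>n. real_of_int \<lfloor>real (Suc n) * fst p\<rfloor> / real (Suc n)) \<longlonglongrightarrow> fst p"
    proof (rule LIMSEQ_I)
      fix e :: real assume "0 < e"
      then obtain m where m: "inverse (real (Suc m)) < e" using reals_Archimedean by blast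
      show "\<exists>no. \<forall>n\<ge>no. norm (real_of_int \<lfloor>real (Suc n) * fst p\<rfloor> / real (Suc n) - fst p) < e"
      proof (intro exI allI impI)
        fix n assume "m \<le> n"
        have "\<bar>real_of_int \<lfloor>real (Suc n) * fst p\<rfloor> - real (Suc n) * fst p\<bar> \<le> 1"
          by linarith
        then have "\<bar>real_of_int \<lfloor>real (Suc n) * fst p\<rfloor> - real (Suc n) * fst p\<bar> / real (Suc n) \<le> 1 / real (Suc n)"
          by (intro divide_right_mono) auto
        also have "\<bar>real_of_int \<lfloor>real (Suc n) * fst p\<rfloor> - real (Suc n) * fst p\<bar> / real (Suc n)
            = \<bar>(real_of_int \<lfloor>real (Suc n) * fst p\<rfloor> - real (Suc n) * fst p) / real (Suc n)\<bar>"
          by (simp add: abs_divide)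
        also have "(real_of_int \<lfloor>real (Suc n) * fst p\<rfloor> - real (Suc n) * fst p) / real (Suc n)
            = real_of_int \<lfloor>real (Suc n) * fst p\<rfloor> / real (Suc n) - fst p"
          by (simp only: diff_divide_distrib) simp
        also have "1 / real (Suc n) \<le> inverse (real (Suc m))"
          using \<open>m \<le> n\<close> by (simp add: field_simps)
        finally show "norm (real_of_int \<lfloor>real (Suc n) * fst p\<rfloor> / real (Suc n) - fst p) < e"
          using m by simp
      qed
    qed
    ultimately show "(\<lambda>n. G n p) \<longlonglongrightarrow> F (fst p) (snd p)"
      unfolding G_def by (rule isCont_tendsto_compose)
  qed
  then show ?thesis by (simp add: case_prod_beta')
qed

lemma bounded_on_compact_if_locally_bounded:
  fixes f :: "'a::metric_space \<Rightarrow> 'b \<Rightarrow> 'c::real_normed_vector"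
  assumes "compact K"
    and loc: "\<And>z. z \<in> K \<Longrightarrow> \<exists>r>0. \<exists>B. \<forall>w\<in>cball z r. \<forall>\<omega>\<in>A. norm (f w \<omega>) \<le> B"
  shows "\<exists>B. \<forall>z\<in>K. \<forall>\<omega>\<in>A. norm (f z \<omega>) \<le> B"
proof -
  obtain r B where rB: "\<And>z. z \<in> K \<Longrightarrow> 0 < r z"
      "\<And>z w \<omega>. z \<in> K \<Longrightarrow> w \<in> cball z (r z) \<Longrightarrow> \<omega> \<in> A \<Longrightarrow> norm (f w \<omega>) \<le> B z"
    using loc by metis
  have "K \<subseteq> (\<Union>c\<in>K. ball c (r c))"
    using rB(1) by auto
  then obtain C where C: "C \<subseteq> K" "finite C" "K \<subseteq> (\<Union>c\<in>C. ball c (r c))"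
    using compactE_image[OF \<open>compact K\<close>, of K "\<lambda>z. ball z (r z)"] by (metis open_ball)
  \<comment> \<open>The sum of the absolute values of the local bounds dominates each of them and
    makes sense for an empty cover too.\<close>
  have "norm (f z \<omega>) \<le> (\<Sum>c\<in>C. \<bar>B c\<bar>)" if zw: "z \<in> K" "\<omega> \<in> A" for z \<omega>
  proof -
    obtain c where c: "c \<in> C" "z \<in> ball c (r c)"
      using C(3) zw(1) by blast
    then have "norm (f z \<omega>) \<le> \<bar>B c\<bar>"
      using rB(2)[of c z \<omega>] C(1) zw by (auto intro: order_trans[OF _ abs_ge_self])
    also have "\<dots> \<le> (\<Sum>c\<in>C. \<bar>B c\<bar>)"
      using c C(2) by (intro member_le_sum) auto
    finally show ?thesis .
  qed
  then show ?thesis by blast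
qed

text \<open>
  A valid path need not be rectifiable. Fubini's theorem is applied to a nearby polynomial path,
  on which the integrals of all holomorphic functions are the same.
\<close>

lemma (in finite_measure) has_contour_integral_expectation:
  fixes f :: "complex \<Rightarrow> 'a \<Rightarrow> complex"
  assumes "open S" and hol: "\<And>\<omega>. \<omega> \<in> space M \<Longrightarrow> (\<lambda>z. f z \<omega>) holomorphic_on S"
    and meas: "\<And>z. z \<in> S \<Longrightarrow> f z \<in> borel_measurable M"
    and loc: "\<And>z. z \<in> S \<Longrightarrow> \<exists>r>0. \<exists>B. \<forall>w\<in>cball z r. \<forall>\<omega>\<in>space M. norm (f w \<omega>) \<le> B"
    and \<gamma>: "valid_path \<gamma>" "path_image \<gamma> \<subseteq> S"
    and I: "\<And>\<omega>. \<omega> \<in> space M \<Longrightarrow> ((\<lambda>z. f z \<omega>) has_contour_integral I \<omega>) \<gamma>"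
  shows "((\<lambda>z. LINT \<omega>|M. f z \<omega>) has_contour_integral (LINT \<omega>|M. I \<omega>)) \<gamma>"
    and "integrable M I"
proof -
  have Ehol: "(\<lambda>z. LINT \<omega>|M. f z \<omega>) holomorphic_on S"
  proof -
    have "(\<lambda>z. LINT \<omega>|M. f z \<omega>) field_differentiable (at z)" if z: "z \<in> S" for z
    proof -
      obtain r B where r: "0 < r" "\<And>w \<omega>. w \<in> cball z r \<Longrightarrow> \<omega> \<in> space M \<Longrightarrow> norm (f w \<omega>) \<le> B"
        using loc[OF z] by blast
      obtain s where s: "0 < s" "cball z s \<subseteq> S"
        using \<open>open S\<close> z open_contains_cball by blast
      show ?thesis
        using has_field_derivative_integral_parameter[OF \<open>open S\<close> hol meas, of z "min r s" B] r s
        unfolding field_differentiable_def by (fastforce simp: subset_iff)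
    qed
    then show ?thesis by (simp add: field_differentiable_at_within holomorphic_on_def)
  qed
  obtain d where "0 < d" and d: "\<And>g h. \<lbrakk>valid_path g; valid_path h;
      \<forall>t\<in>{0..1}. norm (g t - \<gamma> t) < d \<and> norm (h t - \<gamma> t) < d;
      pathstart h = pathstart g; pathfinish h = pathfinish g\<rbrakk>
      \<Longrightarrow> path_image h \<subseteq> S \<and> (\<forall>f. f holomorphic_on S \<longrightarrow> contour_integral h f = contour_integral g f)"
    using contour_integral_nearby_ends[OF \<open>open S\<close> valid_path_imp_path[OF \<gamma>(1)] \<gamma>(2)] by metis
  obtain p where p: "polynomial_function p" "pathstart p = pathstart \<gamma>" "pathfinish p = pathfinish \<gamma>"
      "\<And>t. t \<in> {0..1} \<Longrightarrow> norm (p t - \<gamma> t) < d"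
    using path_approx_polynomial_function[OF valid_path_imp_path[OF \<gamma>(1)] \<open>0 < d\<close>] by blast
  have vp: "valid_path p" using p(1) valid_path_polynomial_function by blast
  have pS: "path_image p \<subseteq> S"
    and eq: "\<And>f. f holomorphic_on S \<Longrightarrow> contour_integral p f = contour_integral \<gamma> f"
    using d[OF \<gamma>(1) vp] p \<open>0 < d\<close> by auto
  obtain p' where p': "polynomial_function p'" "\<And>x. (p has_vector_derivative (p' x)) (at x)"
    using has_vector_derivative_polynomial_function[OF p(1)] by blast
  have cp: "continuous_on UNIV p" "continuous_on UNIV p'"
    using p(1) p'(1) continuous_on_polymonial_function by blast+
  \<comment> \<open>Clamping the time to the unit interval extends the integrand continuously to the
    whole line, which the joint measurability lemma asks for, and changes nothing on the interval
    itself.\<close>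
  define c where "c t = max 0 (min 1 t)" for t :: real
  have c: "c t \<in> {0..1}" for t by (auto simp: c_def)
  have c_id: "c t = t" if "t \<in> {0..1}" for t using that by (auto simp: c_def)
  have cc: "continuous_on A c" for A by (auto simp: c_def intro!: continuous_intros)
  have pcS: "p (c t) \<in> S" for t
    using pS c[of t] unfolding path_image_def by blast
  define F where "F t \<omega> = f (p (c t)) \<omega> * p' (c t)" for t \<omega>
  have Fcont: "continuous_on UNIV (\<lambda>t. F t \<omega>)" if "\<omega> \<in> space M" for \<omega>
  proof -
    have "continuous_on UNIV (\<lambda>t. f (p (c t)) \<omega>)"
      by (rule continuous_on_compose2[OF holomorphic_on_imp_continuous_on[OF hol[OF that]]
            continuous_on_compose2[OF cp(1) cc]]) (use pcS in auto)
    then show ?thesis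
      unfolding F_def by (intro continuous_on_mult continuous_on_compose2[OF cp(2) cc]) auto
  qed
  have Fmeas: "F t \<in> borel_measurable M" for t
    unfolding F_def using meas[OF pcS] by measurable
  have Fm2: "(\<lambda>(t, \<omega>). F t \<omega>) \<in> borel_measurable (lborel \<Otimes>\<^sub>M M)"
    using borel_measurable_pair_continuous_fst[OF Fmeas Fcont]
    by (simp cong: measurable_cong_sets sets_pair_measure_cong)
  obtain B1 where B1: "\<And>z \<omega>. z \<in> path_image p \<Longrightarrow> \<omega> \<in> space M \<Longrightarrow> norm (f z \<omega>) \<le> B1"
    using bounded_on_compact_if_locally_bounded[of "path_image p" "space M" f] loc pS
      compact_valid_path_image[OF vp] by (metis subsetD)
  obtain B2 where B2: "\<And>t. norm (p' (c t)) \<le> B2"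
  proof -
    have "bounded (p' ` {0..1})"
      using cp(2) by (meson compact_Icc compact_continuous_image compact_imp_bounded continuous_on_subset top_greatest)
    then show ?thesis using that c by (force simp: bounded_iff)
  qed
  have Fbd: "norm (F t \<omega>) \<le> \<bar>B1\<bar> * \<bar>B2\<bar>" if "\<omega> \<in> space M" for t \<omega>
  proof -
    have "norm (f (p (c t)) \<omega>) \<le> \<bar>B1\<bar>"
      using B1[of "p (c t)" \<omega>] c[of t] that by (auto simp: path_image_def)
    moreover have "norm (p' (c t)) \<le> \<bar>B2\<bar>" using B2[of t] by linarith
    ultimately show ?thesis unfolding F_def norm_mult by (intro mult_mono) auto
  qed
  interpret P: pair_sigma_finite lborel M ..
  have Fint: "integrable (lborel \<Otimes>\<^sub>M M) (\<lambda>(t, \<omega>). indicator {0..1} t *\<^sub>R F t \<omega>)"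
  proof (rule integrableI_bounded_set[where A = "{0..1} \<times> space M" and B = "\<bar>B1\<bar> * \<bar>B2\<bar>"])
    show "{0..1::real} \<times> space M \<in> sets (lborel \<Otimes>\<^sub>M M)"
      by (intro pair_measureI) auto
    show "(\<lambda>(t, \<omega>). indicator {0..1} t *\<^sub>R F t \<omega>) \<in> borel_measurable (lborel \<Otimes>\<^sub>M M)"
      using Fm2 by measurable
    show "emeasure (lborel \<Otimes>\<^sub>M M) ({0..1::real} \<times> space M) < \<infinity>"
      by (simp add: emeasure_pair_measure_Times less_top[symmetric] ennreal_mult_eq_top_iff)
    show "AE x in lborel \<Otimes>\<^sub>M M. x \<in> {0..1} \<times> space M \<longrightarrow>
        norm (case x of (t, \<omega>) \<Rightarrow> indicator {0..1} t *\<^sub>R F t \<omega>) \<le> \<bar>B1\<bar> * \<bar>B2\<bar>"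
      using Fbd by (intro AE_I2) (auto simp: indicator_def)
    show "AE x in lborel \<Otimes>\<^sub>M M. x \<notin> {0..1} \<times> space M \<longrightarrow>
        (case x of (t, \<omega>) \<Rightarrow> indicator {0..1} t *\<^sub>R F t \<omega>) = 0"
      by (intro AE_I2) (auto simp: space_pair_measure indicator_def)
  qed
  \<comment> \<open>One path \<open>p\<close> represents the integrals over \<open>\<gamma>\<close>
    of all holomorphic functions on \<open>S\<close>, hence those of every sample function and of
    their expectation. Only on this smooth path is Fubini used.\<close>
  have val: "contour_integral \<gamma> g = (LINT t|lborel. indicator {0..1} t *\<^sub>R (g (p (c t)) * p' (c t)))"
    if g: "g holomorphic_on S" for g
  proof -
    have "contour_integral \<gamma> g = integral {0..1} (\<lambda>t. g (p t) * vector_derivative p (at t))"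
      using eq[OF g] by (simp add: contour_integral_integral)
    also have "\<dots> = integral {0..1} (\<lambda>t. g (p (c t)) * p' (c t))"
      by (rule integral_cong) (simp add: c_id vector_derivative_at[OF p'(2)])
    also have "\<dots> = (LINT t:{0..1}|lborel. g (p (c t)) * p' (c t))"
    proof (rule set_borel_integral_eq_integral(2)[symmetric])
      have "continuous_on {0..1} (\<lambda>t. g (p (c t)))"
        by (rule continuous_on_compose2[OF holomorphic_on_imp_continuous_on[OF g]
            continuous_on_compose2[OF cp(1) cc]]) (use pcS in auto)
      moreover have "continuous_on {0..1} (\<lambda>t. p' (c t))"
        by (rule continuous_on_compose2[OF cp(2) cc]) auto
      ultimately show "set_integrable lborel {0..1} (\<lambda>t. g (p (c t)) * p' (c t))"
        by (intro 
            borel_integrable_atLeastAtMost' continuous_on_mult)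
    qed
    finally show ?thesis by (simp add: set_lebesgue_integral_def)
  qed
  have FI: "(LINT t|lborel. indicator {0..1} t *\<^sub>R F t \<omega>) = I \<omega>" if w: "\<omega> \<in> space M" for \<omega>
  proof -
    have "I \<omega> = contour_integral \<gamma> (\<lambda>z. f z \<omega>)"
      using I[OF w] by (simp add: contour_integral_unique)
    then show ?thesis
      using val[OF hol[OF w]] by (simp add: F_def)
  qed
  show "integrable M I"
    using P.integrable_snd[OF Fint] FI by (simp cong: Bochner_Integration.integrable_cong)
  have "contour_integral \<gamma> (\<lambda>z. LINT \<omega>|M. f z \<omega>)
      = (LINT t|lborel. LINT \<omega>|M. indicator {0..1} t *\<^sub>R F t \<omega>)"
    unfolding val[OF Ehol] F_def by simp
  also have "\<dots> = (LINT \<omega>|M. LINT t|lborel. indicator {0..1} t *\<^sub>R F t \<omega>)"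
    using P.Fubini_integral[OF Fint] by simp
  also have "\<dots> = (LINT \<omega>|M. I \<omega>)"
    by (rule Bochner_Integration.integral_cong) (use FI in auto)
  finally have "contour_integral \<gamma> (\<lambda>z. LINT \<omega>|M. f z \<omega>) = (LINT \<omega>|M. I \<omega>)" .
  moreover have "(\<lambda>z. LINT \<omega>|M. f z \<omega>) contour_integrable_on \<gamma>"
    using contour_integrable_holomorphic_simple[OF Ehol \<open>open S\<close> \<gamma>] .
  ultimately show "((\<lambda>z. LINT \<omega>|M. f z \<omega>) has_contour_integral (LINT \<omega>|M. I \<omega>)) \<gamma>"
    by (metis has_contour_integral_integral)
qed

section \<open>Joint cumulants and moments\<close>

text \<open>
  With \<open>a I\<close> the mixed moment of \<open>\<xi>\<close> and the \<open>X p\<close>, \<open>p \<in> I\<close>, and \<open>b I\<close> that of the \<open>X p\<close> alone,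
  this is the joint cumulant of \<open>\<xi>\<close> and the \<open>X p\<close>, \<open>p \<in> J\<close>. The recursion is Leibniz' rule
  for the mixed derivatives of \<open>a = (a / b) b\<close>, where \<open>a / b\<close> is the logarithmic derivative of
  the moment generating function in the direction of \<open>\<xi>\<close>.
\<close>

function cumulant_of_moments :: "('i set \<Rightarrow> complex) \<Rightarrow> ('i set \<Rightarrow> complex) \<Rightarrow> 'i set \<Rightarrow> complex" where
  "cumulant_of_moments a b J =
     (a J - (\<Sum>I | I \<subset> J \<and> finite J. cumulant_of_moments a b I * b (J - I))) / b {}"
  by auto
termination
  by (relation "Wellfounded.measure (\<lambda>(a, b, J). card J)") (auto intro: psubset_card_mono)

declare cumulant_of_moments.simps [simp del]

text \<open>The condition \<open>finite J\<close> inside the recursive sum serves termination: it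
  makes \<open>card\<close> decrease strictly. Under finiteness it drops out here.\<close>

lemma cumulant_of_moments_psubset:
  "finite J \<Longrightarrow> cumulant_of_moments a b J =
     (a J - (\<Sum>I | I \<subset> J. cumulant_of_moments a b I * b (J - I))) / b {}"
  by (subst cumulant_of_moments.simps) simp

lemma Pow_eq_insert_psubsets: "Pow J = insert J {I. I \<subset> J}"
  by auto

lemma moment_eq_sum_cumulants:
  assumes "finite J" "b {} \<noteq> 0"
  shows "a J = (\<Sum>I\<in>Pow J. cumulant_of_moments a b I * b (J - I))"
proof -
  have "finite {I. I \<subset> J}" using assms(1) by (auto intro: finite_subset[of _ "Pow J"])
  then show ?thesis
    using assms by (simp add: Pow_eq_insert_psubsets cumulant_of_moments_psubset[of J])
qed

lemma sum_Pow_insert: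
  fixes f :: "'i set \<Rightarrow> 'a::comm_monoid_add"
  assumes "finite J" "p \<notin> J"
  shows "sum f (Pow (insert p J)) = (\<Sum>I\<in>Pow J. f I + f (insert p I))"
proof -
  have "sum f (Pow (insert p J)) = sum f (Pow J) + sum f (insert p ` Pow J)"
    unfolding Pow_insert using assms by (intro sum.union_disjoint) auto
  also have "sum f (insert p ` Pow J) = (\<Sum>I\<in>Pow J. f (insert p I))"
    using assms(2) by (subst sum.reindex) (auto simp: inj_on_def)
  finally show ?thesis by (simp add: sum.distrib)
qed

text \<open>Inserting \<open>p\<close> into every moment is what differentiation in the variable of
  \<open>X p\<close> does to moments weighted by an exponential; the cumulants inherit the rule.
  Differentiate the recursion and compare with the expansion of the moment of
  \<open>insert p J\<close>, whose subsets come in pairs \<open>I\<close>,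
  \<open>insert p I\<close>. The pair with \<open>I = J\<close> accounts for the derivative of the
  denominator \<open>b {}\<close> and for the new cumulant.\<close>

lemma has_field_derivative_cumulant_of_moments:
  fixes a b :: "complex \<Rightarrow> 'i set \<Rightarrow> complex"
  assumes "finite J" "p \<notin> J" "b w {} \<noteq> 0"
    and "\<And>I. I \<subseteq> J \<Longrightarrow> ((\<lambda>w. a w I) has_field_derivative a w (insert p I)) (at w)"
    and "\<And>I. I \<subseteq> J \<Longrightarrow> ((\<lambda>w. b w I) has_field_derivative b w (insert p I)) (at w)"
  shows "((\<lambda>w. cumulant_of_moments (a w) (b w) J) has_field_derivative
           cumulant_of_moments (a w) (b w) (insert p J)) (at w)"
  using assms
proof (induction J rule: finite_psubset_induct)
  case (psubset J)
  define k where "k I = cumulant_of_moments (a w) (b w) I" for I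
  define s where "s = (\<Sum>I | I \<subset> J. k I * b w (J - I))"
  define s' where "s' = (\<Sum>I | I \<subset> J. k (insert p I) * b w (J - I) + b w (insert p (J - I)) * k I)"
  have ds: "((\<lambda>w. \<Sum>I | I \<subset> J. cumulant_of_moments (a w) (b w) I * b w (J - I)) has_field_derivative s')
      (at w)"
    unfolding s'_def k_def
  proof (intro DERIV_sum DERIV_mult)
    fix I assume "I \<in> {I. I \<subset> J}"
    then show "((\<lambda>w. cumulant_of_moments (a w) (b w) I) has_field_derivative
           cumulant_of_moments (a w) (b w) (insert p I)) (at w)"
      using psubset.prems by (intro psubset.IH) auto
    show "((\<lambda>w. b w (J - I)) has_field_derivative b w (insert p (J - I))) (at w)"
      using psubset.prems by auto
  qed
  have fin: "finite {I. I \<subset> J}" "finite (insert p J)"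
    using psubset.hyps by (auto intro: finite_subset[of _ "Pow J"])
  have "((\<lambda>w. cumulant_of_moments (a w) (b w) J) has_field_derivative
      ((a w (insert p J) - s') * b w {} - (a w J - s) * b w {p}) / (b w {} * b w {})) (at w)"
    unfolding cumulant_of_moments_psubset[OF psubset.hyps] s_def k_def
    using psubset.prems ds by (intro DERIV_divide DERIV_diff) auto
  moreover have "a w J - s = k J * b w {}"
    using psubset.prems(2) by (simp add: k_def s_def cumulant_of_moments_psubset[OF psubset.hyps])
  moreover have "a w (insert p J) - s' = k J * b w {p} + k (insert p J) * b w {}"
  proof -
    have "a w (insert p J) = (\<Sum>I\<in>Pow J. k I * b w (insert p J - I) + k (insert p I) * b w (insert p J - insert p I))"
      unfolding k_def
      by (subst moment_eq_sum_cumulants[where b = "b w" and a = "a w" and J = "insert p J"])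
        (use psubset fin in \<open>auto simp: sum_Pow_insert\<close>)
    also have "\<dots> = (\<Sum>I\<in>Pow J. k (insert p I) * b w (J - I) + b w (insert p (J - I)) * k I)"
    proof (rule sum.cong)
      fix I assume "I \<in> Pow J"
      then have "insert p J - I = insert p (J - I)" "insert p J - insert p I = J - I"
        using \<open>p \<notin> J\<close> by auto
      then show "k I * b w (insert p J - I) + k (insert p I) * b w (insert p J - insert p I)
          = k (insert p I) * b w (J - I) + b w (insert p (J - I)) * k I" by simp
    qed simp
    also have "\<dots> = k (insert p J) * b w {} + b w {p} * k J + s'"
      unfolding Pow_eq_insert_psubsets s'_def using fin by simp
    finally show ?thesis by simp
  qed
  ultimately have "((\<lambda>w. cumulant_of_moments (a w) (b w) J) has_field_derivative
      ((k J * b w {p} + k (insert p J) * b w {}) * b w {} - k J * b w {} * b w {p}) / (b w {} * b w {})) (at w)"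
    by simp
  also have "((k J * b w {p} + k (insert p J) * b w {}) * b w {} - k J * b w {} * b w {p}) / (b w {} * b w {})
      = k (insert p J)"
    using psubset.prems(2) by (simp add: field_simps)
  finally show ?case by (simp add: k_def)
qed

text \<open>Expand \<open>a J\<close> and all \<open>d p (J - {p})\<close> into cumulants and swap
  the sums over \<open>p\<close> and \<open>I\<close>. With \<open>K I\<close> for the left side of
  the claim at \<open>I\<close>, this gives that the sum of \<open>K I * b (J - I)\<close> over
  \<open>I\<close> in \<open>Pow J\<close> is 0. By induction only \<open>I = J\<close> survives,
  and \<open>b {}\<close> can be cancelled.\<close>

lemma cumulant_of_moments_Ward:
  fixes a b :: "'i set \<Rightarrow> complex" and d :: "'i \<Rightarrow> 'i set \<Rightarrow> complex"
  assumes "finite J" "b {} \<noteq> 0"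
    and "\<And>I. I \<subseteq> J \<Longrightarrow> a I + (\<Sum>p\<in>I. d p (I - {p})) = 0"
  shows "cumulant_of_moments a b J + (\<Sum>p\<in>J. cumulant_of_moments (d p) b (J - {p})) = 0"
  using assms
proof (induction J rule: finite_psubset_induct)
  case (psubset J)
  let ?k = "\<lambda>I. cumulant_of_moments a b I" and ?e = "\<lambda>p I. cumulant_of_moments (d p) b I"
  let ?K = "\<lambda>I. ?k I + (\<Sum>p\<in>I. ?e p (I - {p}))"
  have fin: "finite {I. I \<subset> J}"
    using psubset.hyps by (auto intro: finite_subset[of _ "Pow J"])
  \<comment> \<open>Adding \<open>p\<close> to the subsets of \<open>J - {p}\<close> gives all
    \<open>p\<close> the common range \<open>Pow J\<close> and the common complement
    \<open>J - I\<close>, ready for the swap of sums.\<close>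
  have d: "d p (J - {p}) = (\<Sum>I | I \<in> Pow J \<and> p \<in> I. ?e p (I - {p}) * b (J - I))" if "p \<in> J" for p
  proof -
    have "d p (J - {p}) = (\<Sum>I\<in>Pow (J - {p}). ?e p I * b (J - {p} - I))"
      using psubset by (intro moment_eq_sum_cumulants) auto
    also have "\<dots> = (\<Sum>I | I \<in> Pow J \<and> p \<in> I. ?e p (I - {p}) * b (J - I))"
    proof (rule sum.reindex_bij_witness[where i = "\<lambda>I. I - {p}" and j = "insert p"])
      fix I assume I: "I \<in> Pow (J - {p})"
      then show eq: "insert p I - {p} = I" and "insert p I \<in> {I \<in> Pow J. p \<in> I}"
        using that by auto
      have "J - insert p I = J - {p} - I" by auto
      then show "?e p (insert p I - {p}) * b (J - insert p I) = ?e p I * b (J - {p} - I)"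
        by (simp only: eq)
    qed auto
    finally show ?thesis .
  qed
  have "0 = a J + (\<Sum>p\<in>J. d p (J - {p}))" using psubset.prems by simp
  also have "a J = (\<Sum>I\<in>Pow J. ?k I * b (J - I))"
    using psubset by (intro moment_eq_sum_cumulants) auto
  also have "(\<Sum>p\<in>J. d p (J - {p})) = (\<Sum>p\<in>J. \<Sum>I | I \<in> Pow J \<and> p \<in> I. ?e p (I - {p}) * b (J - I))"
    using d by simp
  also have "\<dots> = (\<Sum>I\<in>Pow J. \<Sum>p | p \<in> J \<and> p \<in> I. ?e p (I - {p}) * b (J - I))"
    using psubset.hyps by (intro sum.swap_restrict) auto
  also have "\<dots> = (\<Sum>I\<in>Pow J. (\<Sum>p\<in>I. ?e p (I - {p})) * b (J - I))"
    unfolding sum_distrib_right by (intro sum.cong refl) auto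
  also have "(\<Sum>I\<in>Pow J. ?k I * b (J - I)) + \<dots> = (\<Sum>I\<in>Pow J. ?K I * b (J - I))"
    by (simp add: sum.distrib distrib_right)
  also have "\<dots> = ?K J * b {} + (\<Sum>I | I \<subset> J. ?K I * b (J - I))"
    unfolding Pow_eq_insert_psubsets using fin by simp
  also have "(\<Sum>I | I \<subset> J. ?K I * b (J - I)) = 0"
  proof (rule sum.neutral, rule ballI)
    fix I assume "I \<in> {I. I \<subset> J}"
    then have "?K I = 0"
      by (intro psubset.IH psubset.prems) auto
    then show "?K I * b (J - I) = 0" by simp
  qed
  finally show ?case using psubset.prems(1) by simp
qed

text \<open>For fixed \<open>b\<close> the recursion is a linear operation on \<open>a\<close> with
  coefficients independent of \<open>z\<close>, so it can be pulled out of the integral term by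
  term.\<close>

lemma has_contour_integral_cumulant_of_moments:
  assumes "finite J"
    and "\<And>I. I \<subseteq> J \<Longrightarrow> ((\<lambda>z. g z * a z I) has_contour_integral c I) \<gamma>"
  shows "((\<lambda>z. g z * cumulant_of_moments (a z) b J) has_contour_integral cumulant_of_moments c b J) \<gamma>"
  using assms
proof (induction J rule: finite_psubset_induct)
  case (psubset J)
  have fin: "finite {I. I \<subset> J}"
    using psubset.hyps by (auto intro: finite_subset[of _ "Pow J"])
  have "((\<lambda>z. (g z * a z J - (\<Sum>I | I \<subset> J. (g z * cumulant_of_moments (a z) b I) * b (J - I))) / b {})
      has_contour_integral cumulant_of_moments c b J) \<gamma>"
    unfolding cumulant_of_moments_psubset[OF psubset.hyps, of c]
  proof (intro has_contour_integral_div has_contour_integral_diff has_contour_integral_sum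
      has_contour_integral_rmul fin)
    fix I assume "I \<in> {I. I \<subset> J}"
    then show "((\<lambda>z. g z * cumulant_of_moments (a z) b I) has_contour_integral cumulant_of_moments c b I) \<gamma>"
      using psubset.prems by (intro psubset.IH) auto
  qed (use psubset.prems in auto)
  then show ?case
    by (rule has_contour_integral_eq)
      (simp add: cumulant_of_moments_psubset[OF psubset.hyps] sum_distrib_left algebra_simps)
qed

lemma bounded_prod:
  fixes X :: "'i \<Rightarrow> 'w \<Rightarrow> 'a::{real_normed_field}"
  assumes "\<And>p \<omega>. p \<in> I \<Longrightarrow> \<omega> \<in> A \<Longrightarrow> norm (X p \<omega>) \<le> B" "\<omega> \<in> A"
  shows "norm (\<Prod>p\<in>I. X p \<omega>) \<le> B ^ card I"
proof -
  have "norm (\<Prod>p\<in>I. X p \<omega>) = (\<Prod>p\<in>I. norm (X p \<omega>))"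
    by (simp add: prod_norm)
  also have "\<dots> \<le> (\<Prod>p\<in>I. B)"
    using assms by (intro prod_mono) auto
  finally show ?thesis by simp
qed

text \<open>\<open>mixed_partial\<close> differentiates innermost in variable 0, which belongs to
  \<open>\<xi>\<close>; this turns \<open>Ln\<close> of the generating function into the quotient
  \<open>a / b\<close> of moments weighted by \<open>exp (T z)\<close>. Each further variable
  inserts one \<open>X p\<close> into all moments, as in
  \<open>has_field_derivative_cumulant_of_moments\<close>. At \<open>z = 0\<close> the weight is 1
  and the plain moments remain.\<close>

lemma (in prob_space) cumulant_with_eq_cumulant_of_moments:
  fixes X :: "'i \<Rightarrow> 'a \<Rightarrow> complex" and \<xi> :: "'a \<Rightarrow> complex"
  assumes "finite J" and \<xi>m: "\<xi> \<in> borel_measurable M"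
    and Xm: "\<And>p. p \<in> J \<Longrightarrow> X p \<in> borel_measurable M"
    and \<xi>b: "\<And>\<omega>. \<omega> \<in> space M \<Longrightarrow> norm (\<xi> \<omega>) \<le> B"
    and Xb: "\<And>p \<omega>. p \<in> J \<Longrightarrow> \<omega> \<in> space M \<Longrightarrow> norm (X p \<omega>) \<le> B"
  shows "cumulant_with M X \<xi> J =
    cumulant_of_moments (\<lambda>I. LINT \<omega>|M. \<xi> \<omega> * (\<Prod>p\<in>I. X p \<omega>)) (\<lambda>I. LINT \<omega>|M. (\<Prod>p\<in>I. X p \<omega>)) J"
proof -
  define ps where "ps = (SOME ps. distinct ps \<and> set ps = J)"
  have ps: "distinct ps" "set ps = J"
    using someI_ex[of "\<lambda>ps. distinct ps \<and> set ps = J"] finite_distinct_list[OF \<open>finite J\<close>]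
    unfolding ps_def by blast+
  define n where "n = length ps"
  define L where "L = \<xi> # map X ps"
  have len: "length L = Suc n" by (simp add: L_def n_def)
  have Lm: "L ! i \<in> borel_measurable M" if "i < Suc n" for i
    using that \<xi>m Xm ps(2) by (cases i) (auto simp: L_def n_def)
  have Lb: "norm ((L ! i) \<omega>) \<le> B" if "i < Suc n" "\<omega> \<in> space M" for i \<omega>
    using that \<xi>b Xb ps(2) by (cases i) (auto simp: L_def n_def)
  have "0 \<le> B"
    using not_empty \<xi>b by (meson ex_in_conv norm_ge_zero order_trans)
  define T where "T z \<omega> = (\<Sum>i<Suc n. z i * (L ! i) \<omega>)" for z :: "nat \<Rightarrow> complex" and \<omega>
  have Tm: "T z \<in> borel_measurable M" for z
    unfolding T_def using Lm by (intro borel_measurable_sum borel_measurable_times) auto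
  have Tb: "norm (T z \<omega>) \<le> (\<Sum>i<Suc n. norm (z i)) * B" if "\<omega> \<in> space M" for z \<omega>
    unfolding T_def sum_distrib_right
    using Lb[OF _ that] by (intro sum_norm_le) (auto simp: norm_mult intro: mult_left_mono)
  have Tupd: "T (z(i := w)) \<omega> = T z \<omega> + (w - z i) * (L ! i) \<omega>" if "i < Suc n" for z i w \<omega>
  proof -
    have "T (z(i := w)) \<omega> = w * (L ! i) \<omega> + (\<Sum>j\<in>{..<Suc n} - {i}. z j * (L ! j) \<omega>)"
      unfolding T_def using that by (subst sum.remove[of _ i]) auto
    moreover have "T z \<omega> = z i * (L ! i) \<omega> + (\<Sum>j\<in>{..<Suc n} - {i}. z j * (L ! j) \<omega>)"
      unfolding T_def using that by (subst sum.remove[of _ i]) auto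
    ultimately show ?thesis by (simp add: algebra_simps)
  qed
  have Eder: "((\<lambda>w. LINT \<omega>|M. g \<omega> * exp (T (z(i := w)) \<omega>)) has_field_derivative
      (LINT \<omega>|M. g \<omega> * (L ! i) \<omega> * exp (T z \<omega>))) (at (z i))"
    if i: "i < Suc n" and g: "g \<in> borel_measurable M" "\<And>\<omega>. \<omega> \<in> space M \<Longrightarrow> norm (g \<omega>) \<le> C"
    for i g C and z :: "nat \<Rightarrow> complex"
  proof -
    let ?f = "\<lambda>w \<omega>. g \<omega> * exp (T (z(i := w)) \<omega>)"
    have d: "deriv (\<lambda>w. ?f w \<omega>) (z i) = g \<omega> * (L ! i) \<omega> * exp (T z \<omega>)" for \<omega>
      unfolding Tupd[OF i] by (rule DERIV_imp_deriv) (auto intro!: derivative_eq_intros)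
    have "((\<lambda>w. LINT \<omega>|M. ?f w \<omega>) has_field_derivative (LINT \<omega>|M. deriv (\<lambda>w. ?f w \<omega>) (z i))) (at (z i))"
    proof (rule has_field_derivative_integral_parameter[OF open_UNIV])
      show "(\<lambda>w. ?f w \<omega>) holomorphic_on UNIV" for \<omega>
        unfolding Tupd[OF i] by (intro holomorphic_intros)
      show "?f w \<in> borel_measurable M" for w
        by (intro borel_measurable_times g(1) Tm measurable_compose[OF Tm borel_measurable_exp])
      show "norm (?f w \<omega>) \<le> C * exp ((\<Sum>i<Suc n. norm (z i)) * B + B)"
        if "w \<in> cball (z i) 1" "\<omega> \<in> space M" for w \<omega>
      proof -
        have "norm (T (z(i := w)) \<omega>) \<le> norm (T z \<omega>) + norm (w - z i) * norm ((L ! i) \<omega>)"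
          unfolding Tupd[OF i] by (metis norm_mult norm_triangle_ineq)
        also have "norm (w - z i) * norm ((L ! i) \<omega>) \<le> 1 * B"
          using that Lb[OF i that(2)] by (intro mult_mono) (auto simp: dist_norm norm_minus_commute)
        finally have "norm (T (z(i := w)) \<omega>) \<le> (\<Sum>i<Suc n. norm (z i)) * B + B"
          using Tb[OF that(2), of z] by linarith
        then have "norm (exp (T (z(i := w)) \<omega>)) \<le> exp ((\<Sum>i<Suc n. norm (z i)) * B + B)"
          by (intro order_trans[OF norm_exp]) simp
        then show ?thesis
          unfolding norm_mult using g(2)[OF that(2)] by (intro mult_mono) (auto intro: order_trans[OF norm_ge_zero])
      qed
    qed auto
    then show ?thesis unfolding d .
  qed
  define a where "a z I = (LINT \<omega>|M. (\<xi> \<omega> * (\<Prod>p\<in>I. X p \<omega>)) * exp (T z \<omega>))" for z I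
  define b where "b z I = (LINT \<omega>|M. (\<Prod>p\<in>I. X p \<omega>) * exp (T z \<omega>))" for z I
  define F where "F z = Ln (LINT \<omega>|M. exp (T z \<omega>))" for z
  have FL: "F = (\<lambda>z. Ln (LINT \<omega>|M. exp (\<Sum>i<length L. z i * (L ! i) \<omega>)))"
    unfolding F_def T_def len ..
  \<comment> \<open>For \<open>n + 1\<close> variables below \<open>\<delta>\<close> the norm of
    \<open>T z\<close> is at most 1/2, so \<open>Re (exp (T z))\<close> is at least
    \<open>exp (- 1 / 2) * cos (1 / 2)\<close>. Its mean is then positive and stays off the branch
    cut of \<open>Ln\<close>. The summand 1 in \<open>B + 1\<close> excludes a zero
    denominator.\<close>
  define \<delta> where "\<delta> = 1 / (2 * (real n + 1) * (B + 1))"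
  have "0 < \<delta>" using \<open>0 \<le> B\<close> by (simp add: \<delta>_def)
  define D where "D = {z :: nat \<Rightarrow> complex. \<forall>i<Suc n. norm (z i) < \<delta>}"
  have bnz: "0 < Re (b z {})" if "z \<in> D" for z
  proof -
    have T12: "norm (T z \<omega>) \<le> 1 / 2" if "\<omega> \<in> space M" for \<omega>
    proof -
      have "(\<Sum>i<Suc n. norm (z i)) \<le> (\<Sum>i<Suc n. \<delta>)"
        using \<open>z \<in> D\<close> by (intro sum_mono) (auto simp: D_def less_imp_le)
      then have "(\<Sum>i<Suc n. norm (z i)) * B \<le> (real n + 1) * \<delta> * (B + 1)"
        using \<open>0 \<le> B\<close> \<open>0 < \<delta>\<close> by (intro mult_mono) (auto simp: algebra_simps)
      also have "\<dots> = 1 / 2"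
      proof -
        have "real n + 1 \<noteq> 0" "B + 1 \<noteq> 0" using \<open>0 \<le> B\<close> by auto
        then show ?thesis unfolding \<delta>_def by (simp add: divide_simps)
      qed
      finally show ?thesis using Tb[OF that, of z] by linarith
    qed
    have low: "exp (- 1 / 2) * cos (1 / 2) \<le> Re (exp (T z \<omega>))" if "\<omega> \<in> space M" for \<omega>
    proof -
      have "\<bar>Re (T z \<omega>)\<bar> \<le> 1 / 2" "\<bar>Im (T z \<omega>)\<bar> \<le> 1 / 2"
        using T12[OF that] abs_Re_le_cmod[of "T z \<omega>"] abs_Im_le_cmod[of "T z \<omega>"] by linarith+
      moreover have "cos (1 / 2) \<le> cos \<bar>Im (T z \<omega>)\<bar>"
        using calculation pi_gt3 by (intro cos_monotone_0_pi_le) linarith+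
      moreover have "0 \<le> cos (1 / 2 :: real)"
        using pi_gt3 by (intro cos_ge_zero) linarith+
      ultimately show ?thesis
        unfolding Re_exp by (intro mult_mono) (simp_all add: abs_le_iff)
    qed
    have int: "integrable M (\<lambda>\<omega>. exp (T z \<omega>))"
    proof (rule integrable_const_bound[where B = "exp (1 / 2)"])
      show "AE \<omega> in M. norm (exp (T z \<omega>)) \<le> exp (1 / 2)"
        using T12 by (intro AE_I2 order_trans[OF norm_exp]) simp
      show "(\<lambda>\<omega>. exp (T z \<omega>)) \<in> borel_measurable M"
        by (rule measurable_compose[OF Tm borel_measurable_exp])
    qed
    have "0 < exp (- 1 / 2) * cos (1 / 2 :: real)"
      using pi_gt3 by (intro mult_pos_pos cos_gt_zero exp_gt_zero) linarith+
    also have "\<dots> \<le> (LINT \<omega>|M. Re (exp (T z \<omega>)))"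
      using low int by (intro integral_ge_const integrable_Re AE_I2) auto
    also have "\<dots> = Re (b z {})"
      using int by (simp add: b_def)
    finally show ?thesis .
  qed
  have DX: "\<And>I. I \<subseteq> J \<Longrightarrow> (\<lambda>\<omega>. \<Prod>p\<in>I. X p \<omega>) \<in> borel_measurable M"
    using Xm by (intro borel_measurable_prod) auto
  have Pb: "norm (\<Prod>p\<in>I. X p \<omega>) \<le> B ^ card I" if "I \<subseteq> J" "\<omega> \<in> space M" for I \<omega>
    using Xb that by (intro bounded_prod[where A = "space M"]) auto
  \<comment> \<open>Claimed at every point of the polydisc \<open>D\<close>, since the next
    derivative needs the formula on a neighbourhood. Variable 0 is taken by \<open>\<xi>\<close>, so
    the variable \<open>Suc m\<close> belongs to \<open>ps ! m\<close>.\<close>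
  have main: "mixed_partial (Suc m) F z = cumulant_of_moments (a z) (b z) (set (take m ps))"
    if "m \<le> n" "z \<in> D" for m z
    using that
  proof (induction m arbitrary: z)
    case 0
    have "((\<lambda>w. LINT \<omega>|M. 1 * exp (T (z(0 := w)) \<omega>)) has_field_derivative
        (LINT \<omega>|M. 1 * (L ! 0) \<omega> * exp (T z \<omega>))) (at (z 0))"
      by (rule Eder[of 0 "\<lambda>_. 1" 1]) auto
    then have 1: "((\<lambda>w. b (z(0 := w)) {}) has_field_derivative a z {}) (at (z 0))"
      by (simp add: a_def b_def L_def)
    have "b z {} \<notin> \<real>\<^sub>\<le>\<^sub>0"
      using bnz[OF 0(2)] by (auto simp: complex_nonpos_Reals_iff)
    then have "((\<lambda>w. Ln (b (z(0 := w)) {})) has_field_derivative a z {} / b z {}) (at (z 0))"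
      using 1 by (auto intro!: derivative_eq_intros simp: divide_inverse)
    then have "deriv (\<lambda>w. F (z(0 := w))) (z 0) = a z {} / b z {}"
      by (intro DERIV_imp_deriv) (simp add: F_def b_def)
    then show ?case by (simp add: cumulant_of_moments_psubset)
  next
    case (Suc m)
    define p where "p = ps ! m"
    have m: "m < length ps" using Suc.prems by (simp add: n_def)
    have tk: "set (take (Suc m) ps) = insert p (set (take m ps))"
      using m by (simp add: p_def take_Suc_conv_app_nth)
    have pn: "p \<notin> set (take m ps)"
    proof -
      have "distinct (take (Suc m) ps)" using ps(1) by simp
      then show ?thesis by (simp add: p_def take_Suc_conv_app_nth[OF m])
    qed
    have pJ: "p \<in> J" and tJ: "set (take m ps) \<subseteq> J"
      using m ps(2) by (auto simp: p_def dest: in_set_takeD)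
    have Lp: "L ! Suc m = X p" "Suc m < Suc n" using m by (auto simp: L_def p_def n_def)
    have upd: "z(Suc m := w) \<in> D" if "w \<in> ball 0 \<delta>" for w
      using Suc.prems that by (auto simp: D_def)
    have zm: "z (Suc m) \<in> ball 0 \<delta>" using Suc.prems m by (auto simp: D_def n_def)
    have "mixed_partial (Suc (Suc m)) F z = deriv (\<lambda>w. mixed_partial (Suc m) F (z(Suc m := w))) (z (Suc m))"
      by simp
    also have "\<dots> = deriv (\<lambda>w. cumulant_of_moments (a (z(Suc m := w))) (b (z(Suc m := w))) (set (take m ps))) (z (Suc m))"
    proof (rule deriv_cong_ev)
      show "\<forall>\<^sub>F w in nhds (z (Suc m)). mixed_partial (Suc m) F (z(Suc m := w)) =
          cumulant_of_moments (a (z(Suc m := w))) (b (z(Suc m := w))) (set (take m ps))"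
        by (rule eventually_nhds_in_open[OF open_ball zm, THEN eventually_mono])
          (use Suc.IH upd Suc.prems in \<open>simp del: mixed_partial.simps\<close>)
    qed simp
    also have "\<dots> = cumulant_of_moments (a (z(Suc m := z (Suc m)))) (b (z(Suc m := z (Suc m)))) (insert p (set (take m ps)))"
    proof (rule DERIV_imp_deriv, rule has_field_derivative_cumulant_of_moments)
      show "b (z(Suc m := z (Suc m))) {} \<noteq> 0"
        using bnz[OF Suc.prems(2)] by auto
      fix I assume I: "I \<subseteq> set (take m ps)"
      then have IJ: "I \<subseteq> J" and fI: "finite I" and pI: "p \<notin> I"
        using tJ pn finite_subset by auto
      have "((\<lambda>w. LINT \<omega>|M. (\<xi> \<omega> * (\<Prod>p\<in>I. X p \<omega>)) * exp (T (z(Suc m := w)) \<omega>)) has_field_derivative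
          (LINT \<omega>|M. (\<xi> \<omega> * (\<Prod>p\<in>I. X p \<omega>)) * (L ! Suc m) \<omega> * exp (T z \<omega>))) (at (z (Suc m)))"
      proof (rule Eder[of "Suc m" _ "B * B ^ card I"])
        show "(\<lambda>\<omega>. \<xi> \<omega> * (\<Prod>p\<in>I. X p \<omega>)) \<in> borel_measurable M"
          using \<xi>m DX[OF IJ] by measurable
        show "norm (\<xi> \<omega> * (\<Prod>p\<in>I. X p \<omega>)) \<le> B * B ^ card I" if "\<omega> \<in> space M" for \<omega>
          unfolding norm_mult using \<xi>b Pb[OF IJ] that \<open>0 \<le> B\<close> by (intro mult_mono) auto
      qed (rule Lp(2))
      then show "((\<lambda>w. a (z(Suc m := w)) I) has_field_derivative a (z(Suc m := z (Suc m))) (insert p I)) (at (z (Suc m)))"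
        unfolding a_def Lp fun_upd_triv using fI pI by (simp add: ac_simps)
      have "((\<lambda>w. LINT \<omega>|M. (\<Prod>p\<in>I. X p \<omega>) * exp (T (z(Suc m := w)) \<omega>)) has_field_derivative
          (LINT \<omega>|M. (\<Prod>p\<in>I. X p \<omega>) * (L ! Suc m) \<omega> * exp (T z \<omega>))) (at (z (Suc m)))"
        by (rule Eder[OF Lp(2) DX[OF IJ] Pb[OF IJ]])
      then show "((\<lambda>w. b (z(Suc m := w)) I) has_field_derivative b (z(Suc m := z (Suc m))) (insert p I)) (at (z (Suc m)))"
        unfolding b_def Lp fun_upd_triv using fI pI by (simp add: ac_simps)
    qed (use pn in auto)
    finally show ?case by (simp add: tk)
  qed
  have T0: "T (\<lambda>_. 0) \<omega> = 0" for \<omega> by (simp add: T_def)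
  have "cumulant_with M X \<xi> J = mixed_partial (Suc n) F (\<lambda>_. 0)"
    unfolding cumulant_with_def joint_cumulant_def ps_def[symmetric] L_def[symmetric]
    by (simp only: len FL)
  also have "\<dots> = cumulant_of_moments (a (\<lambda>_. 0)) (b (\<lambda>_. 0)) (set (take n ps))"
    using \<open>0 < \<delta>\<close> by (intro main) (auto simp: D_def)
  also have "set (take n ps) = J" by (simp add: n_def ps)
  also have "a (\<lambda>_. 0) = (\<lambda>I. LINT \<omega>|M. \<xi> \<omega> * (\<Prod>p\<in>I. X p \<omega>))"
    by (intro ext) (simp add: a_def T0)
  also have "b (\<lambda>_. 0) = (\<lambda>I. LINT \<omega>|M. (\<Prod>p\<in>I. X p \<omega>))"
    by (intro ext) (simp add: b_def T0)
  finally show ?thesis .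
qed

section \<open>Uniform first-order expansions and substitution\<close>

text \<open>A first-order Taylor expansion at \<open>t = 0\<close> whose error is of order
  \<open>t^2\<close> uniformly over \<open>D\<close>. The bounds on \<open>f0\<close> and
  \<open>f1\<close> are part of the notion so that it is closed under products.\<close>

definition uniform_expansion ::
  "'y set \<Rightarrow> (real \<Rightarrow> 'y \<Rightarrow> complex) \<Rightarrow> ('y \<Rightarrow> complex) \<Rightarrow> ('y \<Rightarrow> complex) \<Rightarrow> bool" where
  "uniform_expansion D f f0 f1 \<longleftrightarrow>
     (\<exists>C. (\<forall>y\<in>D. norm (f0 y) \<le> C \<and> norm (f1 y) \<le> C) \<and>
       (\<forall>\<^sub>F t in nhds 0. \<forall>y\<in>D. norm (f t y - f0 y - complex_of_real t * f1 y) \<le> C * t\<^sup>2))"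

lemma uniform_expansionI:
  assumes "\<And>y. y \<in> D \<Longrightarrow> norm (f0 y) \<le> A" "\<And>y. y \<in> D \<Longrightarrow> norm (f1 y) \<le> B"
    and "\<forall>\<^sub>F t in nhds 0. \<forall>y\<in>D. norm (f t y - f0 y - complex_of_real t * f1 y) \<le> C * t\<^sup>2"
  shows "uniform_expansion D f f0 f1"
  unfolding uniform_expansion_def
proof (intro exI conjI ballI)
  let ?C = "max A (max B C)"
  show "norm (f0 y) \<le> ?C" "norm (f1 y) \<le> ?C" if "y \<in> D" for y
    using assms(1,2)[OF that] by auto
  have "C * t\<^sup>2 \<le> ?C * t\<^sup>2" for t :: real by (intro mult_right_mono) auto
  then show "\<forall>\<^sub>F t in nhds 0. \<forall>y\<in>D. norm (f t y - f0 y - complex_of_real t * f1 y) \<le> ?C * t\<^sup>2"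
    using assms(3) by (elim eventually_mono) (blast intro: order_trans)
qed

lemma uniform_expansion_cong:
  assumes "uniform_expansion D g g0 g1" "\<forall>\<^sub>F t in nhds 0. \<forall>y\<in>D. f t y = g t y"
    and "\<And>y. y \<in> D \<Longrightarrow> f0 y = g0 y" "\<And>y. y \<in> D \<Longrightarrow> f1 y = g1 y"
  shows "uniform_expansion D f f0 f1"
proof -
  obtain C where C: "\<And>y. y \<in> D \<Longrightarrow> norm (g0 y) \<le> C" "\<And>y. y \<in> D \<Longrightarrow> norm (g1 y) \<le> C"
    "\<forall>\<^sub>F t in nhds 0. \<forall>y\<in>D. norm (g t y - g0 y - complex_of_real t * g1 y) \<le> C * t\<^sup>2"
    using assms(1) by (auto simp: uniform_expansion_def)
  have "\<forall>\<^sub>F t in nhds 0. \<forall>y\<in>D. norm (f t y - f0 y - complex_of_real t * f1 y) \<le> C * t\<^sup>2"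
    using C(3) assms(2) by eventually_elim (simp add: assms(3,4))
  then show ?thesis using C(1,2) assms(3,4) by (intro uniform_expansionI) simp_all
qed

lemma uniform_expansion_const:
  assumes "\<And>y. y \<in> D \<Longrightarrow> norm (g y) \<le> B"
  shows "uniform_expansion D (\<lambda>_. g) g (\<lambda>_. 0)"
  by (rule uniform_expansionI[where A = B and B = 0 and C = 0]) (use assms in auto)

lemma uniform_expansion_add:
  assumes "uniform_expansion D f f0 f1" "uniform_expansion D g g0 g1"
  shows "uniform_expansion D (\<lambda>t y. f t y + g t y) (\<lambda>y. f0 y + g0 y) (\<lambda>y. f1 y + g1 y)"
proof -
  obtain C where C: "\<And>y. y \<in> D \<Longrightarrow> norm (f0 y) \<le> C" "\<And>y. y \<in> D \<Longrightarrow> norm (f1 y) \<le> C"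
    "\<forall>\<^sub>F t in nhds 0. \<forall>y\<in>D. norm (f t y - f0 y - complex_of_real t * f1 y) \<le> C * t\<^sup>2"
    using assms(1) by (auto simp: uniform_expansion_def)
  obtain C' where C': "\<And>y. y \<in> D \<Longrightarrow> norm (g0 y) \<le> C'" "\<And>y. y \<in> D \<Longrightarrow> norm (g1 y) \<le> C'"
    "\<forall>\<^sub>F t in nhds 0. \<forall>y\<in>D. norm (g t y - g0 y - complex_of_real t * g1 y) \<le> C' * t\<^sup>2"
    using assms(2) by (auto simp: uniform_expansion_def)
  show ?thesis
  proof (rule uniform_expansionI)
    show "\<forall>\<^sub>F t in nhds 0. \<forall>y\<in>D. norm (f t y + g t y - (f0 y + g0 y)
        - complex_of_real t * (f1 y + g1 y)) \<le> (C + C') * t\<^sup>2"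
      using C(3) C'(3)
    proof eventually_elim
      case (elim t)
      show ?case
      proof
        fix y assume y: "y \<in> D"
        have "f t y + g t y - (f0 y + g0 y) - complex_of_real t * (f1 y + g1 y)
          = (f t y - f0 y - complex_of_real t * f1 y) + (g t y - g0 y - complex_of_real t * g1 y)"
          by (simp add: algebra_simps)
        then show "norm (f t y + g t y - (f0 y + g0 y) - complex_of_real t * (f1 y + g1 y)) \<le> (C + C') * t\<^sup>2"
          using norm_triangle_mono[OF elim(1)[rule_format, OF y] elim(2)[rule_format, OF y]]
          by (simp add: algebra_simps)
      qed
    qed
  qed (use norm_triangle_mono[OF C(1) C'(1)] norm_triangle_mono[OF C(2) C'(2)] in blast)+
qed

lemma uniform_expansion_sum:
  assumes "\<And>i. i \<in> I \<Longrightarrow> uniform_expansion D (f i) (f0 i) (f1 i)"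
  shows "uniform_expansion D (\<lambda>t y. \<Sum>i\<in>I. f i t y) (\<lambda>y. \<Sum>i\<in>I. f0 i y) (\<lambda>y. \<Sum>i\<in>I. f1 i y)"
  using assms
proof (induction I rule: infinite_finite_induct)
  case (insert i I)
  then show ?case
    by (simp add: uniform_expansion_add)
qed (auto intro!: uniform_expansion_const)

lemma uniform_expansion_mult:
  assumes "uniform_expansion D f f0 f1" "uniform_expansion D g g0 g1"
  shows "uniform_expansion D (\<lambda>t y. f t y * g t y) (\<lambda>y. f0 y * g0 y) (\<lambda>y. f1 y * g0 y + f0 y * g1 y)"
proof -
  obtain A where A: "\<And>y. y \<in> D \<Longrightarrow> norm (f0 y) \<le> A" "\<And>y. y \<in> D \<Longrightarrow> norm (f1 y) \<le> A"
    "\<forall>\<^sub>F t in nhds 0. \<forall>y\<in>D. norm (f t y - f0 y - complex_of_real t * f1 y) \<le> A * t\<^sup>2"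
    using assms(1) by (auto simp: uniform_expansion_def)
  obtain B where B: "\<And>y. y \<in> D \<Longrightarrow> norm (g0 y) \<le> B" "\<And>y. y \<in> D \<Longrightarrow> norm (g1 y) \<le> B"
    "\<forall>\<^sub>F t in nhds 0. \<forall>y\<in>D. norm (g t y - g0 y - complex_of_real t * g1 y) \<le> B * t\<^sup>2"
    using assms(2) by (auto simp: uniform_expansion_def)
  have small: "\<forall>\<^sub>F t :: real in nhds 0. \<bar>t\<bar> < 1"
    by (rule eventually_nhds_in_open[of "ball 0 1", THEN eventually_mono]) auto
  show ?thesis
  proof (rule uniform_expansionI)
    show "norm (f0 y * g0 y) \<le> A * B" if "y \<in> D" for y
      unfolding norm_mult using A(1)[OF that] B(1)[OF that] order_trans[OF norm_ge_zero A(1)[OF that]]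
      by (intro mult_mono) auto
    show "norm (f1 y * g0 y + f0 y * g1 y) \<le> A * B + A * B" if "y \<in> D" for y
      using A(1)[OF that] A(2)[OF that] B(1)[OF that] B(2)[OF that] order_trans[OF norm_ge_zero A(1)[OF that]]
      by (intro order_trans[OF norm_triangle_ineq] add_mono) (auto simp: norm_mult intro!: mult_mono)
    show "\<forall>\<^sub>F t in nhds 0. \<forall>y\<in>D. norm (f t y * g t y - f0 y * g0 y
        - complex_of_real t * (f1 y * g0 y + f0 y * g1 y)) \<le> (6 * A * B) * t\<^sup>2"
      using A(3) B(3) small
    proof eventually_elim
      case (elim t)
      show ?case
      proof
        fix y assume y: "y \<in> D"
        define r s where "r = f t y - f0 y - complex_of_real t * f1 y"
          and "s = g t y - g0 y - complex_of_real t * g1 y"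
        have A0: "0 \<le> A" and B0: "0 \<le> B"
          using A(1)[OF y] B(1)[OF y] norm_ge_zero order_trans by blast+
        have t1: "\<bar>t\<bar> \<le> 1" "t\<^sup>2 \<le> 1" using elim(3) by (auto simp: abs_square_le_1)
        have r: "norm r \<le> A * t\<^sup>2" and s: "norm s \<le> B * t\<^sup>2"
          using elim(1,2) y by (auto simp: r_def s_def)
        have fb: "norm (f0 y + complex_of_real t * f1 y) \<le> 2 * A"
        proof -
          have "norm (complex_of_real t * f1 y) \<le> 1 * A"
            unfolding norm_mult using t1 A(2)[OF y] by (intro mult_mono) auto
          then show ?thesis using norm_triangle_mono[OF A(1)[OF y]] by force
        qed
        have gb: "norm (g0 y + complex_of_real t * g1 y) \<le> 2 * B"
        proof -
          have "norm (complex_of_real t * g1 y) \<le> 1 * B"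
            unfolding norm_mult using t1 B(2)[OF y] by (intro mult_mono) auto
          then show ?thesis using norm_triangle_mono[OF B(1)[OF y]] by force
        qed
        have s': "norm s \<le> B"
          using s t1(2) B0 mult_left_mono[of "t\<^sup>2" 1 B] by linarith
        have e1: "norm (complex_of_real t ^ 2 * (f1 y * g1 y)) \<le> t\<^sup>2 * (A * B)"
          unfolding norm_mult norm_power using A(2)[OF y] B(2)[OF y] A0
          by (intro mult_mono) auto
        have e2: "norm ((f0 y + complex_of_real t * f1 y) * s) \<le> (2 * A) * (B * t\<^sup>2)"
          unfolding norm_mult using fb s A0 by (intro mult_mono) auto
        have e3: "norm (r * (g0 y + complex_of_real t * g1 y + s)) \<le> (A * t\<^sup>2) * (2 * B + B)"
          unfolding norm_mult using r norm_triangle_mono[OF gb s'] A0 by (intro mult_mono) auto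
        \<comment> \<open>With remainders \<open>r\<close> and \<open>s\<close> of the two factors
          and \<open>t\<close> of modulus below 1, the three summands are at most
          \<open>A * B\<close>, \<open>2 * A * B\<close> and \<open>3 * A * B\<close> times the
          square of \<open>t\<close>; hence the factor 6.\<close>
        have "f t y * g t y - f0 y * g0 y - complex_of_real t * (f1 y * g0 y + f0 y * g1 y)
          = complex_of_real t ^ 2 * (f1 y * g1 y) + (f0 y + complex_of_real t * f1 y) * s
            + r * (g0 y + complex_of_real t * g1 y + s)"
          unfolding r_def s_def by (simp add: power2_eq_square algebra_simps)
        also have "norm \<dots> \<le> t\<^sup>2 * (A * B) + (2 * A) * (B * t\<^sup>2) + (A * t\<^sup>2) * (2 * B + B)"
          by (intro norm_triangle_mono e1 e2 e3)
        also have "\<dots> = (6 * A * B) * t\<^sup>2" by (simp add: algebra_simps)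
        finally show "norm (f t y * g t y - f0 y * g0 y
            - complex_of_real t * (f1 y * g0 y + f0 y * g1 y)) \<le> (6 * A * B) * t\<^sup>2" .
      qed
    qed
  qed
qed

lemma uniform_expansion_mult_one:
  assumes "uniform_expansion D f (\<lambda>_. 1) f1" "uniform_expansion D g (\<lambda>_. 1) g1"
  shows "uniform_expansion D (\<lambda>t y. f t y * g t y) (\<lambda>_. 1) (\<lambda>y. f1 y + g1 y)"
  using uniform_expansion_mult[OF assms] by simp

lemma uniform_expansion_prod_one:
  assumes "\<And>i. i \<in> I \<Longrightarrow> uniform_expansion D (f i) (\<lambda>_. 1) (f1 i)"
  shows "uniform_expansion D (\<lambda>t y. \<Prod>i\<in>I. f i t y) (\<lambda>_. 1) (\<lambda>y. \<Sum>i\<in>I. f1 i y)"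
  using assms
proof (induction I rule: infinite_finite_induct)
  case (insert i I)
  then show ?case
    by (simp add: uniform_expansion_mult_one)
qed (auto intro!: uniform_expansion_const)

lemma uniform_expansion_prod:
  assumes "finite I" "\<And>i. i \<in> I \<Longrightarrow> uniform_expansion D (f i) (f0 i) (f1 i)"
  shows "uniform_expansion D (\<lambda>t y. \<Prod>i\<in>I. f i t y) (\<lambda>y. \<Prod>i\<in>I. f0 i y)
    (\<lambda>y. \<Sum>i\<in>I. f1 i y * (\<Prod>j\<in>I - {i}. f0 j y))"
  using assms
proof (induction I)
  case (insert i I)
  have "(\<Sum>j\<in>insert i I. f1 j y * (\<Prod>l\<in>insert i I - {j}. f0 l y))
      = f1 i y * (\<Prod>l\<in>I. f0 l y) + f0 i y * (\<Sum>j\<in>I. f1 j y * (\<Prod>l\<in>I - {j}. f0 l y))" for y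
  proof -
    have "insert i I - {j} = insert i (I - {j})" if "j \<in> I" for j
      using that insert.hyps by auto
    then have "(\<Sum>j\<in>I. f1 j y * (\<Prod>l\<in>insert i I - {j}. f0 l y))
        = (\<Sum>j\<in>I. f0 i y * (f1 j y * (\<Prod>l\<in>I - {j}. f0 l y)))"
      using insert.hyps by (intro sum.cong) auto
    then show ?thesis
      using insert.hyps by (simp add: sum_distrib_left)
  qed
  then show ?case
    using insert uniform_expansion_mult[of D "f i" "f0 i" "f1 i"] by simp
qed (auto intro!: uniform_expansion_const)

lemma eventually_abs_mult_le:
  fixes B :: real
  assumes "0 < r"
  shows "\<forall>\<^sub>F t :: real in nhds 0. \<bar>t\<bar> * \<bar>B\<bar> \<le> r"
proof (rule eventually_nhds_in_open[of "ball 0 (r / (\<bar>B\<bar> + 1))", THEN eventually_mono])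
  fix t :: real assume "t \<in> ball 0 (r / (\<bar>B\<bar> + 1))"
  then have "\<bar>t\<bar> * (\<bar>B\<bar> + 1) < r" by (simp add: field_simps)
  moreover have "\<bar>t\<bar> * \<bar>B\<bar> \<le> \<bar>t\<bar> * (\<bar>B\<bar> + 1)" by (intro mult_left_mono) auto
  ultimately show "\<bar>t\<bar> * \<bar>B\<bar> \<le> r" by linarith
qed (use assms in auto)

text \<open>A closed \<open>r\<close>-neighbourhood \<open>K'\<close> of \<open>K\<close> is still
  compact and inside \<open>S\<close>. One radius and one supremum of \<open>\<phi>\<close> on
  \<open>K'\<close> then serve every base point, so the second-order remainder bound is
  uniform.\<close>

lemma uniform_expansion_holomorphic:
  assumes "open S" "compact K" "K \<subseteq> S" "\<phi> holomorphic_on S"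
    and x: "\<And>y. y \<in> D \<Longrightarrow> x y \<in> K" and h: "\<And>y. y \<in> D \<Longrightarrow> norm (h y) \<le> B"
  shows "uniform_expansion D (\<lambda>t y. \<phi> (x y + complex_of_real t * h y)) (\<lambda>y. \<phi> (x y))
    (\<lambda>y. deriv \<phi> (x y) * h y)"
proof -
  obtain r where r: "0 < r" "(\<Union>x\<in>K. cball x r) \<subseteq> S"
    using compact_subset_open_imp_cball_epsilon_subset[OF assms(2,1,3)] by blast
  define K' where "K' = (\<Union>z\<in>K. \<Union>w\<in>cball 0 r. {z + w})"
  have "compact K'"
    unfolding K'_def by (intro compact_sums' \<open>compact K\<close> compact_cball)
  have cb: "cball z r \<subseteq> K'" if "z \<in> K" for z
  proof
    fix w assume "w \<in> cball z r"
    then have "w - z \<in> cball 0 r" "w = z + (w - z)" by (auto simp: dist_norm norm_minus_commute)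
    then show "w \<in> K'" using that unfolding K'_def by blast
  qed
  have "K' \<subseteq> S"
  proof
    fix u assume "u \<in> K'"
    then obtain z w where "z \<in> K" "w \<in> cball 0 r" "u = z + w" by (auto simp: K'_def)
    then show "u \<in> S" using r(2) by (force simp: dist_norm)
  qed
  have "compact (\<phi> ` K')" "compact (deriv \<phi> ` K)"
    using \<open>compact K'\<close> \<open>K' \<subseteq> S\<close> assms
    by (meson compact_continuous_image holomorphic_deriv holomorphic_on_imp_continuous_on holomorphic_on_subset)+
  then obtain A A' where A: "\<And>w. w \<in> K' \<Longrightarrow> norm (\<phi> w) \<le> A" "\<And>w. w \<in> K \<Longrightarrow> norm (deriv \<phi> w) \<le> A'"
    by (metis compact_imp_bounded bounded_iff imageI)
  show ?thesis
  proof (rule uniform_expansionI)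
    show "norm (\<phi> (x y)) \<le> A" if "y \<in> D" for y
      using x[OF that] cb[OF x[OF that]] r(1) by (intro A) auto
    show "norm (deriv \<phi> (x y) * h y) \<le> A' * B" if "y \<in> D" for y
      unfolding norm_mult using A(2)[OF x[OF that]] h[OF that] order_trans[OF norm_ge_zero A(2)[OF x[OF that]]]
      by (intro mult_mono) auto
    show "\<forall>\<^sub>F t in nhds 0. \<forall>y\<in>D. norm (\<phi> (x y + complex_of_real t * h y) - \<phi> (x y)
        - complex_of_real t * (deriv \<phi> (x y) * h y)) \<le> (8 * \<bar>A\<bar> / r\<^sup>2 * B\<^sup>2) * t\<^sup>2"
      using eventually_abs_mult_le[OF half_gt_zero[OF r(1)], of B]
    proof eventually_elim
      case (elim t)
      show ?case
      proof
        fix y assume y: "y \<in> D"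
        let ?u = "complex_of_real t * h y"
        have u: "norm ?u \<le> \<bar>t\<bar> * \<bar>B\<bar>"
          unfolding norm_mult using h[OF y] by (intro mult_mono) auto
        have "norm (\<phi> (x y + ?u) - \<phi> (x y) - ?u * deriv \<phi> (x y)) \<le> 8 * \<bar>A\<bar> / r\<^sup>2 * (norm ?u)\<^sup>2"
        proof (rule holomorphic_second_order_remainder[OF \<open>open S\<close> assms(4) _ r(1)])
          show "cball (x y) r \<subseteq> S" using cb[OF x[OF y]] \<open>K' \<subseteq> S\<close> by blast
          show "norm (\<phi> w) \<le> \<bar>A\<bar>" if "w \<in> cball (x y) r" for w
            using A(1)[of w] that cb[OF x[OF y]] by fastforce
          show "norm ?u \<le> r / 2" using u elim by linarith
        qed
        also have "\<dots> \<le> 8 * \<bar>A\<bar> / r\<^sup>2 * (\<bar>t\<bar> * \<bar>B\<bar>)\<^sup>2"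
          using u by (intro mult_left_mono power_mono) auto
        finally show "norm (\<phi> (x y + ?u) - \<phi> (x y) - complex_of_real t * (deriv \<phi> (x y) * h y))
            \<le> (8 * \<bar>A\<bar> / r\<^sup>2 * B\<^sup>2) * t\<^sup>2"
          by (simp add: power_mult_distrib ac_simps)
      qed
    qed
  qed
qed

text \<open>Since \<open>d\<close> is bounded, the base is uniformly close to 1 for small
  \<open>t\<close>, which allows every real exponent, negative ones included. The power is read as a
  complex one, holomorphic on the right half-plane.\<close>

lemma uniform_expansion_powr:
  fixes d :: "'y \<Rightarrow> real"
  assumes d: "\<And>y. y \<in> D \<Longrightarrow> \<bar>d y\<bar> \<le> B"
  shows "uniform_expansion D (\<lambda>t y. complex_of_real ((1 + t * d y) powr s)) (\<lambda>_. 1)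
    (\<lambda>y. complex_of_real s * complex_of_real (d y))"
proof (rule uniform_expansion_cong)
  let ?S = "{z. 0 < Re z}"
  have "uniform_expansion D (\<lambda>t y. (1 + complex_of_real t * complex_of_real (d y)) powr complex_of_real s)
    (\<lambda>y. 1 powr complex_of_real s) (\<lambda>y. deriv (\<lambda>z. z powr complex_of_real s) 1 * complex_of_real (d y))"
  proof (rule uniform_expansion_holomorphic[where K = "{1}" and S = ?S])
    show "open ?S" by (rule open_halfspace_Re_gt)
    show "(\<lambda>z. z powr complex_of_real s) holomorphic_on ?S"
      by (intro holomorphic_intros) (auto simp: complex_nonpos_Reals_iff)
  qed (use d in auto)
  moreover have "deriv (\<lambda>z. z powr complex_of_real s) 1 = complex_of_real s"
    by (rule DERIV_imp_deriv) (auto intro!: derivative_eq_intros simp: complex_nonpos_Reals_iff)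
  ultimately show "uniform_expansion D
    (\<lambda>t y. (1 + complex_of_real t * complex_of_real (d y)) powr complex_of_real s)
    (\<lambda>_. 1) (\<lambda>y. complex_of_real s * complex_of_real (d y))" by simp
  show "\<forall>\<^sub>F t in nhds 0. \<forall>y\<in>D. complex_of_real ((1 + t * d y) powr s)
      = (1 + complex_of_real t * complex_of_real (d y)) powr complex_of_real s"
    using eventually_abs_mult_le[OF zero_less_one, of B]
  proof eventually_elim
    case (elim t)
    show ?case
    proof
      fix y assume "y \<in> D"
      then have "\<bar>t * d y\<bar> \<le> \<bar>t\<bar> * \<bar>B\<bar>"
        using d[of y] by (auto simp: abs_mult intro!: mult_left_mono)
      then have "0 \<le> 1 + t * d y" using elim by linarith
      then show "complex_of_real ((1 + t * d y) powr s)
          = (1 + complex_of_real t * complex_of_real (d y)) powr complex_of_real s"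
        using powr_of_real[of "1 + t * d y" s] by simp
    qed
  qed
qed simp_all

text \<open>No dominated convergence is needed, since the remainder is uniform.\<close>

lemma (in finite_measure) uniform_expansion_integral:
  assumes ue: "uniform_expansion (space M) f f0 f1"
    and meas: "\<forall>\<^sub>F t in nhds 0. f t \<in> borel_measurable M"
    and const: "\<forall>\<^sub>F t in nhds 0. (LINT y|M. f t y) = c"
  shows "integrable M f1" "(LINT y|M. f1 y) = 0"
proof -
  obtain C where C: "\<And>y. y \<in> space M \<Longrightarrow> norm (f0 y) \<le> C" "\<And>y. y \<in> space M \<Longrightarrow> norm (f1 y) \<le> C"
    "\<forall>\<^sub>F t in nhds 0. \<forall>y\<in>space M. norm (f t y - f0 y - complex_of_real t * f1 y) \<le> C * t\<^sup>2"
    using ue by (auto simp: uniform_expansion_def)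
  obtain e where "0 < e" and e: "\<And>t. \<bar>t\<bar> < e \<Longrightarrow> f t \<in> borel_measurable M"
      "\<And>t. \<bar>t\<bar> < e \<Longrightarrow> (LINT y|M. f t y) = c"
      "\<And>t y. \<bar>t\<bar> < e \<Longrightarrow> y \<in> space M \<Longrightarrow> norm (f t y - f0 y - complex_of_real t * f1 y) \<le> C * t\<^sup>2"
    using eventually_conj[OF meas eventually_conj[OF const C(3)]]
    by (auto simp: eventually_nhds_metric dist_norm)
  have f00: "f 0 y = f0 y" if "y \<in> space M" for y
    using e(3)[of 0 y] \<open>0 < e\<close> that by simp
  have f0m: "f0 \<in> borel_measurable M"
    using e(1)[of 0] \<open>0 < e\<close> f00 by (subst measurable_cong[of _ _ "f 0"]) auto
  define s where "s n = e / (real n + 2)" for n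
  have s: "0 < s n" "s n < e" for n
    using \<open>0 < e\<close> by (auto simp: s_def field_simps add_pos_nonneg)
  have s0: "s \<longlonglongrightarrow> 0" unfolding s_def by real_asymp
  have rem: "norm ((f (s n) y - f0 y) / complex_of_real (s n) - f1 y) \<le> C * s n" if "y \<in> space M" for n y
  proof -
    have "(f (s n) y - f0 y) / complex_of_real (s n) - f1 y
        = (f (s n) y - f0 y - complex_of_real (s n) * f1 y) / complex_of_real (s n)"
      using s[of n] by (simp add: field_simps)
    also have "norm \<dots> \<le> C * (s n)\<^sup>2 / s n"
      using e(3)[of "s n" y] s[of n] that by (auto simp: norm_divide intro!: divide_right_mono)
    also have "\<dots> = C * s n" using s[of n] by (simp add: power2_eq_square)
    finally show ?thesis .
  qed
  have f1m: "f1 \<in> borel_measurable M"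
  proof (rule borel_measurable_LIMSEQ_metric)
    show "(\<lambda>y. (f (s n) y - f0 y) / complex_of_real (s n)) \<in> borel_measurable M" for n
      using e(1)[of "s n"] s[of n] f0m by (auto intro!: borel_measurable_divide borel_measurable_diff)
    fix y assume y: "y \<in> space M"
    have "(\<lambda>n. (f (s n) y - f0 y) / complex_of_real (s n) - f1 y) \<longlonglongrightarrow> 0"
      by (rule Lim_null_comparison[where g = "\<lambda>n. C * s n"])
        (use rem[OF y] tendsto_mult_right_zero[OF s0] in auto)
    then show "(\<lambda>n. (f (s n) y - f0 y) / complex_of_real (s n)) \<longlonglongrightarrow> f1 y"
      by (simp add: LIM_zero_iff)
  qed
  show f1i: "integrable M f1"
    using C(2) f1m by (intro integrable_const_bound[where B = C]) auto
  have f0i: "integrable M f0"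
    using C(1) f0m by (intro integrable_const_bound[where B = C]) auto
  have ri: "integrable M (\<lambda>y. f t y - f0 y - complex_of_real t * f1 y)" if "\<bar>t\<bar> < e" for t
    using e(1,3)[OF that] f0m f1m
    by (intro integrable_const_bound[where B = "C * t\<^sup>2"] AE_I2 borel_measurable_diff borel_measurable_times) auto
  have fi: "integrable M (f t)" if "\<bar>t\<bar> < e" for t
  proof -
    have "integrable M (\<lambda>y. (f t y - f0 y - complex_of_real t * f1 y) + (f0 y + complex_of_real t * f1 y))"
      using ri[OF that] f0i f1i by (intro Bochner_Integration.integrable_add integrable_mult_right) auto
    then show ?thesis by (simp add: algebra_simps)
  qed
  have c: "(LINT y|M. f0 y) = c"
    using e(2)[of 0] \<open>0 < e\<close> f00 by (simp cong: Bochner_Integration.integral_cong)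
  \<comment> \<open>Both integrals in the difference quotient equal \<open>c\<close>, so only the
    integral of \<open>f1\<close> is left, and the uniform remainder bounds it by a multiple of
    \<open>s n\<close> for every \<open>n\<close>.\<close>
  have bound: "norm (LINT y|M. f1 y) \<le> C * s n * measure M (space M)" for n
  proof -
    have st: "\<bar>s n\<bar> < e" using s[of n] by simp
    have "norm (LINT y|M. (f (s n) y - f0 y) / complex_of_real (s n) - f1 y) \<le> (LINT y|M. C * s n)"
      using rem fi[OF st] f0i f1i
      by (intro order_trans[OF integral_norm_bound integral_mono] integrable_norm
          Bochner_Integration.integrable_diff integrable_divide) auto
    also have "(LINT y|M. (f (s n) y - f0 y) / complex_of_real (s n) - f1 y)
        = ((LINT y|M. f (s n) y) - (LINT y|M. f0 y)) / complex_of_real (s n) - (LINT y|M. f1 y)"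
      using fi[OF st] f0i f1i by simp
    finally show ?thesis using e(2)[OF st] c by (simp add: ac_simps)
  qed
  have "(\<lambda>n. C * s n * measure M (space M)) \<longlonglongrightarrow> 0"
    using s0 by (auto intro!: tendsto_eq_intros)
  then have "norm (LINT y|M. f1 y) \<le> 0"
    by (rule tendsto_lowerbound) (use bound in auto)
  then show "(LINT y|M. f1 y) = 0" by simp
qed

section \<open>Change of variables for product Lebesgue measure\<close>

lemma lborel_eq_nn_integral_substitution:
  fixes g g' :: "real \<Rightarrow> real"
  assumes "a \<le> b" and g: "\<And>x. x \<in> {a..b} \<Longrightarrow> (g has_real_derivative g' x) (at x)"
    and g': "continuous_on {a..b} g'" "\<And>x. x \<in> {a..b} \<Longrightarrow> 0 \<le> g' x" and "g a = a" "g b = b"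
    and A: "A \<in> sets borel"
  shows "emeasure lborel A = (\<integral>\<^sup>+x. ennreal (if x \<in> {a..b} then g' x else 1)
    * indicator A (if x \<in> {a..b} then g x else x) \<partial>lborel)"
proof -
  have gm: "(\<lambda>x. indicator {a..b} x *\<^sub>R g x) \<in> borel_measurable borel"
    "(\<lambda>x. indicator {a..b} x *\<^sub>R g' x) \<in> borel_measurable borel"
    by (intro borel_measurable_continuous_on_indicator
        has_real_derivative_imp_continuous_on[OF g] g'(1); simp)+
  have "emeasure lborel A = (\<integral>\<^sup>+x. indicator A x \<partial>lborel)" using A by simp
  also have "\<dots> = (\<integral>\<^sup>+x. indicator A x * indicator {a..b} x + indicator A x * indicator (- {a..b}) x \<partial>lborel)"
    by (intro nn_integral_cong) (auto simp: indicator_def)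
  also have "\<dots> = (\<integral>\<^sup>+x. ennreal (indicator A x * indicator {g a..g b} x) \<partial>lborel)
      + (\<integral>\<^sup>+x. indicator A x * indicator (- {a..b}) x \<partial>lborel)"
    using A assms(5,6) by (subst nn_integral_add) (auto simp: ennreal_mult ennreal_indicator)
  also have "(\<integral>\<^sup>+x. ennreal (indicator A x * indicator {g a..g b} x) \<partial>lborel)
      = (\<integral>\<^sup>+x. ennreal (indicator A (g x) * g' x * indicator {a..b} x) \<partial>lborel)"
    using A assms by (intro nn_integral_substitution) (auto simp: set_borel_measurable_def)
  also have "\<dots> + (\<integral>\<^sup>+x. indicator A x * indicator (- {a..b}) x \<partial>lborel)
      = (\<integral>\<^sup>+x. ennreal (indicator A (g x) * g' x * indicator {a..b} x) + indicator A x * indicator (- {a..b}) x \<partial>lborel)"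
  proof (rule nn_integral_add[symmetric])
    have "(\<lambda>x. indicator A (indicator {a..b} x *\<^sub>R g x) * (indicator {a..b} x *\<^sub>R g' x)) \<in> borel_measurable borel"
      using gm A by measurable
    moreover have "(\<lambda>x. indicator A (indicator {a..b} x *\<^sub>R g x) * (indicator {a..b} x *\<^sub>R g' x))
        = (\<lambda>x. indicator A (g x) * g' x * indicator {a..b} x)"
      by (auto simp: indicator_def)
    ultimately show "(\<lambda>x. ennreal (indicator A (g x) * g' x * indicator {a..b} x)) \<in> borel_measurable lborel"
      by simp
    show "(\<lambda>x. indicator A x * indicator (- {a..b}) x :: ennreal) \<in> borel_measurable lborel"
      using A by measurable
  qed
  also have "\<dots> = (\<integral>\<^sup>+x. ennreal (if x \<in> {a..b} then g' x else 1)
    * indicator A (if x \<in> {a..b} then g x else x) \<partial>lborel)"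
    using g'(2) by (intro nn_integral_cong) (auto simp: indicator_def)
  finally show ?thesis .
qed

text \<open>The map acts on each coordinate separately, so two measures need comparing on boxes
  only, where the integral factors into one-dimensional substitutions; no multivariate Jacobian
  theorem enters. Continuing the map by the identity outside \<open>{a..b}\<close> makes it a map of
  the whole line, as the product measure requires.\<close>

lemma integral_PiM_lborel_substitution:
  fixes g g' :: "real \<Rightarrow> real" and F :: "('i \<Rightarrow> real) \<Rightarrow> complex"
  assumes "finite I" "a \<le> b" and g: "\<And>x. x \<in> {a..b} \<Longrightarrow> (g has_real_derivative g' x) (at x)"
    and g': "continuous_on {a..b} g'" "\<And>x. x \<in> {a..b} \<Longrightarrow> 0 \<le> g' x" and "g a = a" "g b = b"
    and F: "F \<in> borel_measurable (\<Pi>\<^sub>M i\<in>I. lborel)"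
  defines "\<phi> \<equiv> \<lambda>x. if x \<in> {a..b} then g x else x"
  defines "\<psi> \<equiv> \<lambda>x. if x \<in> {a..b} then g' x else 1"
  shows "\<phi> \<in> borel_measurable borel" "\<psi> \<in> borel_measurable borel"
    "(LINT y|(\<Pi>\<^sub>M i\<in>I. lborel). F y)
      = (LINT y|(\<Pi>\<^sub>M i\<in>I. lborel). (\<Prod>i\<in>I. \<psi> (y i)) *\<^sub>R F (\<lambda>i\<in>I. \<phi> (y i)))"
proof -
  interpret product_sigma_finite "\<lambda>_::'i. lborel :: real measure" ..
  have gm: "(\<lambda>x. indicator {a..b} x *\<^sub>R g x) \<in> borel_measurable borel"
    "(\<lambda>x. indicator {a..b} x *\<^sub>R g' x) \<in> borel_measurable borel"
    by (intro borel_measurable_continuous_on_indicator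
        has_real_derivative_imp_continuous_on[OF g] g'(1); simp)+
  have "(\<lambda>x. indicator {a..b} x *\<^sub>R g x + indicator (- {a..b}) x * x) \<in> borel_measurable borel"
    using gm(1) by measurable
  moreover have "(\<lambda>x. indicator {a..b} x *\<^sub>R g x + indicator (- {a..b}) x * x) = \<phi>"
    by (auto simp: \<phi>_def indicator_def)
  ultimately show \<phi>[measurable]: "\<phi> \<in> borel_measurable borel" by simp
  have "(\<lambda>x. indicator {a..b} x *\<^sub>R g' x + indicator (- {a..b}) x) \<in> borel_measurable borel"
    using gm(2) by measurable
  moreover have "(\<lambda>x. indicator {a..b} x *\<^sub>R g' x + indicator (- {a..b}) x) = \<psi>"
    by (auto simp: \<psi>_def indicator_def)
  ultimately show \<psi>[measurable]: "\<psi> \<in> borel_measurable borel" by simp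
  have \<psi>0: "0 \<le> \<psi> x" for x using g'(2) by (auto simp: \<psi>_def)
  let ?L = "\<Pi>\<^sub>M i\<in>I. (lborel :: real measure)"
  let ?\<Phi> = "\<lambda>y. \<lambda>i\<in>I. \<phi> (y i)"
  have \<Phi>: "?\<Phi> \<in> ?L \<rightarrow>\<^sub>M ?L"
    by (intro measurable_restrict measurable_compose[OF measurable_component_singleton]) auto
  have \<Psi>: "(\<lambda>y. \<Prod>i\<in>I. \<psi> (y i)) \<in> borel_measurable ?L"
    by (intro borel_measurable_prod measurable_compose[OF measurable_component_singleton]) auto
  have eq: "distr (density ?L (\<lambda>y. ennreal (\<Prod>i\<in>I. \<psi> (y i)))) ?L ?\<Phi> = ?L"
  proof (rule PiM_eqI)
    fix A :: "'i \<Rightarrow> real set" assume A: "\<And>i. i \<in> I \<Longrightarrow> A i \<in> sets lborel"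
    have E: "Pi\<^sub>E I A \<in> sets ?L" using A \<open>finite I\<close> by (intro sets_PiM_I_finite) auto
    have "emeasure (distr (density ?L (\<lambda>y. ennreal (\<Prod>i\<in>I. \<psi> (y i)))) ?L ?\<Phi>) (Pi\<^sub>E I A)
      = emeasure (density ?L (\<lambda>y. ennreal (\<Prod>i\<in>I. \<psi> (y i)))) (?\<Phi> -` Pi\<^sub>E I A \<inter> space ?L)"
      using \<Phi> E by (subst emeasure_distr) auto
    also have "\<dots> = (\<integral>\<^sup>+y. ennreal (\<Prod>i\<in>I. \<psi> (y i)) * indicator (?\<Phi> -` Pi\<^sub>E I A \<inter> space ?L) y \<partial>?L)"
      using \<Phi> E \<Psi> by (intro emeasure_density) auto
    also have "\<dots> = (\<integral>\<^sup>+y. (\<Prod>i\<in>I. ennreal (\<psi> (y i)) * indicator (A i) (\<phi> (y i))) \<partial>?L)"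
    proof (rule nn_integral_cong)
      fix y assume "y \<in> space ?L"
      then have "indicator (?\<Phi> -` Pi\<^sub>E I A \<inter> space ?L) y = (\<Prod>i\<in>I. indicator (A i) (\<phi> (y i)) :: ennreal)"
        using \<open>finite I\<close> by (auto simp: indicator_def PiE_iff prod_zero_iff)
      then show "ennreal (\<Prod>i\<in>I. \<psi> (y i)) * indicator (?\<Phi> -` Pi\<^sub>E I A \<inter> space ?L) y
          = (\<Prod>i\<in>I. ennreal (\<psi> (y i)) * indicator (A i) (\<phi> (y i)))"
        using \<psi>0 by (simp add: prod.distrib prod_ennreal)
    qed
    also have "\<dots> = (\<Prod>i\<in>I. \<integral>\<^sup>+x. ennreal (\<psi> x) * indicator (A i) (\<phi> x) \<partial>lborel)"
    proof (rule product_nn_integral_prod[OF \<open>finite I\<close>])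
      fix i assume "i \<in> I"
      then have [measurable]: "A i \<in> sets borel" using A by simp
      show "(\<lambda>x. ennreal (\<psi> x) * indicator (A i) (\<phi> x)) \<in> borel_measurable lborel"
        by measurable
    qed
    also have "\<dots> = (\<Prod>i\<in>I. emeasure lborel (A i))"
      using A lborel_eq_nn_integral_substitution[OF assms(2) g g' assms(6,7)]
      unfolding \<phi>_def \<psi>_def by (intro prod.cong) auto
    finally show "emeasure (distr (density ?L (\<lambda>y. ennreal (\<Prod>i\<in>I. \<psi> (y i)))) ?L ?\<Phi>) (Pi\<^sub>E I A)
      = (\<Prod>i\<in>I. emeasure lborel (A i))" .
  qed (use \<open>finite I\<close> in auto)
  have "(LINT y|?L. F y) = (LINT y|distr (density ?L (\<lambda>y. ennreal (\<Prod>i\<in>I. \<psi> (y i)))) ?L ?\<Phi>. F y)"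
    by (simp only: eq)
  also have "\<dots> = (LINT y|density ?L (\<lambda>y. ennreal (\<Prod>i\<in>I. \<psi> (y i))). F (?\<Phi> y))"
    using \<Phi> F by (intro integral_distr) auto
  also have "\<dots> = (LINT y|?L. (\<Prod>i\<in>I. \<psi> (y i)) *\<^sub>R F (?\<Phi> y))"
    using \<Phi> F \<Psi> \<psi>0 by (intro integral_density) (auto intro!: prod_nonneg measurable_compose[OF \<Phi> F])
  finally show "(LINT y|?L. F y) = (LINT y|?L. (\<Prod>i\<in>I. \<psi> (y i)) *\<^sub>R F (?\<Phi> y))" .
qed

section \<open>Interlacing arrays\<close>

text \<open>
  The field \<open>h\<close> applied to the logarithm of the density, plus the divergence of \<open>h\<close>: \<open>D\<close> is the
  difference quotient of \<open>h\<close>, \<open>d\<close> its derivative, and \<open>e = V' h\<close>. For \<open>h(x) = 1 / (z - x)\<close>, with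
  \<open>V'\<close> taken at \<open>z\<close> instead of \<open>x\<close>, it is half the loop observable at \<open>z\<close>.
\<close>

definition ward_sum ::
  "nat \<Rightarrow> nat \<Rightarrow> real \<Rightarrow> (real \<Rightarrow> real \<Rightarrow> complex) \<Rightarrow> (real \<Rightarrow> complex) \<Rightarrow> (real \<Rightarrow> complex)
     \<Rightarrow> (nat \<times> nat \<Rightarrow> real) \<Rightarrow> complex" where
  "ward_sum N k \<theta> D d e y =
     (\<Sum>j=1..N. \<Sum>i=1..<j. D (y (N, j)) (y (N, i))) +
     (\<Sum>j=1..k. \<Sum>i=1..<j. complex_of_real (2 * \<theta> - 1) * D (y (k, j)) (y (k, i))) +
     (\<Sum>j=k..<N.
        (\<Sum>b=1..j. \<Sum>a=1..<b. complex_of_real (2 - 2 * \<theta>) * D (y (j, b)) (y (j, a))) +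
        (\<Sum>a=1..j. \<Sum>b=1..j+1. complex_of_real (\<theta> - 1) * D (y (j, a)) (y (j + 1, b)))) +
     (\<Sum>i=1..N. complex_of_real (- real N * \<theta>) * e (y (N, i))) +
     (\<Sum>p\<in>array_index k N. d (y p))"

lemma mem_array_index [simp]: "(j, i) \<in> array_index k N \<longleftrightarrow> k \<le> j \<and> j \<le> N \<and> 1 \<le> i \<and> i \<le> j"
  by (auto simp: array_index_def)

lemma finite_array_index [simp]: "finite (array_index k N)"
  by (auto simp: array_index_def)

lemma measurable_array_component [measurable]:
  "p \<in> array_index k N \<Longrightarrow> (\<lambda>y. y p) \<in> borel_measurable (array_lebesgue k N)"
  using measurable_component_singleton[of p "array_index k N" "\<lambda>_. lborel :: real measure"] by simp

lemma interlacing_level_less: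
  assumes "interlacing k N y" "k \<le> j" "j \<le> N" "1 \<le> a" "a < b" "b \<le> j"
  shows "y (j, a) < y (j, b)"
  using \<open>a < b\<close> \<open>b \<le> j\<close>
proof (induction b)
  case (Suc b)
  have "y (j, b) < y (j, Suc b)" if "1 \<le> b"
    using assms that Suc.prems by (auto simp: interlacing_def)
  then show ?case
    using Suc assms(4) by (cases "a = b") auto
qed simp

lemma interlacing_level_le:
  assumes "interlacing k N y" "k \<le> j" "j \<le> N" "1 \<le> a" "a \<le> b" "b \<le> j"
  shows "y (j, a) \<le> y (j, b)"
  using interlacing_level_less[OF assms(1-4)] assms(5,6) by (cases "a = b") (auto simp: less_imp_le)

lemma interlacing_between:
  assumes "interlacing k N y" "k \<le> j" "Suc j \<le> N" "1 \<le> a" "a \<le> j"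
  shows "y (Suc j, a) < y (j, a)" "y (j, a) < y (Suc j, Suc a)"
proof -
  have "\<forall>j\<in>{k+1..N}. \<forall>i\<in>{1..j-1}. y (j, i) < y (j - 1, i) \<and> y (j - 1, i) < y (j, i + 1)"
    using assms(1) by (simp add: interlacing_def)
  moreover have "Suc j \<in> {k+1..N}" "a \<in> {1..Suc j - 1}" using assms by auto
  ultimately have "y (Suc j, a) < y (Suc j - 1, a) \<and> y (Suc j - 1, a) < y (Suc j, a + 1)" by blast
  then show "y (Suc j, a) < y (j, a)" "y (j, a) < y (Suc j, Suc a)" by simp_all
qed

text \<open>Keeps the bases of the cross-level factors and the denominators of the cross-level
  difference quotients nonzero. The entry \<open>y (j, a)\<close> lies strictly between the entries
  \<open>a\<close> and \<open>Suc a\<close> of the level \<open>Suc j\<close>, and every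
  \<open>b\<close> is on one side of this gap.\<close>

lemma interlacing_adjacent_neq:
  assumes y: "interlacing k N y" and "k \<le> j" "Suc j \<le> N" "1 \<le> a" "a \<le> j" "1 \<le> b" "b \<le> Suc j"
  shows "y (j, a) \<noteq> y (Suc j, b)"
proof -
  have a: "y (Suc j, a) < y (j, a)" "y (j, a) < y (Suc j, Suc a)"
    using assms by (auto intro!: interlacing_between)
  show ?thesis
  proof (cases "b \<le> a")
    case True
    then show ?thesis
      using a(1) interlacing_level_le[OF y, of "Suc j" b a] assms by auto
  next
    case False
    then show ?thesis
      using a(2) interlacing_level_le[OF y, of "Suc j" "Suc a" b] assms by auto
  qed
qed

text \<open>Descending induction from the level \<open>N\<close>: an entry is enclosed by two
  entries of the next longer level. Thus the constraint imposed on the level \<open>N\<close> alone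
  confines all levels.\<close>

lemma interlacing_bounds:
  assumes y: "interlacing k N y" and "(j, i) \<in> array_index k N"
  shows "y (N, 1) \<le> y (j, i) \<and> y (j, i) \<le> y (N, N)"
proof -
  have "j \<le> N" using assms by simp
  then show ?thesis using assms(2)
  proof (induction j arbitrary: i rule: inc_induct)
    case base
    then show ?case
      using interlacing_level_le[OF y, of N 1 i] interlacing_level_le[OF y, of N i N] by auto
  next
    case (step j)
    have "y (Suc j, i) < y (j, i)" "y (j, i) < y (Suc j, Suc i)"
      using step y by (auto intro!: interlacing_between)
    moreover have "y (N, 1) \<le> y (Suc j, i)" "y (Suc j, Suc i) \<le> y (N, N)"
      using step.IH[of i] step.IH[of "Suc i"] step by auto
    ultimately show ?case by linarith
  qed
qed

lemma interlacing_strict_mono: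
  assumes "strict_mono (\<phi> :: real \<Rightarrow> real)"
    and z: "\<And>p. p \<in> array_index k N \<Longrightarrow> z p = \<phi> (y p)"
  shows "interlacing k N z \<longleftrightarrow> interlacing k N y"
proof -
  have less: "z p < z q \<longleftrightarrow> y p < y q" if "p \<in> array_index k N" "q \<in> array_index k N" for p q
    using that assms by (simp add: strict_mono_less)
  show ?thesis
    unfolding interlacing_def by (intro arg_cong2[where f = "(\<and>)"] ball_cong refl less) auto
qed

section \<open>The law of the array on the set of interlacing configurations\<close>

locale corners_process =
  fixes N k :: nat and am ap \<theta> :: real and U :: "complex set" and V :: "complex \<Rightarrow> complex"
    and M :: "'w measure" and Y :: "'w \<Rightarrow> nat \<times> nat \<Rightarrow> real"
  assumes am_less_ap: "am < ap" and open_U: "open U" and seg_U: "complex_of_real ` {am..ap} \<subseteq> U"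
    and V_hol: "V holomorphic_on U" and V_real: "\<And>x. x \<in> {am..ap} \<Longrightarrow> V (complex_of_real x) \<in> \<real>"
    and k_range: "k \<in> {1..N}" and prob_M: "prob_space M"
    and distr_Y: "distributed M (array_lebesgue k N) Y (\<lambda>y. ennreal (array_density N k am ap \<theta> V y))"
begin

abbreviation "seg \<equiv> complex_of_real ` {am..ap}"
abbreviation "L \<equiv> array_lebesgue k N"
abbreviation "W \<equiv> array_weight N k am ap \<theta> V"
abbreviation "dens \<equiv> array_density N k am ap \<theta> V"

lemma compact_seg: "compact seg"
  by (intro compact_continuous_image continuous_intros compact_Icc)

definition "good = {y \<in> space L. interlacing k N y \<and> am < y (N, 1) \<and> y (N, N) < ap}"

text \<open>Restriction to \<open>good\<close> turns almost sure properties into pointwise ones: at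
  every point of the space the entries interlace and lie inside the interval. Bounds and holomorphy
  can then be required for all sample points.\<close>

definition "law = restrict_space (distr M L Y) good"

lemma good_range: "y \<in> good \<Longrightarrow> p \<in> array_index k N \<Longrightarrow> am < y p \<and> y p < ap"
  using interlacing_bounds[of k N y "fst p" "snd p"] by (auto simp: good_def)

lemma sets_good: "good \<in> sets L"
proof -
  have c [measurable]: "\<And>j i. k \<le> j \<Longrightarrow> j \<le> N \<Longrightarrow> 1 \<le> i \<Longrightarrow> i \<le> j \<Longrightarrow> (\<lambda>y. y (j, i)) \<in> borel_measurable L"
    by (intro measurable_array_component) simp
  have 1: "Measurable.pred L (\<lambda>y. \<forall>j\<in>{k..N}. \<forall>i\<in>{1..<j}. y (j, i) < y (j, i + 1))"
    by (intro pred_intros_finite borel_measurable_pred_less c) auto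
  have 2: "Measurable.pred L (\<lambda>y. \<forall>j\<in>{k+1..N}. \<forall>i\<in>{1..j-1}. y (j, i) < y (j - 1, i) \<and> y (j - 1, i) < y (j, i + 1))"
    by (intro pred_intros_finite pred_intros_logic borel_measurable_pred_less c) auto
  have 3: "Measurable.pred L (\<lambda>y. am < y (N, 1))" "Measurable.pred L (\<lambda>y. y (N, N) < ap)"
    using k_range by (intro borel_measurable_pred_less c borel_measurable_const; auto)+
  have "Measurable.pred L (\<lambda>y. interlacing k N y \<and> am < y (N, 1) \<and> y (N, N) < ap)"
    unfolding interlacing_def by (intro pred_intros_logic 1 2 3)
  then show ?thesis by (simp add: good_def pred_def)
qed

lemma good_differences:
  assumes "y \<in> good"
  shows "k \<le> j \<Longrightarrow> j \<le> N \<Longrightarrow> 1 \<le> a \<Longrightarrow> a < b \<Longrightarrow> b \<le> j \<Longrightarrow> y (j, a) < y (j, b)"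
    and "k \<le> j \<Longrightarrow> Suc j \<le> N \<Longrightarrow> 1 \<le> a \<Longrightarrow> a \<le> j \<Longrightarrow> 1 \<le> b \<Longrightarrow> b \<le> Suc j \<Longrightarrow> y (j, a) \<noteq> y (Suc j, b)"
  using assms interlacing_level_less[of k N y] interlacing_adjacent_neq[of k N y]
  by (auto simp: good_def)

lemma weight_pos: "y \<in> good \<Longrightarrow> 0 < W y"
proof -
  assume y: "y \<in> good"
  have d: "y (j, b) \<noteq> y (j, a)" if "k \<le> j" "j \<le> N" "1 \<le> a" "a < b" "b \<le> j" for j a b
    using good_differences(1)[OF y that] by simp
  show "0 < W y"
    unfolding array_weight_def using k_range y
    by (intro mult_pos_pos prod_pos ballI)
      (auto simp: good_def d good_differences(2)[OF y] intro: good_differences(1)[OF y])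
qed

lemma weight_zero: "y \<in> space L \<Longrightarrow> y \<notin> good \<Longrightarrow> W y = 0"
  by (auto simp: array_weight_def good_def)

lemma density_zero: "y \<in> space L \<Longrightarrow> y \<notin> good \<Longrightarrow> dens y = 0"
  by (simp add: array_density_def weight_zero)

lemma density_nonneg: "y \<in> space L \<Longrightarrow> 0 \<le> dens y"
proof -
  have "0 \<le> W y" if "y \<in> space L" for y
    using weight_pos[of y] weight_zero[OF that] by (cases "y \<in> good") auto
  then show "y \<in> space L \<Longrightarrow> 0 \<le> dens y"
    unfolding array_density_def array_norm_const_def by (intro divide_nonneg_nonneg integral_nonneg) auto
qed

text \<open>Read off from \<open>distributed\<close>, which avoids analysing the formula, in which
  \<open>V\<close> is arbitrary outside \<open>U\<close>. Nonnegativity makes the passage through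
  \<open>ennreal\<close> and back the identity.\<close>

lemma density_measurable: "dens \<in> borel_measurable L"
proof -
  have "(\<lambda>y. enn2real (ennreal (dens y))) \<in> borel_measurable L"
    using distributed_borel_measurable[OF distr_Y] by measurable
  then show ?thesis
    by (subst measurable_cong[where g = "\<lambda>y. enn2real (ennreal (dens y))"]) (auto simp: density_nonneg)
qed

lemma Y_measurable: "Y \<in> M \<rightarrow>\<^sub>M L"
  using distributed_measurable[OF distr_Y] .

lemma distr_eq: "distr M L Y = density L (\<lambda>y. ennreal (dens y))"
  using distributed_distr_eq_density[OF distr_Y] by simp

text \<open>Division by zero would make the density vanish identically, whereas the distribution of
  \<open>Y\<close> has total mass 1.\<close>

lemma norm_const_nonzero: "array_norm_const N k am ap \<theta> V \<noteq> 0"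
proof
  assume "array_norm_const N k am ap \<theta> V = 0"
  then have "emeasure (density L (\<lambda>y. ennreal (dens y))) (space L) = 0"
    by (subst emeasure_density) (auto simp: array_density_def)
  moreover have "emeasure (distr M L Y) (space L) = 1"
    using prob_space.emeasure_space_1[OF prob_space.prob_space_distr[OF prob_M Y_measurable]] by simp
  ultimately show False by (simp add: distr_eq)
qed

lemma space_law: "space law = good"
  using sets.sets_into_space[OF sets_good] by (auto simp: law_def space_restrict_space)

lemma measurable_law: "g \<in> borel_measurable L \<Longrightarrow> g \<in> borel_measurable law"
  unfolding law_def by (intro measurable_restrict_space1) (simp add: measurable_distr_eq1)

text \<open>A function measurable for \<open>law\<close> is controlled on \<open>good\<close> only;
  the indicator extends it by 0 to a measurable function on all arrays.\<close>

lemma integral_law: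
  fixes g :: "_ \<Rightarrow> complex"
  assumes "g \<in> borel_measurable law"
  shows "(\<lambda>y. indicator good y *\<^sub>R g y) \<in> borel_measurable L"
    and "(LINT y|law. g y) = (LINT y|L. dens y *\<^sub>R (indicator good y *\<^sub>R g y))"
proof -
  show m: "(\<lambda>y. indicator good y *\<^sub>R g y) \<in> borel_measurable L"
    using assms sets_good unfolding law_def by (subst (asm) borel_measurable_restrict_space_iff) auto
  have "(LINT y|law. g y) = (LINT y|distr M L Y. indicator good y *\<^sub>R g y)"
    unfolding law_def using sets_good by (intro integral_restrict_space) auto
  also have "\<dots> = (LINT y|L. dens y *\<^sub>R (indicator good y *\<^sub>R g y))"
    unfolding distr_eq using density_nonneg
    by (intro integral_density m density_measurable AE_I2) auto
  finally show "(LINT y|law. g y) = (LINT y|L. dens y *\<^sub>R (indicator good y *\<^sub>R g y))" .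
qed

lemma integral_law_eq_expectation:
  fixes g :: "_ \<Rightarrow> complex"
  assumes "g \<in> borel_measurable L"
  shows "(LINT y|law. g y) = (LINT \<omega>|M. g (Y \<omega>))"
proof -
  have "(LINT y|law. g y) = (LINT y|L. dens y *\<^sub>R g y)"
    unfolding integral_law(2)[OF measurable_law[OF assms]]
  proof (rule Bochner_Integration.integral_cong)
    show "dens y *\<^sub>R (indicator good y *\<^sub>R g y) = dens y *\<^sub>R g y" if "y \<in> space L" for y
      using density_zero[OF that] by (cases "y \<in> good") auto
  qed simp
  also have "\<dots> = (LINT y|distr M L Y. g y)"
    unfolding distr_eq using density_nonneg
    by (intro integral_density[symmetric] assms density_measurable AE_I2) auto
  also have "\<dots> = (LINT \<omega>|M. g (Y \<omega>))"
    by (rule integral_distr[OF Y_measurable assms])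
  finally show ?thesis .
qed

lemma prob_space_law: "prob_space law"
proof
  have "1 = (\<integral>\<^sup>+y. ennreal (dens y) \<partial>L)"
    using prob_space.emeasure_space_1[OF prob_space.prob_space_distr[OF prob_M Y_measurable]]
      distributed_borel_measurable[OF distr_Y]
    by (simp add: distr_eq emeasure_density cong: nn_integral_cong)
  also have "\<dots> = (\<integral>\<^sup>+y. ennreal (dens y) * indicator good y \<partial>L)"
  proof (rule nn_integral_cong)
    show "ennreal (dens y) = ennreal (dens y) * indicator good y" if "y \<in> space L" for y
      using density_zero[OF that] by (cases "y \<in> good") auto
  qed
  also have "\<dots> = emeasure (distr M L Y) good"
    unfolding distr_eq using distributed_borel_measurable[OF distr_Y] sets_good
    by (intro emeasure_density[symmetric]) auto
  also have "\<dots> = emeasure law (space law)"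
    unfolding space_law unfolding law_def
    using sets_good by (subst emeasure_restrict_space) auto
  finally show "emeasure law (space law) = 1" by simp
qed

sublocale P: prob_space law by (rule prob_space_law)

text \<open>Continued by the identity outside the interval, so that it can be a strictly increasing
  map of the whole line that fixes the endpoints.\<close>

definition "flow h t = (\<lambda>x. if x \<in> {am..ap} then x + t * h x else x)" for h :: "real \<Rightarrow> real"

text \<open>The substitution rule for the diagonal map \<open>\<Phi>\<close>, written as an identity
  under \<open>law\<close>: the weight quotient replaces the density at \<open>y\<close> by that at
  \<open>\<Phi> y\<close>, and the product over all entries is the Jacobian. It has no boundary
  contribution because \<open>\<Phi> y\<close> is in \<open>good\<close> exactly when
  \<open>y\<close> is.\<close>

lemma integral_law_flow:
  fixes h h' :: "real \<Rightarrow> real" and X :: "_ \<Rightarrow> complex"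
  assumes h: "\<And>x. x \<in> {am..ap} \<Longrightarrow> (h has_real_derivative h' x) (at x)"
    and h': "continuous_on {am..ap} h'" and h0: "h am = 0" "h ap = 0"
    and t: "\<And>x. x \<in> {am..ap} \<Longrightarrow> 0 < 1 + t * h' x"
    and X: "X \<in> borel_measurable L"
  defines "\<Phi> \<equiv> \<lambda>y. \<lambda>p\<in>array_index k N. flow h t (y p)"
  defines "F \<equiv> \<lambda>y. complex_of_real (W (\<Phi> y) / W y * (\<Prod>p\<in>array_index k N. 1 + t * h' (y p))) * X (\<Phi> y)"
  shows "F \<in> borel_measurable law" "(LINT y|law. F y) = (LINT y|law. X y)"
proof -
  let ?g = "\<lambda>x. x + t * h x" and ?g' = "\<lambda>x. 1 + t * h' x"
  let ?\<psi> = "\<lambda>x. if x \<in> {am..ap} then ?g' x else 1"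
  have g: "(?g has_real_derivative ?g' x) (at x)" if "x \<in> {am..ap}" for x
    using h[OF that] by (auto intro!: derivative_eq_intros)
  have g': "continuous_on {am..ap} ?g'" by (intro continuous_intros h')
  have g'0: "0 \<le> ?g' x" if "x \<in> {am..ap}" for x using t[OF that] by simp
  note subst = integral_PiM_lborel_substitution[OF finite_array_index[of k N] less_imp_le[OF am_less_ap] g g' g'0]
  have fl: "flow h t = (\<lambda>x. if x \<in> {am..ap} then ?g x else x)" by (simp add: flow_def)
  have ends: "?g am = am" "?g ap = ap" using h0 by auto
  have g_mono: "?g x < ?g y" if "am \<le> x" "x < y" "y \<le> ap" for x y
    using that by (intro DERIV_pos_imp_increasing[OF \<open>x < y\<close>]) (metis atLeastAtMost_iff g order_trans t)
  have mono: "strict_mono (flow h t)"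
  proof (rule strict_monoI)
    fix x y :: real assume "x < y"
    have in1: "am \<le> ?g x" "?g x \<le> ap" if "x \<in> {am..ap}" for x
      using g_mono[of am x] g_mono[of x ap] that ends
      by (cases "x = am"; cases "x = ap"; auto)+
    show "flow h t x < flow h t y"
      using \<open>x < y\<close> in1[of x] in1[of y] g_mono[of x y] by (auto simp: flow_def)
  qed
  have fl_ends: "flow h t am = am" "flow h t ap = ap"
    using ends am_less_ap by (auto simp: flow_def)
  have \<Phi>_good: "\<Phi> y \<in> good \<longleftrightarrow> y \<in> good" if "y \<in> space L" for y
  proof -
    have "\<Phi> y \<in> space L" by (auto simp: \<Phi>_def space_PiM)
    moreover have "interlacing k N (\<Phi> y) \<longleftrightarrow> interlacing k N y"
      by (rule interlacing_strict_mono[OF mono]) (simp add: \<Phi>_def)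
    moreover have "am < \<Phi> y (N, 1) \<longleftrightarrow> am < y (N, 1)" "\<Phi> y (N, N) < ap \<longleftrightarrow> y (N, N) < ap"
      using k_range strict_mono_less[OF mono, of am "y (N, 1)"] strict_mono_less[OF mono, of "y (N, N)" ap]
      by (auto simp: \<Phi>_def fl_ends)
    ultimately show ?thesis using that by (simp add: good_def)
  qed
  have Xm: "(\<lambda>y. dens y *\<^sub>R (indicator good y *\<^sub>R X y)) \<in> borel_measurable L"
    using density_measurable sets_good X by measurable
  have flm: "flow h t \<in> borel_measurable borel"
    and \<psi>m: "?\<psi> \<in> borel_measurable borel"
    and eq: "(LINT y|L. dens y *\<^sub>R (indicator good y *\<^sub>R X y))
      = (LINT y|L. (\<Prod>p\<in>array_index k N. ?\<psi> (y p)) *\<^sub>R (dens (\<Phi> y) *\<^sub>R (indicator good (\<Phi> y) *\<^sub>R X (\<Phi> y))))"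
    using subst[OF _ _ ends Xm] unfolding \<Phi>_def fl by auto
  have \<Phi>m: "\<Phi> \<in> L \<rightarrow>\<^sub>M L"
    unfolding \<Phi>_def using flm
    by (intro measurable_restrict measurable_compose[OF measurable_component_singleton]) auto
  have \<Psi>m: "(\<lambda>y. \<Prod>p\<in>array_index k N. ?\<psi> (y p)) \<in> borel_measurable L"
    by (intro borel_measurable_prod measurable_compose[OF measurable_array_component \<psi>m])
  define \<Psi> where "\<Psi> y = (\<Prod>p\<in>array_index k N. ?\<psi> (y p))" for y
  \<comment> \<open>In the quotient the normalization constant cancels, so \<open>W\<close> may be
    replaced by \<open>dens\<close>, whose measurability is known.\<close>
  have pt: "F y = complex_of_real (dens (\<Phi> y) / dens y * (\<Prod>p\<in>array_index k N. ?\<psi> (y p))) * X (\<Phi> y)"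
    if "y \<in> good" for y
  proof -
    have "(\<Prod>p\<in>array_index k N. ?\<psi> (y p)) = (\<Prod>p\<in>array_index k N. 1 + t * h' (y p))"
      using good_range[OF that] by (intro prod.cong) (auto simp: less_imp_le)
    then show ?thesis
      using norm_const_nonzero by (simp add: F_def array_density_def)
  qed
  note [measurable] = density_measurable measurable_compose[OF \<Phi>m density_measurable]
    \<Psi>m[folded \<Psi>_def] measurable_compose[OF \<Phi>m X]
  have "(\<lambda>y. complex_of_real (dens (\<Phi> y) / dens y * \<Psi> y) * X (\<Phi> y)) \<in> borel_measurable L"
    by measurable
  then show Fm: "F \<in> borel_measurable law"
    by (subst measurable_cong[OF pt]) (auto simp: space_law \<Psi>_def intro: measurable_law)
  have "(LINT y|law. F y) = (LINT y|L. dens y *\<^sub>R (indicator good y *\<^sub>R F y))"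
    by (rule integral_law(2)[OF Fm])
  also have "\<dots> = (LINT y|L. (\<Prod>p\<in>array_index k N. ?\<psi> (y p)) *\<^sub>R (dens (\<Phi> y) *\<^sub>R (indicator good (\<Phi> y) *\<^sub>R X (\<Phi> y))))"
  proof (rule Bochner_Integration.integral_cong)
    fix y assume "y \<in> space L"
    moreover have "dens y \<noteq> 0" if "y \<in> good"
      using weight_pos[OF that] norm_const_nonzero by (simp add: array_density_def)
    ultimately show "dens y *\<^sub>R (indicator good y *\<^sub>R F y) = (\<Prod>p\<in>array_index k N. ?\<psi> (y p)) *\<^sub>R (dens (\<Phi> y) *\<^sub>R (indicator good (\<Phi> y) *\<^sub>R X (\<Phi> y)))"
      using \<Phi>_good[of y] pt[of y] by (cases "y \<in> good") (simp_all add: scaleR_conv_of_real)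
  qed simp
  also have "\<dots> = (LINT y|law. X y)"
    unfolding integral_law(2)[OF measurable_law[OF X]] eq ..
  finally show "(LINT y|law. F y) = (LINT y|law. X y)" .
qed

end

section \<open>The Ward identity\<close>

lemma uniform_expansion_linear:
  fixes d :: "'y \<Rightarrow> real"
  assumes "\<And>y. y \<in> D \<Longrightarrow> \<bar>d y\<bar> \<le> B"
  shows "uniform_expansion D (\<lambda>t y. complex_of_real (1 + t * d y)) (\<lambda>_. 1) (\<lambda>y. complex_of_real (d y))"
  by (rule uniform_expansionI[where A = 1 and B = B and C = 0]) (use assms in auto)

text \<open>With the identity in place of the random array, \<open>array_stieltjes\<close> becomes a
  deterministic function of an array. Everything can then be integrated under \<open>law\<close>
  without reference to \<open>M\<close>.\<close>

definition stieltjes_prod :: "(nat \<times> nat \<Rightarrow> complex) \<Rightarrow> (nat \<times> nat) set \<Rightarrow> (nat \<times> nat \<Rightarrow> real) \<Rightarrow> complex" where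
  "stieltjes_prod v I y = (\<Prod>p\<in>I. array_stieltjes (\<lambda>y. y) (fst p) (v p) y)"

text \<open>The derivative at \<open>t = 0\<close> of the Stieltjes transform at \<open>v\<close>
  when each entry \<open>x\<close> of level \<open>r\<close> moves to
  \<open>x + t * h x\<close>.\<close>

definition stieltjes_derivative :: "(real \<Rightarrow> complex) \<Rightarrow> nat \<Rightarrow> complex \<Rightarrow> (nat \<times> nat \<Rightarrow> real) \<Rightarrow> complex" where
  "stieltjes_derivative h r v y = (\<Sum>i=1..r. h (y (r, i)) / (v - complex_of_real (y (r, i)))\<^sup>2)"

lemma measurable_array_stieltjes:
  assumes "r \<in> {k..N}"
  shows "array_stieltjes (\<lambda>y. y) r z \<in> borel_measurable (array_lebesgue k N)"
proof -
  have [measurable]: "(\<lambda>y. y (r, i)) \<in> borel_measurable (array_lebesgue k N)" if "i \<in> {1..r}" for i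
    using that assms by (intro measurable_array_component) auto
  have "(\<lambda>y. \<Sum>i=1..r. 1 / (z - complex_of_real (y (r, i)))) \<in> borel_measurable (array_lebesgue k N)"
    by measurable
  then show ?thesis
    by (simp add: array_stieltjes_def[abs_def])
qed

lemma measurable_stieltjes_prod:
  assumes "\<And>p. p \<in> I \<Longrightarrow> fst p \<in> {k..N}"
  shows "stieltjes_prod v I \<in> borel_measurable (array_lebesgue k N)"
  unfolding stieltjes_prod_def[abs_def]
  by (intro borel_measurable_prod measurable_array_stieltjes assms)

context corners_process
begin

lemma deriv_V_real:
  assumes "x \<in> {am..ap}"
  shows "deriv V (complex_of_real x) \<in> \<real>"
proof -
  have d: "(V has_field_derivative deriv V (complex_of_real x)) (at (complex_of_real x))"
    using assms seg_U by (intro holomorphic_derivI[OF V_hol open_U]) auto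
  then have "((\<lambda>z. (V z - V (complex_of_real x)) / (z - complex_of_real x)) \<longlongrightarrow> deriv V (complex_of_real x))
      (at (complex_of_real x))"
    by (simp add: has_field_derivative_iff)
  moreover have "filterlim complex_of_real (at (complex_of_real x)) (at x within {am..ap})"
    by (auto simp: filterlim_at eventually_at_filter intro!: tendsto_intros)
  ultimately have lim: "((\<lambda>t. (V (complex_of_real t) - V (complex_of_real x)) / (complex_of_real t - complex_of_real x))
      \<longlongrightarrow> deriv V (complex_of_real x)) (at x within {am..ap})"
    by (rule filterlim_compose)
  show ?thesis
  proof (rule Lim_in_closed_set[OF closed_complex_Reals _ _ lim])
    show "\<forall>\<^sub>F t in at x within {am..ap}. (V (complex_of_real t) - V (complex_of_real x)) / (complex_of_real t - complex_of_real x) \<in> \<real>"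
      unfolding eventually_at_filter using V_real assms
      by (intro always_eventually) (auto intro!: Reals_divide Reals_diff)
    show "at x within {am..ap} \<noteq> bot"
      using am_less_ap assms by (simp add: trivial_limit_within islimpt_Icc)
  qed
qed

text \<open>By \<open>integral_law_flow\<close> the integral of the transported integrand is
  constant in small \<open>t\<close>. That integrand expands uniformly in \<open>t\<close> with
  first-order coefficient \<open>f1\<close>: the logarithmic derivative of weight and Jacobian times
  the test function, plus the derivative of the test function.\<close>

lemma Ward_identity_real:
  fixes h h' :: "real \<Rightarrow> real"
  assumes h: "\<And>x. x \<in> {am..ap} \<Longrightarrow> (h has_real_derivative h' x) (at x)"
    and h': "continuous_on {am..ap} h'" and h0: "h am = 0" "h ap = 0"
    and "finite I" and I: "\<And>p. p \<in> I \<Longrightarrow> fst p \<in> {k..N} \<and> v p \<notin> seg"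
  defines "f1 \<equiv> \<lambda>y. ward_sum N k \<theta> (\<lambda>x y. complex_of_real ((h x - h y) / (x - y)))
        (\<lambda>x. complex_of_real (h' x)) (\<lambda>x. deriv V (complex_of_real x) * complex_of_real (h x)) y
        * stieltjes_prod v I y
      + (\<Sum>p\<in>I. stieltjes_derivative (\<lambda>x. complex_of_real (h x)) (fst p) (v p) y * stieltjes_prod v (I - {p}) y)"
  shows "integrable law f1" "(LINT y|law. f1 y) = 0"
proof -
  obtain B where B: "\<And>x. x \<in> {am..ap} \<Longrightarrow> \<bar>h' x\<bar> \<le> B"
    using compact_imp_bounded[OF compact_continuous_image[OF h' compact_Icc]]
    by (metis bounded_iff imageI real_norm_def)
  have "continuous_on {am..ap} h"
    by (rule has_real_derivative_imp_continuous_on[OF h])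
  then obtain B' where B': "\<And>x. x \<in> {am..ap} \<Longrightarrow> \<bar>h x\<bar> \<le> B'"
    using compact_imp_bounded[OF compact_continuous_image[OF _ compact_Icc]]
    by (metis bounded_iff imageI real_norm_def)
  \<comment> \<open>Bounded by the supremum of \<open>h'\<close> through the mean value inequality.
    On the diagonal division by zero yields 0, which satisfies the same bound.\<close>
  define dq where "dq x y = (h x - h y) / (x - y)" for x y
  have dq: "\<bar>dq x y\<bar> \<le> \<bar>B\<bar>" if "x \<in> {am..ap}" "y \<in> {am..ap}" for x y
  proof -
    have "norm (h x - h y) \<le> B * norm (x - y)"
      using that B h by (intro field_differentiable_bound[of "{am..ap}" h h'])
        (auto intro: has_field_derivative_at_within)
    also have "\<dots> \<le> \<bar>B\<bar> * norm (x - y)" by (intro mult_right_mono) auto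
    finally show ?thesis by (cases "x = y") (auto simp: dq_def abs_divide divide_simps)
  qed
  have gr: "y p \<in> {am..ap}" if "y \<in> good" "p \<in> array_index k N" for y p
    using good_range[OF that] by auto
  define A where "A = array_index k N"
  \<comment> \<open>\<open>R\<close> is the quotient of the weights after and before the flow,
    \<open>J\<close> the Jacobian and \<open>Q\<close> the transported test function. The factors of
    \<open>R\<close> come from multiplying each difference of entries by \<open>1 + t * dq\<close>,
    which leaves no singular base.\<close>
  define R where "R t y =
     (\<Prod>j=1..N. \<Prod>i=1..<j. 1 + t * dq (y (N, j)) (y (N, i))) *
     (\<Prod>j=1..k. \<Prod>i=1..<j. (1 + t * dq (y (k, j)) (y (k, i))) powr (2 * \<theta> - 1)) *
     (\<Prod>j=k..<N.
        (\<Prod>b=1..j. \<Prod>a=1..<b. (1 + t * dq (y (j, b)) (y (j, a))) powr (2 - 2 * \<theta>)) *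
        (\<Prod>a=1..j. \<Prod>b=1..j+1. (1 + t * dq (y (j, a)) (y (j + 1, b))) powr (\<theta> - 1))) *
     (\<Prod>i=1..N. exp (- real N * \<theta> * (Re (V (complex_of_real (y (N, i) + t * h (y (N, i)))))
        - Re (V (complex_of_real (y (N, i)))))))" for t and y :: "nat \<times> nat \<Rightarrow> real"
  define J where "J t y = (\<Prod>p\<in>A. 1 + t * h' (y p))" for t and y :: "nat \<times> nat \<Rightarrow> real"
  define Q where "Q t y = (\<Prod>p\<in>I. \<Sum>i=1..fst p. 1 / (v p - (complex_of_real (y (fst p, i))
      + complex_of_real t * complex_of_real (h (y (fst p, i))))))" for t and y :: "nat \<times> nat \<Rightarrow> real"
  define \<Phi> where "\<Phi> t y = (\<lambda>p\<in>A. flow h t (y p))" for t and y :: "nat \<times> nat \<Rightarrow> real"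

  have small: "\<forall>\<^sub>F t :: real in nhds 0. \<bar>t\<bar> * \<bar>B\<bar> \<le> 1 / 2"
    by (rule eventually_abs_mult_le) simp
  have pos: "0 < 1 + t * h' x" "0 < 1 + t * dq x y"
    if "\<bar>t\<bar> * \<bar>B\<bar> \<le> 1 / 2" "x \<in> {am..ap}" "y \<in> {am..ap}" for t x y
  proof -
    have "\<bar>t * h' x\<bar> \<le> \<bar>t\<bar> * \<bar>B\<bar>" "\<bar>t * dq x y\<bar> \<le> \<bar>t\<bar> * \<bar>B\<bar>"
      unfolding abs_mult using B[OF that(2)] dq[OF that(2,3)] by (auto intro!: mult_left_mono)
    then show "0 < 1 + t * h' x" "0 < 1 + t * dq x y" using that(1) by linarith+
  qed
  \<comment> \<open>As \<open>h\<close> vanishes at the endpoints, the distance to an endpoint is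
    also multiplied by a factor \<open>1 + t * dq\<close>, which is positive for small
    \<open>t\<close>.\<close>
  have range: "x + t * h x \<in> {am..ap}" if "\<bar>t\<bar> * \<bar>B\<bar> \<le> 1 / 2" "x \<in> {am..ap}" for t x
  proof -
    have "x + t * h x - am = (x - am) * (1 + t * dq x am)"
      using h0 by (cases "x = am") (auto simp: dq_def field_simps)
    moreover have "ap - (x + t * h x) = (ap - x) * (1 + t * dq ap x)"
      using h0 by (cases "x = ap") (auto simp: dq_def field_simps)
    ultimately show ?thesis
      using pos(2)[OF that, of am] pos(2)[OF that(1) _ that(2), of ap] that(2) am_less_ap
      by (smt (verit) atLeastAtMost_iff mult_nonneg_nonneg)
  qed
  have flow: "flow h t (y p) = y p + t * h (y p)" if "y \<in> good" "p \<in> A" for t y p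
    using gr[OF that(1)] that(2) by (simp add: flow_def A_def)
  have diff: "\<Phi> t y p - \<Phi> t y q = (y p - y q) * (1 + t * dq (y p) (y q))"
    if "y \<in> good" "p \<in> A" "q \<in> A" "y p \<noteq> y q" for t y p q
    using that by (simp add: \<Phi>_def flow dq_def field_simps)
  have W: "W (\<Phi> t y) = W y * R t y" if t: "\<bar>t\<bar> * \<bar>B\<bar> \<le> 1 / 2" and y: "y \<in> good" for t y
  proof -
    have pos': "0 < 1 + t * dq (y p) (y q)" if "p \<in> A" "q \<in> A" for p q
      using that gr[OF y] by (intro pos(2)[OF t]) (auto simp: A_def)
    have less: "\<Phi> t y p < \<Phi> t y q" if "p \<in> A" "q \<in> A" "y p < y q" for p q
    proof -
      have "0 < (y q - y p) * (1 + t * dq (y q) (y p))"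
        using that pos' by (intro mult_pos_pos) auto
      then show ?thesis using diff[OF y that(2,1), of t] that(3) by simp
    qed
    have "interlacing k N (\<Phi> t y)"
      using y less unfolding good_def interlacing_def A_def by (auto intro!: less[unfolded A_def])
    moreover have "am < \<Phi> t y (N, 1)" "\<Phi> t y (N, N) < ap"
    proof -
      have mem: "(N, 1) \<in> A" "(N, N) \<in> A" using k_range by (auto simp: A_def)
      have "\<Phi> t y (N, 1) - am = (y (N, 1) - am) * (1 + t * dq (y (N, 1)) am)"
        "ap - \<Phi> t y (N, N) = (ap - y (N, N)) * (1 + t * dq ap (y (N, N)))"
        using mem y h0 by (auto simp: \<Phi>_def flow dq_def good_def field_simps)
      moreover have "0 < (y (N, 1) - am) * (1 + t * dq (y (N, 1)) am)"
        "0 < (ap - y (N, N)) * (1 + t * dq ap (y (N, N)))"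
        using mem y gr[OF y] am_less_ap by (auto intro!: mult_pos_pos pos(2)[OF t] simp: A_def good_def)
      ultimately show "am < \<Phi> t y (N, 1)" "\<Phi> t y (N, N) < ap" by linarith+
    qed
    moreover have "interlacing k N y" "am < y (N, 1)" "y (N, N) < ap" using y by (auto simp: good_def)
    ultimately have bools: "of_bool (interlacing k N (\<Phi> t y)) = (1 :: real)"
      "of_bool (am < \<Phi> t y (N, 1) \<and> \<Phi> t y (N, N) < ap) = (1 :: real)"
      "of_bool (interlacing k N y) = (1 :: real)" "of_bool (am < y (N, 1) \<and> y (N, N) < ap) = (1 :: real)"
      by simp_all
    have d: "\<Phi> t y (j, b) - \<Phi> t y (j, a) = (y (j, b) - y (j, a)) * (1 + t * dq (y (j, b)) (y (j, a)))"
      "(\<Phi> t y (j, b) - \<Phi> t y (j, a)) powr s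
        = (y (j, b) - y (j, a)) powr s * (1 + t * dq (y (j, b)) (y (j, a))) powr s"
      if "k \<le> j" "j \<le> N" "1 \<le> a" "a < b" "b \<le> j" for j a b s
    proof -
      have "y (j, a) < y (j, b)" using good_differences(1)[OF y that] .
      then show *: "\<Phi> t y (j, b) - \<Phi> t y (j, a) = (y (j, b) - y (j, a)) * (1 + t * dq (y (j, b)) (y (j, a)))"
        using that by (intro diff[OF y]) (auto simp: A_def)
      show "(\<Phi> t y (j, b) - \<Phi> t y (j, a)) powr s
        = (y (j, b) - y (j, a)) powr s * (1 + t * dq (y (j, b)) (y (j, a))) powr s"
        unfolding * by (rule powr_mult)
    qed
    have d': "\<bar>\<Phi> t y (j, a) - \<Phi> t y (j + 1, b)\<bar> powr s
        = \<bar>y (j, a) - y (j + 1, b)\<bar> powr s * (1 + t * dq (y (j, a)) (y (j + 1, b))) powr s"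
      if "k \<le> j" "j < N" "1 \<le> a" "a \<le> j" "1 \<le> b" "b \<le> j + 1" for j a b s
    proof -
      have "y (j, a) \<noteq> y (j + 1, b)" using good_differences(2)[OF y, of j a b] that by simp
      then have *: "\<Phi> t y (j, a) - \<Phi> t y (j + 1, b)
          = (y (j, a) - y (j + 1, b)) * (1 + t * dq (y (j, a)) (y (j + 1, b)))"
        using that by (intro diff[OF y]) (auto simp: A_def)
      have "0 < 1 + t * dq (y (j, a)) (y (j + 1, b))"
        using that by (intro pos') (auto simp: A_def)
      then show ?thesis
        unfolding * abs_mult by (subst powr_mult) auto
    qed
    have e1: "(\<Prod>j=1..N. \<Prod>i=1..<j. \<Phi> t y (N, j) - \<Phi> t y (N, i))
      = (\<Prod>j=1..N. \<Prod>i=1..<j. y (N, j) - y (N, i)) * (\<Prod>j=1..N. \<Prod>i=1..<j. 1 + t * dq (y (N, j)) (y (N, i)))"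
      using k_range unfolding prod.distrib[symmetric] by (intro prod.cong refl d) auto
    have e2: "(\<Prod>j=1..k. \<Prod>i=1..<j. (\<Phi> t y (k, j) - \<Phi> t y (k, i)) powr (2 * \<theta> - 1))
      = (\<Prod>j=1..k. \<Prod>i=1..<j. (y (k, j) - y (k, i)) powr (2 * \<theta> - 1))
        * (\<Prod>j=1..k. \<Prod>i=1..<j. (1 + t * dq (y (k, j)) (y (k, i))) powr (2 * \<theta> - 1))"
      using k_range unfolding prod.distrib[symmetric] by (intro prod.cong refl d) auto
    have e3: "(\<Prod>j=k..<N.
        (\<Prod>b=1..j. \<Prod>a=1..<b. (\<Phi> t y (j, b) - \<Phi> t y (j, a)) powr (2 - 2 * \<theta>)) *
        (\<Prod>a=1..j. \<Prod>b=1..j+1. \<bar>\<Phi> t y (j, a) - \<Phi> t y (j + 1, b)\<bar> powr (\<theta> - 1)))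
      = (\<Prod>j=k..<N.
        (\<Prod>b=1..j. \<Prod>a=1..<b. (y (j, b) - y (j, a)) powr (2 - 2 * \<theta>)) *
        (\<Prod>a=1..j. \<Prod>b=1..j+1. \<bar>y (j, a) - y (j + 1, b)\<bar> powr (\<theta> - 1))) *
        (\<Prod>j=k..<N.
        (\<Prod>b=1..j. \<Prod>a=1..<b. (1 + t * dq (y (j, b)) (y (j, a))) powr (2 - 2 * \<theta>)) *
        (\<Prod>a=1..j. \<Prod>b=1..j+1. (1 + t * dq (y (j, a)) (y (j + 1, b))) powr (\<theta> - 1)))"
    proof -
      have "(\<Prod>b=1..j. \<Prod>a=1..<b. (\<Phi> t y (j, b) - \<Phi> t y (j, a)) powr (2 - 2 * \<theta>))
        = (\<Prod>b=1..j. \<Prod>a=1..<b. (y (j, b) - y (j, a)) powr (2 - 2 * \<theta>))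
          * (\<Prod>b=1..j. \<Prod>a=1..<b. (1 + t * dq (y (j, b)) (y (j, a))) powr (2 - 2 * \<theta>))"
        "(\<Prod>a=1..j. \<Prod>b=1..j+1. \<bar>\<Phi> t y (j, a) - \<Phi> t y (j + 1, b)\<bar> powr (\<theta> - 1))
        = (\<Prod>a=1..j. \<Prod>b=1..j+1. \<bar>y (j, a) - y (j + 1, b)\<bar> powr (\<theta> - 1))
          * (\<Prod>a=1..j. \<Prod>b=1..j+1. (1 + t * dq (y (j, a)) (y (j + 1, b))) powr (\<theta> - 1))"
        if "j \<in> {k..<N}" for j
        using that unfolding prod.distrib[symmetric] by (intro prod.cong refl d d'; auto)+
      note level = this
      show ?thesis
        by (rule trans[OF prod.cong[OF refl] prod.distrib]) (simp only: level, simp only: ac_simps)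
    qed
    have e4: "(\<Prod>i=1..N. exp (- real N * \<theta> * Re (V (complex_of_real (\<Phi> t y (N, i))))))
      = (\<Prod>i=1..N. exp (- real N * \<theta> * Re (V (complex_of_real (y (N, i)))))) *
        (\<Prod>i=1..N. exp (- real N * \<theta> * (Re (V (complex_of_real (y (N, i) + t * h (y (N, i)))))
          - Re (V (complex_of_real (y (N, i)))))))"
      unfolding prod.distrib[symmetric]
    proof (intro prod.cong refl)
      fix i assume "i \<in> {1..N}"
      then have "(N, i) \<in> A" using k_range by (auto simp: A_def)
      then have "\<Phi> t y (N, i) = y (N, i) + t * h (y (N, i))" using y by (simp add: \<Phi>_def flow)
      then show "exp (- real N * \<theta> * Re (V (complex_of_real (\<Phi> t y (N, i)))))
        = exp (- real N * \<theta> * Re (V (complex_of_real (y (N, i))))) *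
          exp (- real N * \<theta> * (Re (V (complex_of_real (y (N, i) + t * h (y (N, i)))))
            - Re (V (complex_of_real (y (N, i))))))"
        unfolding mult_exp_exp by (simp add: algebra_simps)
    qed
    show ?thesis
      unfolding array_weight_def R_def bools e1 e2 e3 e4 by (simp only: mult_1_left ac_simps)
  qed

  have ue_dq: "uniform_expansion good (\<lambda>t y. complex_of_real (1 + t * dq (y p) (y q))) (\<lambda>_. 1)
      (\<lambda>y. complex_of_real (dq (y p) (y q)))" if "p \<in> A" "q \<in> A" for p q
    using that dq gr by (intro uniform_expansion_linear[where B = "\<bar>B\<bar>"]) (auto simp: A_def)
  have ue_powr: "uniform_expansion good (\<lambda>t y. complex_of_real ((1 + t * dq (y p) (y q)) powr s)) (\<lambda>_. 1)
      (\<lambda>y. complex_of_real s * complex_of_real (dq (y p) (y q)))" if "p \<in> A" "q \<in> A" for p q s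
    using that dq gr by (intro uniform_expansion_powr[where B = "\<bar>B\<bar>"]) (auto simp: A_def)
  have ue_h': "uniform_expansion good (\<lambda>t y. complex_of_real (1 + t * h' (y p))) (\<lambda>_. 1)
      (\<lambda>y. complex_of_real (h' (y p)))" if "p \<in> A" for p
    using that B gr by (intro uniform_expansion_linear[where B = B]) (auto simp: A_def)
  have ue_hol: "uniform_expansion good (\<lambda>t y. \<phi> (complex_of_real (y p) + complex_of_real t * complex_of_real (h (y p))))
      (\<lambda>y. \<phi> (complex_of_real (y p))) (\<lambda>y. deriv \<phi> (complex_of_real (y p)) * complex_of_real (h (y p)))"
    if "open S" "seg \<subseteq> S" "\<phi> holomorphic_on S" "p \<in> A" for \<phi> S p
    using that B' gr
    by (intro uniform_expansion_holomorphic[where S = S and K = seg and B = B'] compact_seg) (auto simp: A_def)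
  have ue_V: "uniform_expansion good (\<lambda>t y. complex_of_real (exp (- real N * \<theta> * (Re (V (complex_of_real (y p + t * h (y p))))
        - Re (V (complex_of_real (y p))))))) (\<lambda>_. 1)
      (\<lambda>y. complex_of_real (- real N * \<theta>) * (deriv V (complex_of_real (y p)) * complex_of_real (h (y p))))"
    if p: "p \<in> A" for p
  proof -
    \<comment> \<open>\<open>Re (V x)\<close> is not holomorphic in \<open>x\<close>. On the
      interval, which the flow does not leave, \<open>V\<close> is real, so the exponential factor
      is the holomorphic function \<open>exp (c * V z)\<close> at the moved entry times a constant
      depending on the initial entry.\<close>
    define c where "c = complex_of_real (- real N * \<theta>)"
    let ?e = "\<lambda>z. exp (c * V z)"
    have dV: "deriv ?e z = c * deriv V z * ?e z" if "z \<in> seg" for z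
      using seg_U that holomorphic_derivI[OF V_hol open_U, of z UNIV]
      by (intro DERIV_imp_deriv) (auto intro!: derivative_eq_intros)
    have hol: "?e holomorphic_on U" by (intro holomorphic_intros V_hol)
    have hol': "(\<lambda>z. exp (- (c * V z))) holomorphic_on U" by (intro holomorphic_intros V_hol)
    have "compact ((\<lambda>z. exp (- (c * V z))) ` seg)"
      using hol' seg_U by (meson compact_continuous_image holomorphic_on_imp_continuous_on holomorphic_on_subset compact_seg)
    then obtain E where E: "\<And>z. z \<in> seg \<Longrightarrow> norm (exp (- (c * V z))) \<le> E"
      by (metis compact_imp_bounded bounded_iff imageI)
    have "uniform_expansion good (\<lambda>_ y. exp (- (c * V (complex_of_real (y p)))))
        (\<lambda>y. exp (- (c * V (complex_of_real (y p))))) (\<lambda>_. 0)"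
      using gr p by (intro uniform_expansion_const[where B = E] E) (auto simp: A_def)
    from uniform_expansion_mult[OF ue_hol[OF open_U seg_U hol p] this]
    have m1: "uniform_expansion good
      (\<lambda>t y. ?e (complex_of_real (y p) + complex_of_real t * complex_of_real (h (y p))) * exp (- (c * V (complex_of_real (y p)))))
      (\<lambda>y. ?e (complex_of_real (y p)) * exp (- (c * V (complex_of_real (y p)))))
      (\<lambda>y. deriv ?e (complex_of_real (y p)) * complex_of_real (h (y p)) * exp (- (c * V (complex_of_real (y p)))))"
      by simp
    have m2: "deriv ?e (complex_of_real (y p)) * complex_of_real (h (y p)) * exp (- (c * V (complex_of_real (y p))))
        = c * (deriv V (complex_of_real (y p)) * complex_of_real (h (y p)))" if "y \<in> good" for y
      using dV[of "complex_of_real (y p)"] gr[OF that] p by (simp add: exp_minus A_def)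
    have m3: "\<forall>\<^sub>F t in nhds 0. \<forall>y\<in>good.
      complex_of_real (exp (- real N * \<theta> * (Re (V (complex_of_real (y p + t * h (y p)))) - Re (V (complex_of_real (y p))))))
      = ?e (complex_of_real (y p) + complex_of_real t * complex_of_real (h (y p))) * exp (- (c * V (complex_of_real (y p))))"
      using small
    proof eventually_elim
      case (elim t)
      show ?case
      proof
        fix y assume y: "y \<in> good"
        have x: "y p \<in> {am..ap}" using gr[OF y] p by (simp add: A_def)
        have Vx: "V (complex_of_real x) = complex_of_real (Re (V (complex_of_real x)))" if "x \<in> {am..ap}" for x
          using V_real[OF that] by (simp add: of_real_Re)
        define r r' where "r = Re (V (complex_of_real (y p)))" and "r' = Re (V (complex_of_real (y p + t * h (y p))))"
        have r: "V (complex_of_real (y p)) = complex_of_real r"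
          and r': "V (complex_of_real (y p + t * h (y p))) = complex_of_real r'"
          unfolding r_def r'_def by (rule Vx[OF x], rule Vx[OF range[OF elim x]])
        have "complex_of_real (y p) + complex_of_real t * complex_of_real (h (y p)) = complex_of_real (y p + t * h (y p))"
          by simp
        then show "complex_of_real (exp (- real N * \<theta> * (Re (V (complex_of_real (y p + t * h (y p)))) - Re (V (complex_of_real (y p))))))
          = ?e (complex_of_real (y p) + complex_of_real t * complex_of_real (h (y p))) * exp (- (c * V (complex_of_real (y p))))"
          unfolding mult_exp_exp exp_of_real[symmetric]
          by (simp only: r r' c_def Re_complex_of_real) (simp add: algebra_simps)
      qed
    qed
    show ?thesis
    proof (rule uniform_expansion_cong[OF m1 m3])
      show "1 = ?e (complex_of_real (y p)) * exp (- (c * V (complex_of_real (y p))))" for y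
        by (simp flip: exp_add)
    qed (simp only: m2 flip: c_def)
  qed
  \<comment> \<open>Every factor expands around 1, so the first-order coefficients simply add up.
    Their sum is \<open>ward_sum\<close>, the logarithmic derivative at
    \<open>t = 0\<close>.\<close>
  have ue_RJ: "uniform_expansion good (\<lambda>t y. complex_of_real (R t y) * complex_of_real (J t y)) (\<lambda>_. 1)
    (\<lambda>y. ward_sum N k \<theta> (\<lambda>x y. complex_of_real (dq x y)) (\<lambda>x. complex_of_real (h' x))
       (\<lambda>x. deriv V (complex_of_real x) * complex_of_real (h x)) y)"
  proof (rule uniform_expansion_cong)
    show "uniform_expansion good (\<lambda>t y.
     (\<Prod>j=1..N. \<Prod>i=1..<j. complex_of_real (1 + t * dq (y (N, j)) (y (N, i)))) *
     (\<Prod>j=1..k. \<Prod>i=1..<j. complex_of_real ((1 + t * dq (y (k, j)) (y (k, i))) powr (2 * \<theta> - 1))) *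
     (\<Prod>j=k..<N.
        (\<Prod>b=1..j. \<Prod>a=1..<b. complex_of_real ((1 + t * dq (y (j, b)) (y (j, a))) powr (2 - 2 * \<theta>))) *
        (\<Prod>a=1..j. \<Prod>b=1..j+1. complex_of_real ((1 + t * dq (y (j, a)) (y (j + 1, b))) powr (\<theta> - 1)))) *
     (\<Prod>i=1..N. complex_of_real (exp (- real N * \<theta> * (Re (V (complex_of_real (y (N, i) + t * h (y (N, i)))))
        - Re (V (complex_of_real (y (N, i)))))))) *
     (\<Prod>p\<in>A. complex_of_real (1 + t * h' (y p)))) (\<lambda>_. 1)
     (\<lambda>y. ward_sum N k \<theta> (\<lambda>x y. complex_of_real (dq x y)) (\<lambda>x. complex_of_real (h' x))
       (\<lambda>x. deriv V (complex_of_real x) * complex_of_real (h x)) y)"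
      unfolding ward_sum_def A_def[symmetric] using k_range
      by (intro uniform_expansion_mult_one uniform_expansion_prod_one ue_dq ue_powr ue_V ue_h')
        (auto simp: A_def)
    show "\<forall>\<^sub>F t in nhds 0. \<forall>y\<in>good. complex_of_real (R t y) * complex_of_real (J t y) =
     (\<Prod>j=1..N. \<Prod>i=1..<j. complex_of_real (1 + t * dq (y (N, j)) (y (N, i)))) *
     (\<Prod>j=1..k. \<Prod>i=1..<j. complex_of_real ((1 + t * dq (y (k, j)) (y (k, i))) powr (2 * \<theta> - 1))) *
     (\<Prod>j=k..<N.
        (\<Prod>b=1..j. \<Prod>a=1..<b. complex_of_real ((1 + t * dq (y (j, b)) (y (j, a))) powr (2 - 2 * \<theta>))) *
        (\<Prod>a=1..j. \<Prod>b=1..j+1. complex_of_real ((1 + t * dq (y (j, a)) (y (j + 1, b))) powr (\<theta> - 1)))) *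
     (\<Prod>i=1..N. complex_of_real (exp (- real N * \<theta> * (Re (V (complex_of_real (y (N, i) + t * h (y (N, i)))))
        - Re (V (complex_of_real (y (N, i)))))))) *
     (\<Prod>p\<in>A. complex_of_real (1 + t * h' (y p)))"
      unfolding R_def J_def by (simp only: of_real_mult of_real_prod) (intro always_eventually allI ballI refl)
  qed simp_all
  have ue_Q: "uniform_expansion good Q (stieltjes_prod v I)
    (\<lambda>y. \<Sum>p\<in>I. stieltjes_derivative (\<lambda>x. complex_of_real (h x)) (fst p) (v p) y * stieltjes_prod v (I - {p}) y)"
  proof (rule uniform_expansion_cong)
    let ?\<phi> = "\<lambda>p z. 1 / (v p - z)"
    show "uniform_expansion good Q
      (\<lambda>y. \<Prod>p\<in>I. \<Sum>i=1..fst p. ?\<phi> p (complex_of_real (y (fst p, i))))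
      (\<lambda>y. \<Sum>p\<in>I. (\<Sum>i=1..fst p. deriv (?\<phi> p) (complex_of_real (y (fst p, i))) * complex_of_real (h (y (fst p, i))))
        * (\<Prod>q\<in>I - {p}. \<Sum>i=1..fst q. ?\<phi> q (complex_of_real (y (fst q, i)))))"
      unfolding Q_def
    proof (intro uniform_expansion_prod uniform_expansion_sum \<open>finite I\<close>)
      fix p i assume "p \<in> I" "i \<in> {1..fst p}"
      then show "uniform_expansion good
        (\<lambda>t y. 1 / (v p - (complex_of_real (y (fst p, i)) + complex_of_real t * complex_of_real (h (y (fst p, i))))))
        (\<lambda>y. ?\<phi> p (complex_of_real (y (fst p, i))))
        (\<lambda>y. deriv (?\<phi> p) (complex_of_real (y (fst p, i))) * complex_of_real (h (y (fst p, i))))"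
        using I[of p] by (intro ue_hol[of "- {v p}" "?\<phi> p"]) (auto simp: A_def intro!: holomorphic_intros)
    qed
    show "stieltjes_prod v I y = (\<Prod>p\<in>I. \<Sum>i=1..fst p. ?\<phi> p (complex_of_real (y (fst p, i))))" for y
      by (simp add: stieltjes_prod_def array_stieltjes_def)
    fix y assume y: "y \<in> good"
    have "deriv (?\<phi> p) (complex_of_real (y (fst p, i))) * complex_of_real (h (y (fst p, i)))
      = complex_of_real (h (y (fst p, i))) / (v p - complex_of_real (y (fst p, i)))\<^sup>2" if "p \<in> I" "i \<in> {1..fst p}" for p i
    proof -
      have "v p \<noteq> complex_of_real (y (fst p, i))"
        using I[OF that(1)] gr[OF y, of "(fst p, i)"] that by auto
      then have "deriv (?\<phi> p) (complex_of_real (y (fst p, i))) = 1 / (v p - complex_of_real (y (fst p, i)))\<^sup>2"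
        by (intro DERIV_imp_deriv) (auto intro!: derivative_eq_intros simp: power2_eq_square)
      then show ?thesis by simp
    qed
    then show "(\<Sum>p\<in>I. stieltjes_derivative (\<lambda>x. complex_of_real (h x)) (fst p) (v p) y * stieltjes_prod v (I - {p}) y)
      = (\<Sum>p\<in>I. (\<Sum>i=1..fst p. deriv (?\<phi> p) (complex_of_real (y (fst p, i))) * complex_of_real (h (y (fst p, i))))
        * (\<Prod>q\<in>I - {p}. \<Sum>i=1..fst q. ?\<phi> q (complex_of_real (y (fst q, i)))))"
      unfolding stieltjes_derivative_def stieltjes_prod_def array_stieltjes_def
      by (intro sum.cong refl arg_cong2[where f = "(*)"]) simp_all
  qed simp
  define F where "F t y = complex_of_real (W (\<Phi> t y) / W y * J t y) * stieltjes_prod v I (\<Phi> t y)"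
    for t and y :: "nat \<times> nat \<Rightarrow> real"
  have Xm: "stieltjes_prod v I \<in> borel_measurable L"
    using I by (intro measurable_stieltjes_prod) auto
  have F: "F t \<in> borel_measurable law" "(LINT y|law. F t y) = (LINT y|law. stieltjes_prod v I y)"
    if "\<bar>t\<bar> * \<bar>B\<bar> \<le> 1 / 2" for t
    using integral_law_flow[OF h h' h0 pos(1)[OF that] Xm] am_less_ap
    unfolding F_def[abs_def] J_def \<Phi>_def A_def by auto
  have "uniform_expansion (space law) F (stieltjes_prod v I) f1"
    unfolding space_law
  proof (rule uniform_expansion_cong[OF uniform_expansion_mult[OF ue_RJ ue_Q]])
    show "\<forall>\<^sub>F t in nhds 0. \<forall>y\<in>good. F t y = complex_of_real (R t y) * complex_of_real (J t y) * Q t y"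
      using small
    proof eventually_elim
      case (elim t)
      show ?case
      proof
        fix y assume y: "y \<in> good"
        have "\<Phi> t y (fst p, i) = y (fst p, i) + t * h (y (fst p, i))" if "p \<in> I" "i \<in> {1..fst p}" for p i
        proof -
          have "(fst p, i) \<in> A" using I[OF that(1)] that(2) by (auto simp: A_def)
          then show ?thesis using y by (simp add: \<Phi>_def flow)
        qed
        then have "stieltjes_prod v I (\<Phi> t y) = Q t y"
          unfolding stieltjes_prod_def array_stieltjes_def Q_def
          by (intro prod.cong sum.cong refl) simp_all
        then show "F t y = complex_of_real (R t y) * complex_of_real (J t y) * Q t y"
          using weight_pos[OF y] by (simp add: F_def W[OF elim y])
      qed
    qed
  qed (simp_all add: f1_def dq_def)
  moreover have "\<forall>\<^sub>F t in nhds 0. F t \<in> borel_measurable law"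
    "\<forall>\<^sub>F t in nhds 0. (LINT y|law. F t y) = (LINT y|law. stieltjes_prod v I y)"
    using small F by (auto elim: eventually_mono)
  ultimately show "integrable law f1" "(LINT y|law. f1 y) = 0"
    by (rule P.uniform_expansion_integral)+
qed

end

section \<open>Holomorphic families of random variables\<close>

text \<open>The hypotheses under which \<open>has_contour_integral_expectation\<close> exchanges
  expectation and contour integral, bundled in a form that sums and products preserve.\<close>

definition holomorphic_family ::
  "'w measure \<Rightarrow> complex set \<Rightarrow> (complex \<Rightarrow> 'w \<Rightarrow> complex) \<Rightarrow> bool" where
  "holomorphic_family M S f \<longleftrightarrow>
     (\<forall>\<omega>\<in>space M. (\<lambda>z. f z \<omega>) holomorphic_on S) \<and>
     (\<forall>z\<in>S. f z \<in> borel_measurable M) \<and>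
     (\<forall>z\<in>S. \<exists>r>0. \<exists>B. \<forall>w\<in>cball z r. \<forall>\<omega>\<in>space M. norm (f w \<omega>) \<le> B)"

lemma holomorphic_familyD:
  assumes "holomorphic_family M S f"
  shows "\<omega> \<in> space M \<Longrightarrow> (\<lambda>z. f z \<omega>) holomorphic_on S"
    and "z \<in> S \<Longrightarrow> f z \<in> borel_measurable M"
    and "z \<in> S \<Longrightarrow> \<exists>r>0. \<exists>B. \<forall>w\<in>cball z r. \<forall>\<omega>\<in>space M. norm (f w \<omega>) \<le> B"
  using assms by (auto simp: holomorphic_family_def)

lemma holomorphic_family_bounded:
  assumes "holomorphic_family M S f" "z \<in> S"
  shows "\<exists>B. \<forall>\<omega>\<in>space M. norm (f z \<omega>) \<le> B"
  using holomorphic_familyD(3)[OF assms] by (meson centre_in_cball less_imp_le)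

lemma holomorphic_family_parameter:
  assumes "open S" "\<phi> holomorphic_on S"
  shows "holomorphic_family M S (\<lambda>z _. \<phi> z)"
  unfolding holomorphic_family_def
proof (intro conjI ballI)
  fix z assume "z \<in> S"
  then obtain r where r: "0 < r" "cball z r \<subseteq> S"
    using \<open>open S\<close> open_contains_cball by blast
  then have "compact (\<phi> ` cball z r)"
    using assms by (meson compact_cball compact_continuous_image holomorphic_on_imp_continuous_on holomorphic_on_subset)
  then obtain B where "\<forall>w\<in>cball z r. norm (\<phi> w) \<le> B"
    by (metis compact_imp_bounded bounded_iff imageI)
  then show "\<exists>r>0. \<exists>B. \<forall>w\<in>cball z r. \<forall>\<omega>\<in>space M. norm (\<phi> w) \<le> B"
    using r by blast
qed (use assms in auto)

lemma holomorphic_family_random: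
  assumes "\<psi> \<in> borel_measurable M" "\<And>\<omega>. \<omega> \<in> space M \<Longrightarrow> norm (\<psi> \<omega>) \<le> B"
  shows "holomorphic_family M S (\<lambda>_. \<psi>)"
  unfolding holomorphic_family_def
proof (intro conjI ballI)
  show "\<exists>r>0. \<exists>B. \<forall>w\<in>cball z r. \<forall>\<omega>\<in>space M. norm (\<psi> \<omega>) \<le> B" for z
    using assms(2) by (intro exI[of _ 1] conjI exI[of _ B]) auto
qed (use assms in auto)

lemma holomorphic_family_add:
  assumes f: "holomorphic_family M S f" and g: "holomorphic_family M S g"
  shows "holomorphic_family M S (\<lambda>z \<omega>. f z \<omega> + g z \<omega>)"
  unfolding holomorphic_family_def
proof (intro conjI ballI)
  fix z assume z: "z \<in> S"
  obtain r B r' B' where "0 < r" "\<forall>w\<in>cball z r. \<forall>\<omega>\<in>space M. norm (f w \<omega>) \<le> B"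
      "0 < r'" "\<forall>w\<in>cball z r'. \<forall>\<omega>\<in>space M. norm (g w \<omega>) \<le> B'"
    using holomorphic_familyD(3)[OF f z] holomorphic_familyD(3)[OF g z] by blast
  then show "\<exists>r>0. \<exists>B. \<forall>w\<in>cball z r. \<forall>\<omega>\<in>space M. norm (f w \<omega> + g w \<omega>) \<le> B"
    by (intro exI[of _ "min r r'"] conjI exI[of _ "B + B'"]) (auto intro!: norm_triangle_mono)
qed (auto intro!: holomorphic_on_add borel_measurable_add holomorphic_familyD[OF f] holomorphic_familyD[OF g])

lemma holomorphic_family_mult:
  assumes f: "holomorphic_family M S f" and g: "holomorphic_family M S g"
  shows "holomorphic_family M S (\<lambda>z \<omega>. f z \<omega> * g z \<omega>)"
  unfolding holomorphic_family_def
proof (intro conjI ballI)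
  fix z assume z: "z \<in> S"
  obtain r B r' B' where r: "0 < r" "\<And>w \<omega>. w \<in> cball z r \<Longrightarrow> \<omega> \<in> space M \<Longrightarrow> norm (f w \<omega>) \<le> B"
      "0 < r'" "\<And>w \<omega>. w \<in> cball z r' \<Longrightarrow> \<omega> \<in> space M \<Longrightarrow> norm (g w \<omega>) \<le> B'"
    using holomorphic_familyD(3)[OF f z] holomorphic_familyD(3)[OF g z] by metis
  have "norm (f w \<omega> * g w \<omega>) \<le> B * B'" if "w \<in> cball z (min r r')" "\<omega> \<in> space M" for w \<omega>
    unfolding norm_mult using r(2)[of w \<omega>] r(4)[of w \<omega>] that
    by (intro mult_mono) (auto intro: order_trans[OF norm_ge_zero])
  then show "\<exists>r>0. \<exists>B. \<forall>w\<in>cball z r. \<forall>\<omega>\<in>space M. norm (f w \<omega> * g w \<omega>) \<le> B"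
    using r(1,3) by (intro exI[of _ "min r r'"] conjI exI[of _ "B * B'"]) auto
qed (auto intro!: holomorphic_on_mult borel_measurable_times holomorphic_familyD[OF f] holomorphic_familyD[OF g])

lemma holomorphic_family_const: "open S \<Longrightarrow> holomorphic_family M S (\<lambda>_ _. c)"
  by (rule holomorphic_family_parameter) auto

lemma holomorphic_family_sum:
  assumes "open S" "\<And>i. i \<in> I \<Longrightarrow> holomorphic_family M S (f i)"
  shows "holomorphic_family M S (\<lambda>z \<omega>. \<Sum>i\<in>I. f i z \<omega>)"
  using assms(2)
proof (induction I rule: infinite_finite_induct)
  case (insert i I)
  then show ?case by (simp add: holomorphic_family_add)
qed (auto intro: holomorphic_family_const[OF assms(1)])

lemma holomorphic_family_power2:
  "holomorphic_family M S f \<Longrightarrow> holomorphic_family M S (\<lambda>z \<omega>. (f z \<omega>)\<^sup>2)"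
  unfolding power2_eq_square by (rule holomorphic_family_mult)

lemma holomorphic_family_prod:
  assumes "open S" "\<And>i. i \<in> I \<Longrightarrow> holomorphic_family M S (f i)"
  shows "holomorphic_family M S (\<lambda>z \<omega>. \<Prod>i\<in>I. f i z \<omega>)"
  using assms(2)
proof (induction I rule: infinite_finite_induct)
  case (insert i I)
  then show ?case by (simp add: holomorphic_family_mult)
qed (auto intro: holomorphic_family_const[OF assms(1)])

lemma holomorphic_family_cong:
  assumes "open S" "holomorphic_family M S g" "\<And>z \<omega>. z \<in> S \<Longrightarrow> \<omega> \<in> space M \<Longrightarrow> f z \<omega> = g z \<omega>"
  shows "holomorphic_family M S f"
  unfolding holomorphic_family_def
proof (intro conjI ballI)
  show "(\<lambda>z. f z \<omega>) holomorphic_on S" if "\<omega> \<in> space M" for \<omega>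
    using holomorphic_familyD(1)[OF assms(2) that] assms(3)[OF _ that] by (metis holomorphic_transform)
  fix z assume z: "z \<in> S"
  show "f z \<in> borel_measurable M"
    using holomorphic_familyD(2)[OF assms(2) z] assms(3)[OF z] by (simp cong: measurable_cong)
  obtain r B where r: "0 < r" "\<forall>w\<in>cball z r. \<forall>\<omega>\<in>space M. norm (g w \<omega>) \<le> B"
    using holomorphic_familyD(3)[OF assms(2) z] by blast
  obtain s where s: "0 < s" "cball z s \<subseteq> S"
    using assms(1) z open_contains_cball by blast
  show "\<exists>r>0. \<exists>B. \<forall>w\<in>cball z r. \<forall>\<omega>\<in>space M. norm (f w \<omega>) \<le> B"
    using r s assms(3) by (intro exI[of _ "min r s"] conjI exI[of _ B]) (auto simp: subset_iff)
qed

lemma holomorphic_family_subset: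
  assumes "holomorphic_family M T f" "T' \<subseteq> T"
  shows "holomorphic_family M T' f"
  using assms holomorphic_on_subset unfolding holomorphic_family_def by blast

text \<open>A closed disc in \<open>S\<close> times \<open>K\<close> is compact and misses the
  diagonal, so one bound for the resolvent holds for all sample points.\<close>

lemma holomorphic_family_resolvent:
  assumes "open S" "compact K" "S \<inter> K = {}" "X \<in> borel_measurable M" "\<And>\<omega>. \<omega> \<in> space M \<Longrightarrow> X \<omega> \<in> K"
  shows "holomorphic_family M S (\<lambda>z \<omega>. 1 / (z - X \<omega>))"
  unfolding holomorphic_family_def
proof (intro conjI ballI)
  show "(\<lambda>z. 1 / (z - X \<omega>)) holomorphic_on S" if "\<omega> \<in> space M" for \<omega>
    using assms(3) assms(5)[OF that] by (intro holomorphic_intros) auto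
  show "(\<lambda>\<omega>. 1 / (z - X \<omega>)) \<in> borel_measurable M" for z
    using assms(4) by measurable
  fix z assume "z \<in> S"
  then obtain r where r: "0 < r" "cball z r \<subseteq> S"
    using \<open>open S\<close> open_contains_cball by blast
  have "compact ((\<lambda>p. 1 / (fst p - snd p)) ` (cball z r \<times> K))"
    using r assms(2,3) by (intro compact_continuous_image continuous_intros compact_Times) auto
  then obtain B where B: "\<And>p. p \<in> cball z r \<times> K \<Longrightarrow> norm (1 / (fst p - snd p)) \<le> B"
    by (metis (no_types, lifting) compact_imp_bounded bounded_iff imageI)
  then show "\<exists>r>0. \<exists>B. \<forall>w\<in>cball z r. \<forall>\<omega>\<in>space M. norm (1 / (w - X \<omega>)) \<le> B"
    using r(1) assms(5) by fastforce
qed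

lemma (in finite_measure) holomorphic_family_contour:
  assumes "open S" "holomorphic_family M S f" "valid_path \<gamma>" "path_image \<gamma> \<subseteq> S"
    and "\<And>\<omega>. \<omega> \<in> space M \<Longrightarrow> ((\<lambda>z. f z \<omega>) has_contour_integral I \<omega>) \<gamma>"
  shows "((\<lambda>z. LINT \<omega>|M. f z \<omega>) has_contour_integral (LINT \<omega>|M. I \<omega>)) \<gamma>" "integrable M I"
  by (rule has_contour_integral_expectation[OF assms(1) holomorphic_familyD(1,2,3)[OF assms(2)] assms(3,4,5)]; assumption)+

section \<open>Measurability and algebra of the loop observable\<close>

lemma sum_resolvents_not_differentiable:
  fixes x :: "'i \<Rightarrow> complex"
  assumes "finite I" "i \<in> I" "x i = z"
  shows "\<not> ((\<lambda>\<zeta>. \<Sum>i\<in>I. 1 / (\<zeta> - x i)) has_field_derivative D) (at z)"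
proof
  let ?f = "\<lambda>\<zeta>. \<Sum>i\<in>I. 1 / (\<zeta> - x i)"
  assume "(?f has_field_derivative D) (at z)"
  then have "(?f \<longlongrightarrow> ?f z) (at z)"
    by (rule DERIV_isCont[unfolded isCont_def])
  moreover have "((\<lambda>\<zeta>. \<zeta> - z) \<longlongrightarrow> z - z) (at z)"
    by (intro tendsto_intros)
  ultimately have "((\<lambda>\<zeta>. (\<zeta> - z) * ?f \<zeta>) \<longlongrightarrow> (z - z) * ?f z) (at z)"
    by (intro tendsto_mult)
  \<comment> \<open>Multiplied by the distance to \<open>z\<close>, each resolvent with pole at
    \<open>z\<close> contributes 1 to the limit. The limit is thus the number of such poles, whereas
    differentiability, hence continuity, would force it to be 0.\<close>
  moreover have "((\<lambda>\<zeta>. (\<zeta> - z) * ?f \<zeta>) \<longlongrightarrow> (\<Sum>i\<in>I. if x i = z then 1 else 0)) (at z)"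
    unfolding sum_distrib_left
  proof (rule tendsto_sum)
    fix i
    show "((\<lambda>\<zeta>. (\<zeta> - z) * (1 / (\<zeta> - x i))) \<longlongrightarrow> (if x i = z then 1 else 0)) (at z)"
    proof (cases "x i = z")
      case True
      have "\<forall>\<^sub>F \<zeta> in at z. (\<zeta> - z) * (1 / (\<zeta> - x i)) = 1"
        using True by (simp add: eventually_at_filter)
      then show ?thesis using True by (simp add: tendsto_eventually)
    next
      case False
      then have "((\<lambda>\<zeta>. (\<zeta> - z) * (1 / (\<zeta> - x i))) \<longlongrightarrow> (z - z) * (1 / (z - x i))) (at z)"
        by (intro tendsto_intros) auto
      then show ?thesis using False by simp
    qed
  qed
  ultimately have "(\<Sum>i\<in>I. if x i = z then 1 else 0) = (0 :: complex)"
    by (metis (no_types, lifting) LIM_unique diff_self mult_zero_left)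
  moreover have "(\<Sum>i\<in>I. if x i = z then 1 else 0) = complex_of_real (real (card {i\<in>I. x i = z}))"
    using \<open>finite I\<close> by (simp add: sum.If_cases Int_def)
  moreover have "card {i\<in>I. x i = z} \<noteq> 0"
    using assms by (auto simp: card_eq_0_iff)
  ultimately show False by (metis of_nat_eq_0_iff of_real_eq_0_iff)
qed

text \<open>Transporting cumulants from \<open>M\<close> to \<open>law\<close> needs the observable
  to be measurable on all arrays, including those with an entry at \<open>z\<close>. There no
  derivative exists, and \<open>deriv\<close> takes a fixed default value; knowing that it is
  constant settles measurability.\<close>

lemma deriv_array_stieltjes:
  "deriv (\<lambda>\<zeta>. array_stieltjes (\<lambda>y. y) j \<zeta> y) z =
     (if \<exists>i\<in>{1..j}. complex_of_real (y (j, i)) = z then (SOME D. False)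
      else - (\<Sum>i=1..j. (1 / (z - complex_of_real (y (j, i))))\<^sup>2))"
proof (cases "\<exists>i\<in>{1..j}. complex_of_real (y (j, i)) = z")
  case True
  then have "\<not> ((\<lambda>\<zeta>. array_stieltjes (\<lambda>y. y) j \<zeta> y) has_field_derivative D) (at z)" for D
    unfolding array_stieltjes_def
    using sum_resolvents_not_differentiable[of "{1..j}" _ "\<lambda>i. complex_of_real (y (j, i))" z D] by blast
  then show ?thesis using True by (simp add: deriv_def)
next
  case False
  then have "((\<lambda>\<zeta>. array_stieltjes (\<lambda>y. y) j \<zeta> y) has_field_derivative
      (\<Sum>i=1..j. - (1 / (z - complex_of_real (y (j, i))))\<^sup>2)) (at z)"
    unfolding array_stieltjes_def
    by (intro DERIV_sum) (auto intro!: derivative_eq_intros simp: power2_eq_square)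
  then show ?thesis using False by (simp add: DERIV_imp_deriv sum_negf)
qed

lemma measurable_deriv_array_stieltjes:
  assumes "j \<in> {k..N}"
  shows "(\<lambda>y. deriv (\<lambda>\<zeta>. array_stieltjes (\<lambda>y. y) j \<zeta> y) z) \<in> borel_measurable (array_lebesgue k N)"
proof -
  have c [measurable]: "(\<lambda>y. y (j, i)) \<in> borel_measurable (array_lebesgue k N)" if "i \<in> {1..j}" for i
    using that assms by (intro measurable_array_component) auto
  have "(\<lambda>y. - (\<Sum>i=1..j. (1 / (z - complex_of_real (y (j, i))))\<^sup>2)) \<in> borel_measurable (array_lebesgue k N)"
    by measurable
  moreover have "Measurable.pred (array_lebesgue k N) (\<lambda>y. \<exists>i\<in>{1..j}. complex_of_real (y (j, i)) = z)"
  proof (intro pred_intros_finite)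
    show "Measurable.pred (array_lebesgue k N) (\<lambda>y. complex_of_real (y (j, i)) = z)" if "i \<in> {1..j}" for i
      using c[OF that] by measurable
  qed simp
  ultimately show ?thesis
    unfolding deriv_array_stieltjes by (intro measurable_If) auto
qed

lemma measurable_loop_observable:
  assumes "k \<in> {1..N}"
  shows "loop_observable N k \<theta> V (\<lambda>y. y) z \<in> borel_measurable (array_lebesgue k N)"
proof -
  note m = measurable_array_stieltjes[of _ k N z] measurable_deriv_array_stieltjes[of _ k N z]
  show ?thesis
    unfolding loop_observable_def[abs_def] Let_def using assms
    by (intro borel_measurable_add borel_measurable_diff borel_measurable_times borel_measurable_sum
        borel_measurable_power borel_measurable_uminus borel_measurable_const m) auto
qed

lemma sum_pairs_less:
  fixes a :: "nat \<Rightarrow> complex"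
  shows "(\<Sum>j=1..n. \<Sum>i=1..<j. a j * a i) = ((\<Sum>i=1..n. a i)\<^sup>2 - (\<Sum>i=1..n. (a i)\<^sup>2)) / 2"
proof (induction n)
  case (Suc n)
  have "{1..<Suc n} = {1..n}" by auto
  then have "(\<Sum>j=1..Suc n. \<Sum>i=1..<j. a j * a i) = (\<Sum>j=1..n. \<Sum>i=1..<j. a j * a i) + a (Suc n) * (\<Sum>i=1..n. a i)"
    by (simp add: sum_distrib_left)
  then show ?case
    unfolding Suc.IH by (simp add: power2_eq_square field_simps)
qed simp

text \<open>Here \<open>a j\<close> is the Stieltjes transform of level \<open>j\<close> and
  \<open>b j\<close> its derivative. The left side is what \<open>ward_sum\<close> delivers, the
  right side the form of the observable: from one level to the next the cross term completes a
  square, and the leftover \<open>t\<close> terms telescope to the levels \<open>k\<close> and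
  \<open>N\<close>.\<close>

lemma loop_telescope:
  fixes a b :: "nat \<Rightarrow> complex" and t :: complex
  assumes "k \<le> N"
  shows "(a N)\<^sup>2 + b N + (2 * t - 1) * ((a k)\<^sup>2 + b k)
      + (\<Sum>j=k..<N. (2 - 2 * t) * ((a j)\<^sup>2 + b j) + 2 * (t - 1) * (a j * a (j + 1))) - 2 * (\<Sum>j=k..N. b j)
    = t * b N + t * (a N)\<^sup>2 + (t - 2) * b k + t * (a k)\<^sup>2
      + (\<Sum>j=k+1..N. - (t + 1) * b j + (1 - t) * (a j - a (j - 1))\<^sup>2 + (1 - t) * b (j - 1))"
  using assms
proof (induction N rule: dec_induct)
  case base
  then show ?case by (simp add: algebra_simps)
next
  case (step n)
  let ?f = "\<lambda>j. (2 - 2 * t) * ((a j)\<^sup>2 + b j) + 2 * (t - 1) * (a j * a (j + 1))"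
  let ?g = "\<lambda>j. - (t + 1) * b j + (1 - t) * (a j - a (j - 1))\<^sup>2 + (1 - t) * b (j - 1)"
  have s: "sum ?f {k..<Suc n} = sum ?f {k..<n} + ?f n" "sum b {k..Suc n} = sum b {k..n} + b (Suc n)"
    "sum ?g {k+1..Suc n} = sum ?g {k+1..n} + ?g (Suc n)"
    using step by simp_all
  show ?case
    unfolding s using step.IH by (simp add: power2_eq_square algebra_simps)
qed

section \<open>Loop equations\<close>

text \<open>Linearity in the field, to be used with the imaginary unit as \<open>c\<close>.\<close>

lemma ward_sum_add_scaled:
  "ward_sum N k \<theta> (\<lambda>x y. D1 x y + c * D2 x y) (\<lambda>x. d1 x + c * d2 x) (\<lambda>x. e1 x + c * e2 x) y
     = ward_sum N k \<theta> D1 d1 e1 y + c * ward_sum N k \<theta> D2 d2 e2 y"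
  unfolding ward_sum_def
  by (simp only: sum.distrib sum_distrib_left distrib_left mult.left_commute[of _ c]) (simp only: add_ac)

lemma stieltjes_derivative_add_scaled:
  "stieltjes_derivative (\<lambda>x. h1 x + c * h2 x) r v y
     = stieltjes_derivative h1 r v y + c * stieltjes_derivative h2 r v y"
  by (simp add: stieltjes_derivative_def sum.distrib sum_distrib_left add_divide_distrib)

context corners_process
begin

text \<open>A complex field generates no flow on the real line, but the identity is linear in the
  field. It is applied to the real and the imaginary part of \<open>H\<close>, both of which vanish
  at the endpoints, and recombined.\<close>

lemma Ward_identity:
  assumes "open S" "seg \<subseteq> S" and H: "H holomorphic_on S"
    and H0: "H (complex_of_real am) = 0" "H (complex_of_real ap) = 0"
    and "finite I" and I: "\<And>p. p \<in> I \<Longrightarrow> fst p \<in> {k..N} \<and> v p \<notin> seg"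
  shows "(LINT y|law. ward_sum N k \<theta>
        (\<lambda>x y. (H (complex_of_real x) - H (complex_of_real y)) / (complex_of_real x - complex_of_real y))
        (\<lambda>x. deriv H (complex_of_real x)) (\<lambda>x. deriv V (complex_of_real x) * H (complex_of_real x)) y
        * stieltjes_prod v I y
      + (\<Sum>p\<in>I. stieltjes_derivative (\<lambda>x. H (complex_of_real x)) (fst p) (v p) y * stieltjes_prod v (I - {p}) y)) = 0"
proof -
  define h1 h2 h1' h2' where "h1 x = Re (H (complex_of_real x))" and "h2 x = Im (H (complex_of_real x))"
    and "h1' x = Re (deriv H (complex_of_real x))" and "h2' x = Im (deriv H (complex_of_real x))" for x
  have der: "(h1 has_real_derivative h1' x) (at x)" "(h2 has_real_derivative h2' x) (at x)"
    if "x \<in> {am..ap}" for x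
  proof -
    have "complex_of_real x \<in> S" using \<open>seg \<subseteq> S\<close> that by blast
    then have "((\<lambda>x. H (complex_of_real x)) has_vector_derivative deriv H (complex_of_real x)) (at x)"
      by (intro has_vector_derivative_real_field holomorphic_derivI[OF H \<open>open S\<close>])
    then show "(h1 has_real_derivative h1' x) (at x)" "(h2 has_real_derivative h2' x) (at x)"
      unfolding h1_def[abs_def] h2_def[abs_def] h1'_def h2'_def has_real_derivative_iff_has_vector_derivative
      by (rule bounded_linear.has_vector_derivative[OF bounded_linear_Re]
          bounded_linear.has_vector_derivative[OF bounded_linear_Im])+
  qed
  have "continuous_on {am..ap} (\<lambda>x. deriv H (complex_of_real x))"
    by (rule continuous_on_compose2[OF holomorphic_on_imp_continuous_on[OF holomorphic_deriv[OF H \<open>open S\<close>]]])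
      (use \<open>seg \<subseteq> S\<close> in \<open>auto intro!: continuous_intros\<close>)
  then have cont: "continuous_on {am..ap} h1'" "continuous_on {am..ap} h2'"
    unfolding h1'_def[abs_def] h2'_def[abs_def] by (intro continuous_intros; assumption)+
  have ends: "h1 am = 0" "h1 ap = 0" "h2 am = 0" "h2 ap = 0"
    using H0 by (simp_all add: h1_def h2_def)
  define f where "f h h' y = ward_sum N k \<theta> (\<lambda>x y. complex_of_real ((h x - h y) / (x - y)))
        (\<lambda>x. complex_of_real (h' x)) (\<lambda>x. deriv V (complex_of_real x) * complex_of_real (h x)) y
        * stieltjes_prod v I y
      + (\<Sum>p\<in>I. stieltjes_derivative (\<lambda>x. complex_of_real (h x)) (fst p) (v p) y * stieltjes_prod v (I - {p}) y)"
    for h h' y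
  have W1: "integrable law (f h1 h1')" "(LINT y|law. f h1 h1' y) = 0"
    using Ward_identity_real[OF der(1) cont(1) ends(1,2) \<open>finite I\<close> I] unfolding f_def[abs_def] by auto
  have W2: "integrable law (f h2 h2')" "(LINT y|law. f h2 h2' y) = 0"
    using Ward_identity_real[OF der(2) cont(2) ends(3,4) \<open>finite I\<close> I] unfolding f_def[abs_def] by auto
  have H_eq: "H (complex_of_real x) = complex_of_real (h1 x) + \<i> * complex_of_real (h2 x)"
    and H'_eq: "deriv H (complex_of_real x) = complex_of_real (h1' x) + \<i> * complex_of_real (h2' x)" for x
    by (simp_all add: complex_eq_iff h1_def h2_def h1'_def h2'_def)
  have D_eq: "(complex_of_real (h1 x) + \<i> * complex_of_real (h2 x) - (complex_of_real (h1 y) + \<i> * complex_of_real (h2 y)))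
      / (complex_of_real x - complex_of_real y)
    = complex_of_real ((h1 x - h1 y) / (x - y)) + \<i> * complex_of_real ((h2 x - h2 y) / (x - y))" for x y
    by (simp add: diff_divide_distrib add_divide_distrib algebra_simps)
  have e_eq: "deriv V (complex_of_real x) * (complex_of_real (h1 x) + \<i> * complex_of_real (h2 x))
    = deriv V (complex_of_real x) * complex_of_real (h1 x) + \<i> * (deriv V (complex_of_real x) * complex_of_real (h2 x))" for x
    by (simp add: algebra_simps)
  have "(LINT y|law. ward_sum N k \<theta>
        (\<lambda>x y. (H (complex_of_real x) - H (complex_of_real y)) / (complex_of_real x - complex_of_real y))
        (\<lambda>x. deriv H (complex_of_real x)) (\<lambda>x. deriv V (complex_of_real x) * H (complex_of_real x)) y
        * stieltjes_prod v I y
      + (\<Sum>p\<in>I. stieltjes_derivative (\<lambda>x. H (complex_of_real x)) (fst p) (v p) y * stieltjes_prod v (I - {p}) y))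
    = (LINT y|law. f h1 h1' y + \<i> * f h2 h2' y)"
    unfolding H_eq H'_eq D_eq e_eq ward_sum_add_scaled stieltjes_derivative_add_scaled f_def
    by (simp only: distrib_left distrib_right sum.distrib sum_distrib_left ac_simps)
  also have "\<dots> = 0"
    using W1 W2 by simp
  finally show ?thesis .
qed

text \<open>The enumeration chosen in \<open>cumulant_with\<close> depends on \<open>J\<close>
  alone, so both sides use the same order and no symmetry of cumulants is invoked; it remains to
  equate the two generating functions.\<close>

lemma cumulant_with_law:
  assumes "finite J" and \<xi>: "\<xi> \<in> borel_measurable L" and X: "\<And>p. p \<in> J \<Longrightarrow> X p \<in> borel_measurable L"
  shows "cumulant_with M (\<lambda>p \<omega>. X p (Y \<omega>)) (\<lambda>\<omega>. \<xi> (Y \<omega>)) J = cumulant_with law X \<xi> J"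
proof -
  define ps where "ps = (SOME ps. distinct ps \<and> set ps = J)"
  have ps: "set ps = J"
    using someI_ex[of "\<lambda>ps. distinct ps \<and> set ps = J"] finite_distinct_list[OF \<open>finite J\<close>]
    unfolding ps_def by blast
  let ?Xs = "\<xi> # map X ps"
  have nth: "((\<lambda>\<omega>. \<xi> (Y \<omega>)) # map (\<lambda>p \<omega>. X p (Y \<omega>)) ps) ! i = (\<lambda>\<omega>. (?Xs ! i) (Y \<omega>))"
    if "i < length ?Xs" for i
    using that by (cases i) auto
  have m: "?Xs ! i \<in> borel_measurable L" if "i < length ?Xs" for i
    using that \<xi> X ps by (cases i) auto
  have "(LINT \<omega>|M. exp (\<Sum>i<length ?Xs. z i * (((\<lambda>\<omega>. \<xi> (Y \<omega>)) # map (\<lambda>p \<omega>. X p (Y \<omega>)) ps) ! i) \<omega>))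
      = (LINT y|law. exp (\<Sum>i<length ?Xs. z i * (?Xs ! i) y))" for z
  proof -
    have "(\<lambda>y. \<Sum>i<length ?Xs. z i * (?Xs ! i) y) \<in> borel_measurable L"
      using m by (intro borel_measurable_sum borel_measurable_times) auto
    then have "(LINT y|law. exp (\<Sum>i<length ?Xs. z i * (?Xs ! i) y)) = (LINT \<omega>|M. exp (\<Sum>i<length ?Xs. z i * (?Xs ! i) (Y \<omega>)))"
      by (rule integral_law_eq_expectation[OF measurable_compose[OF _ borel_measurable_exp]])
    also have "\<dots> = (LINT \<omega>|M. exp (\<Sum>i<length ?Xs. z i * (((\<lambda>\<omega>. \<xi> (Y \<omega>)) # map (\<lambda>p \<omega>. X p (Y \<omega>)) ps) ! i) \<omega>))"
      using nth by (intro Bochner_Integration.integral_cong refl arg_cong[where f = exp] sum.cong) auto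
    finally show ?thesis by simp
  qed
  then show ?thesis
    unfolding cumulant_with_def joint_cumulant_def ps_def[symmetric] by simp
qed

end

section \<open>Cauchy integrals around the interval\<close>

locale corners_contour = corners_process +
  fixes S :: "complex set" and H :: "complex \<Rightarrow> complex" and \<Gamma> :: "real \<Rightarrow> complex"
  assumes open_S: "open S" and seg_S: "seg \<subseteq> S" and S_U: "S \<subseteq> U" and H_hol: "H holomorphic_on S"
    and H_ends: "H (complex_of_real am) = 0" "H (complex_of_real ap) = 0"
    and path_\<Gamma>: "valid_path \<Gamma>" "pathfinish \<Gamma> = pathstart \<Gamma>" "path_image \<Gamma> \<subseteq> S - seg"
    and winding: "\<And>x. x \<in> seg \<Longrightarrow> winding_number \<Gamma> x = 1" "\<And>w. w \<notin> S \<Longrightarrow> winding_number \<Gamma> w = 0"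
begin

abbreviation "g z \<equiv> H z / (2 * complex_of_real pi * \<i>)"

lemma open_compl_seg: "open (- seg)"
  using compact_seg by (simp add: compact_imp_closed open_Compl)

lemma open_S_seg: "open (S - seg)"
  by (intro open_Diff open_S compact_imp_closed compact_seg)

text \<open>Global Cauchy formula, with winding number 1 on the interval and 0 outside
  \<open>S\<close>. The function is left general since besides \<open>H\<close> it will be
  \<open>deriv H\<close>, \<open>deriv V\<close> times \<open>H\<close>, and \<open>H\<close>
  divided by the square of \<open>z - w\<close>.\<close>

lemma Cauchy_seg:
  assumes "f holomorphic_on S" "x \<in> {am..ap}"
  shows "((\<lambda>z. f z / (2 * complex_of_real pi * \<i>) * (1 / (z - complex_of_real x))) has_contour_integral f (complex_of_real x)) \<Gamma>"
proof -
  have "((\<lambda>z. f z / (z - complex_of_real x)) has_contour_integral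
      (2 * pi * \<i> * winding_number \<Gamma> (complex_of_real x) * f (complex_of_real x))) \<Gamma>"
    using assms seg_S path_\<Gamma> winding(2)
    by (intro Cauchy_integral_formula_global[OF open_S]) auto
  then have "((\<lambda>z. f z / (z - complex_of_real x) / (2 * complex_of_real pi * \<i>)) has_contour_integral
      (2 * pi * \<i> * winding_number \<Gamma> (complex_of_real x) * f (complex_of_real x)) / (2 * complex_of_real pi * \<i>)) \<Gamma>"
    by (rule has_contour_integral_div)
  then show ?thesis
    using winding(1)[of "complex_of_real x"] assms(2) by (simp add: mult.commute)
qed

text \<open>The derivative of \<open>H z / (z - x)\<close> integrates to 0 over the closed contour,
  which trades the double pole for the simple pole of \<open>deriv H z / (z - x)\<close>.\<close>

lemma Cauchy_seg_square:
  assumes x: "x \<in> {am..ap}"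
  shows "((\<lambda>z. g z * (1 / (z - complex_of_real x))\<^sup>2) has_contour_integral deriv H (complex_of_real x)) \<Gamma>"
proof -
  let ?x = "complex_of_real x" and ?c = "2 * complex_of_real pi * \<i>"
  have "((\<lambda>z. deriv H z / ?c * (1 / (z - ?x)) - g z * (1 / (z - ?x))\<^sup>2) has_contour_integral
      (H (pathfinish \<Gamma>) / ?c / (pathfinish \<Gamma> - ?x) - H (pathstart \<Gamma>) / ?c / (pathstart \<Gamma> - ?x))) \<Gamma>"
  proof (rule contour_integral_primitive[where S = "S - seg"])
    fix z assume z: "z \<in> S - seg"
    then have nz: "z - ?x \<noteq> 0" using x by auto
    have alg: "(A * w - B * 1) / (w * w) = A * (1 / w) - B * (1 / w)\<^sup>2" if "w \<noteq> 0" for A B w :: complex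
      using that by (simp add: field_simps power2_eq_square)
    have "(H has_field_derivative deriv H z) (at z within S - seg)"
      using holomorphic_derivI[OF H_hol open_S] z by auto
    then have "((\<lambda>z. H z / ?c) has_field_derivative deriv H z / ?c) (at z within S - seg)"
      by (rule DERIV_cdivide)
    moreover have "((\<lambda>z. z - ?x) has_field_derivative 1) (at z within S - seg)"
      by (auto intro!: derivative_eq_intros)
    ultimately show "((\<lambda>z. H z / ?c / (z - ?x)) has_field_derivative
        deriv H z / ?c * (1 / (z - ?x)) - g z * (1 / (z - ?x))\<^sup>2) (at z within S - seg)"
      unfolding alg[OF nz, symmetric] using nz by (rule DERIV_divide)
  qed (use path_\<Gamma> in auto)
  then have "((\<lambda>z. deriv H z / ?c * (1 / (z - ?x)) - g z * (1 / (z - ?x))\<^sup>2) has_contour_integral 0) \<Gamma>"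
    using path_\<Gamma>(2) by simp
  from has_contour_integral_diff[OF Cauchy_seg[OF holomorphic_deriv[OF H_hol open_S] x] this]
  show ?thesis by simp
qed

text \<open>Partial fractions split the two poles into simple ones; this is how a difference
  quotient of \<open>H\<close> becomes a contour integral.\<close>

lemma Cauchy_seg_pair:
  assumes "x \<in> {am..ap}" "y \<in> {am..ap}" "x \<noteq> y"
  shows "((\<lambda>z. g z * (1 / (z - complex_of_real x) * (1 / (z - complex_of_real y)))) has_contour_integral
    (H (complex_of_real x) - H (complex_of_real y)) / (complex_of_real x - complex_of_real y)) \<Gamma>"
proof (rule has_contour_integral_eq)
  let ?x = "complex_of_real x" and ?y = "complex_of_real y"
  show "((\<lambda>z. (g z * (1 / (z - ?x)) - g z * (1 / (z - ?y))) / (?x - ?y)) has_contour_integral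
    (H ?x - H ?y) / (?x - ?y)) \<Gamma>"
    by (intro has_contour_integral_div has_contour_integral_diff Cauchy_seg H_hol assms)
  fix z assume "z \<in> path_image \<Gamma>"
  then have "z \<noteq> ?x" "z \<noteq> ?y" using path_\<Gamma>(3) assms by auto
  then have "1 / (z - ?x) - 1 / (z - ?y) = (?x - ?y) * (1 / (z - ?x) * (1 / (z - ?y)))"
    by (simp add: field_simps)
  then have "g z * (1 / (z - ?x)) - g z * (1 / (z - ?y)) = g z * ((?x - ?y) * (1 / (z - ?x) * (1 / (z - ?y))))"
    by (metis right_diff_distrib)
  then show "(g z * (1 / (z - ?x)) - g z * (1 / (z - ?y))) / (?x - ?y) = g z * (1 / (z - ?x) * (1 / (z - ?y)))"
    using assms(3) by simp
qed

lemma deriv_V_hol: "deriv V holomorphic_on S"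
  using holomorphic_deriv[OF V_hol open_U] S_U holomorphic_on_subset by blast

definition "ward_kernel z = ward_sum N k \<theta>
  (\<lambda>x y. 1 / (z - complex_of_real x) * (1 / (z - complex_of_real y)))
  (\<lambda>x. (1 / (z - complex_of_real x))\<^sup>2) (\<lambda>x. deriv V z * (1 / (z - complex_of_real x)))"

definition "ward_H = ward_sum N k \<theta>
  (\<lambda>x y. (H (complex_of_real x) - H (complex_of_real y)) / (complex_of_real x - complex_of_real y))
  (\<lambda>x. deriv H (complex_of_real x)) (\<lambda>x. deriv V (complex_of_real x) * H (complex_of_real x))"

lemma contour_ward_kernel:
  assumes y: "y \<in> good"
  shows "((\<lambda>z. g z * ward_kernel z y) has_contour_integral ward_H y) \<Gamma>"
proof -
  have r: "y p \<in> {am..ap}" if "p \<in> array_index k N" for p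
    using good_range[OF y that] by auto
  let ?c = "\<lambda>z p. 1 / (z - complex_of_real (y p))"
  let ?dq = "\<lambda>x y. (H (complex_of_real x) - H (complex_of_real y)) / (complex_of_real x - complex_of_real y)"
  have level: "((\<lambda>z. g z * (?c z (j, b) * ?c z (j, a))) has_contour_integral ?dq (y (j, b)) (y (j, a))) \<Gamma>"
    if "k \<le> j" "j \<le> N" "1 \<le> a" "a < b" "b \<le> j" for j a b
    using that good_differences(1)[OF y that] by (intro Cauchy_seg_pair r) auto
  have adj: "((\<lambda>z. g z * (?c z (j, a) * ?c z (j + 1, b))) has_contour_integral ?dq (y (j, a)) (y (j + 1, b))) \<Gamma>"
    if "k \<le> j" "j < N" "1 \<le> a" "a \<le> j" "1 \<le> b" "b \<le> j + 1" for j a b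
    using that good_differences(2)[OF y, of j a b] by (intro Cauchy_seg_pair r) auto
  \<comment> \<open>The kernel carries \<open>deriv V\<close> at \<open>z\<close>. Since
    \<open>deriv V\<close> is holomorphic on \<open>S\<close>, Cauchy's formula for its product with
    \<open>H\<close> brings the evaluation back to the entry.\<close>
  have e: "((\<lambda>z. g z * (deriv V z * ?c z (N, i))) has_contour_integral
      deriv V (complex_of_real (y (N, i))) * H (complex_of_real (y (N, i)))) \<Gamma>" if "i \<in> {1..N}" for i
    using Cauchy_seg[OF holomorphic_on_mult[OF deriv_V_hol H_hol], of "y (N, i)"] r[of "(N, i)"] that k_range
    by (simp add: ac_simps)
  show ?thesis
  proof (rule has_contour_integral_eq)
    show "((\<lambda>z.
       (\<Sum>j=1..N. \<Sum>i=1..<j. g z * (?c z (N, j) * ?c z (N, i))) +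
       (\<Sum>j=1..k. \<Sum>i=1..<j. complex_of_real (2 * \<theta> - 1) * (g z * (?c z (k, j) * ?c z (k, i)))) +
       (\<Sum>j=k..<N.
          (\<Sum>b=1..j. \<Sum>a=1..<b. complex_of_real (2 - 2 * \<theta>) * (g z * (?c z (j, b) * ?c z (j, a)))) +
          (\<Sum>a=1..j. \<Sum>b=1..j+1. complex_of_real (\<theta> - 1) * (g z * (?c z (j, a) * ?c z (j + 1, b))))) +
       (\<Sum>i=1..N. complex_of_real (- real N * \<theta>) * (g z * (deriv V z * ?c z (N, i)))) +
       (\<Sum>p\<in>array_index k N. g z * (?c z p)\<^sup>2)) has_contour_integral ward_H y) \<Gamma>"
      unfolding ward_H_def ward_sum_def using k_range
      by (intro has_contour_integral_add has_contour_integral_sum has_contour_integral_lmul level adj e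
          Cauchy_seg_square r finite_array_index) auto
    show "(\<Sum>j=1..N. \<Sum>i=1..<j. g z * (?c z (N, j) * ?c z (N, i))) +
       (\<Sum>j=1..k. \<Sum>i=1..<j. complex_of_real (2 * \<theta> - 1) * (g z * (?c z (k, j) * ?c z (k, i)))) +
       (\<Sum>j=k..<N.
          (\<Sum>b=1..j. \<Sum>a=1..<b. complex_of_real (2 - 2 * \<theta>) * (g z * (?c z (j, b) * ?c z (j, a)))) +
          (\<Sum>a=1..j. \<Sum>b=1..j+1. complex_of_real (\<theta> - 1) * (g z * (?c z (j, a) * ?c z (j + 1, b))))) +
       (\<Sum>i=1..N. complex_of_real (- real N * \<theta>) * (g z * (deriv V z * ?c z (N, i)))) +
       (\<Sum>p\<in>array_index k N. g z * (?c z p)\<^sup>2) = g z * ward_kernel z y" for z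
      unfolding ward_kernel_def ward_sum_def
      by (simp only: distrib_left sum_distrib_left mult.left_commute[of _ "g z"])
  qed
qed

text \<open>The pole at \<open>w\<close> lies outside \<open>S\<close>, so the square in the
  denominator is part of the holomorphic factor. Only the poles at the entries contribute, and they
  yield the derivative of the Stieltjes transform at \<open>w\<close> along
  \<open>H\<close>.\<close>

lemma contour_stieltjes:
  assumes y: "y \<in> good" and "r \<in> {k..N}" "w \<notin> S"
  shows "((\<lambda>z. g z / (z - w)\<^sup>2 * array_stieltjes (\<lambda>y. y) r z y) has_contour_integral
    stieltjes_derivative (\<lambda>x. H (complex_of_real x)) r w y) \<Gamma>"
proof (rule has_contour_integral_eq)
  have hol: "(\<lambda>z. H z / (z - w)\<^sup>2) holomorphic_on S"
    using \<open>w \<notin> S\<close> by (intro holomorphic_intros H_hol) auto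
  show "((\<lambda>z. \<Sum>i=1..r. H z / (z - w)\<^sup>2 / (2 * complex_of_real pi * \<i>) * (1 / (z - complex_of_real (y (r, i)))))
      has_contour_integral stieltjes_derivative (\<lambda>x. H (complex_of_real x)) r w y) \<Gamma>"
    unfolding stieltjes_derivative_def
  proof (intro has_contour_integral_sum)
    fix i assume "i \<in> {1..r}"
    then have "(r, i) \<in> array_index k N" using assms by auto
    then show "((\<lambda>z. H z / (z - w)\<^sup>2 / (2 * complex_of_real pi * \<i>) * (1 / (z - complex_of_real (y (r, i)))))
      has_contour_integral H (complex_of_real (y (r, i))) / (w - complex_of_real (y (r, i)))\<^sup>2) \<Gamma>"
      using Cauchy_seg[OF hol, of "y (r, i)"] good_range[OF y] by (simp add: power2_commute[of w] less_imp_le)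
  qed simp
  show "(\<Sum>i=1..r. H z / (z - w)\<^sup>2 / (2 * complex_of_real pi * \<i>) * (1 / (z - complex_of_real (y (r, i)))))
      = g z / (z - w)\<^sup>2 * array_stieltjes (\<lambda>y. y) r z y" for z
    unfolding array_stieltjes_def sum_distrib_left by (intro sum.cong refl) (simp add: mult_ac)
qed

lemma loop_observable_eq_ward_kernel:
  assumes y: "y \<in> good" and z: "z \<notin> seg"
  shows "loop_observable N k \<theta> V (\<lambda>y. y) z y = 2 * ward_kernel z y"
proof -
  define a where "a j = array_stieltjes (\<lambda>y. y) j z y" for j
  define b where "b j = - (\<Sum>i=1..j. (1 / (z - complex_of_real (y (j, i))))\<^sup>2)" for j
  let ?t = "complex_of_real \<theta>"
  have db: "deriv (\<lambda>\<zeta>. array_stieltjes (\<lambda>y. y) j \<zeta> y) z = b j" if "k \<le> j" "j \<le> N" for j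
  proof -
    have "complex_of_real (y (j, i)) \<noteq> z" if "i \<in> {1..j}" for i
      using that \<open>k \<le> j\<close> \<open>j \<le> N\<close> good_range[OF y, of "(j, i)"] z by (auto simp: less_imp_le)
    then show ?thesis unfolding deriv_array_stieltjes b_def by auto
  qed
  have "loop_observable N k \<theta> V (\<lambda>y. y) z y
    = - 2 * of_nat N * ?t * deriv V z * a N + ?t * b N + ?t * (a N)\<^sup>2 + (?t - 2) * b k + ?t * (a k)\<^sup>2
      + (\<Sum>j=k+1..N. - (?t + 1) * b j + (1 - ?t) * (a j - a (j - 1))\<^sup>2 + (1 - ?t) * b (j - 1))"
    unfolding loop_observable_def Let_def a_def[symmetric] using k_range
    by (intro arg_cong2[where f = "(+)"] sum.cong refl) (auto simp: db)
  also have "\<dots> = - 2 * of_nat N * ?t * deriv V z * a N + ((a N)\<^sup>2 + b N + (2 * ?t - 1) * ((a k)\<^sup>2 + b k)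
      + (\<Sum>j=k..<N. (2 - 2 * ?t) * ((a j)\<^sup>2 + b j) + 2 * (?t - 1) * (a j * a (j + 1))) - 2 * (\<Sum>j=k..N. b j))"
    using k_range by (subst loop_telescope) (auto simp: algebra_simps)
  also have "\<dots> = 2 * ward_kernel z y"
  proof -
    let ?c = "\<lambda>p. 1 / (z - complex_of_real (y p))"
    \<comment> \<open>Sums over pairs are half of the squared sum minus the diagonal; the diagonal
      is \<open>- b n\<close>, because the derivative of a resolvent is minus its square.\<close>
    have pairs: "(\<Sum>j=1..n. \<Sum>i=1..<j. ?c (n, j) * ?c (n, i)) = ((a n)\<^sup>2 + b n) / 2" for n
      using sum_pairs_less[of "\<lambda>i. ?c (n, i)" n] by (simp add: a_def b_def array_stieltjes_def)
    have cross: "(\<Sum>i=1..j. \<Sum>l=1..j+1. ?c (j, i) * ?c (j + 1, l)) = a j * a (j + 1)" for j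
      unfolding a_def array_stieltjes_def by (simp only: sum_product)
    have pairs': "(\<Sum>j=1..n. \<Sum>i=1..<j. C * (?c (n, j) * ?c (n, i))) = C * (((a n)\<^sup>2 + b n) / 2)" for n C
      unfolding pairs[of n, symmetric] by (simp only: sum_distrib_left)
    have cross': "(\<Sum>i=1..j. \<Sum>l=1..j+1. C * (?c (j, i) * ?c (j + 1, l))) = C * (a j * a (j + 1))" for j C
      unfolding cross[of j, symmetric] by (simp only: sum_distrib_left)
    have diag: "(\<Sum>p\<in>array_index k N. (?c p)\<^sup>2) = - (\<Sum>j=k..N. b j)"
      unfolding b_def array_index_def by (simp add: sum.Sigma sum_negf case_prod_beta')
    have V: "(\<Sum>i=1..N. complex_of_real (- real N * \<theta>) * (deriv V z * ?c (N, i)))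
        = - (of_nat N * ?t * deriv V z * a N)"
      unfolding a_def array_stieltjes_def by (simp add: sum_distrib_left sum_negf mult.assoc)
    have "ward_kernel z y = ((a N)\<^sup>2 + b N) / 2 + (2 * ?t - 1) * (((a k)\<^sup>2 + b k) / 2)
        + (\<Sum>j=k..<N. (2 - 2 * ?t) * (((a j)\<^sup>2 + b j) / 2) + (?t - 1) * (a j * a (j + 1)))
        + - (of_nat N * ?t * deriv V z * a N) + - (\<Sum>j=k..N. b j)"
      unfolding ward_kernel_def ward_sum_def V diag pairs pairs' cross' by simp
    moreover have "(\<Sum>j=k..<N. (2 - 2 * ?t) * ((a j)\<^sup>2 + b j) + 2 * (?t - 1) * (a j * a (j + 1)))
       = 2 * (\<Sum>j=k..<N. (2 - 2 * ?t) * (((a j)\<^sup>2 + b j) / 2) + (?t - 1) * (a j * a (j + 1)))"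
      unfolding sum_distrib_left by (intro sum.cong refl) (simp add: field_simps)
    \<comment> \<open>What remains is linear in a few groups of terms. Stated for free variables, it
      is settled without expanding the sums.\<close>
    moreover have "x + (p + q * r + s' - 2 * u) = 2 * w"
      if "w = p / 2 + q * (r / 2) + s + - v + - u" "s' = 2 * s" "x = - 2 * v" for p q r s s' u v w x :: complex
      using that by (simp add: field_simps)
    moreover have "- 2 * of_nat N * ?t * deriv V z * a N = - 2 * (of_nat N * ?t * deriv V z * a N)"
      by simp
    ultimately show ?thesis by blast
  qed
  finally show ?thesis .
qed

lemma family_resolvent:
  assumes "p \<in> array_index k N"
  shows "holomorphic_family law (- seg) (\<lambda>z y. 1 / (z - complex_of_real (y p)))"
proof (rule holomorphic_family_resolvent)
  show "open (- seg)" by (rule open_compl_seg)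
  have "(\<lambda>y. y p) \<in> borel_measurable law"
    by (intro measurable_law measurable_array_component assms)
  then show "(\<lambda>y. complex_of_real (y p)) \<in> borel_measurable law"
    by measurable
  show "complex_of_real (y p) \<in> seg" if "y \<in> space law" for y
    using good_range[OF _ assms, of y] that by (auto simp: space_law less_imp_le)
qed (auto intro: compact_seg)

lemma family_stieltjes:
  assumes "r \<in> {k..N}"
  shows "holomorphic_family law (- seg) (array_stieltjes (\<lambda>y. y) r)"
proof -
  have "holomorphic_family law (- seg) (\<lambda>z y. \<Sum>i=1..r. 1 / (z - complex_of_real (y (r, i))))"
    using assms by (intro holomorphic_family_sum open_compl_seg family_resolvent) auto
  then show ?thesis by (simp add: array_stieltjes_def[abs_def])
qed

lemma family_ward_kernel: "holomorphic_family law (S - seg) ward_kernel"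
proof -
  have r: "holomorphic_family law (S - seg) (\<lambda>z y. 1 / (z - complex_of_real (y p)))"
    if "p \<in> array_index k N" for p
    using family_resolvent[OF that] by (rule holomorphic_family_subset) auto
  have V: "holomorphic_family law (S - seg) (\<lambda>z y. deriv V z)"
    using deriv_V_hol by (intro holomorphic_family_parameter open_S_seg) (rule holomorphic_on_subset, auto)
  show ?thesis
    unfolding ward_kernel_def[abs_def] ward_sum_def[abs_def] using k_range
    by (intro holomorphic_family_add holomorphic_family_sum holomorphic_family_mult holomorphic_family_power2
        holomorphic_family_const V r open_S_seg) auto
qed

text \<open>Inherited from \<open>ward_kernel\<close>, a polynomial in resolvents and
  \<open>deriv V z\<close> that involves no derivative of a random function.\<close>

lemma family_loop_observable: "holomorphic_family law (S - seg) (loop_observable N k \<theta> V (\<lambda>y. y))"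
proof (rule holomorphic_family_cong[OF open_S_seg])
  show "holomorphic_family law (S - seg) (\<lambda>z y. 2 * ward_kernel z y)"
    by (intro holomorphic_family_mult holomorphic_family_const family_ward_kernel open_S_seg)
qed (auto simp: loop_observable_eq_ward_kernel space_law)

text \<open>Inside the expectation the contour integral turns half the observable into
  \<open>ward_H\<close> and the Stieltjes transforms into derivatives of the test function along
  \<open>H\<close>. These are the two parts of \<open>Ward_identity\<close>, used for every subset
  of \<open>J\<close>; the recursion then passes from moments to cumulants.\<close>

lemma loop_equation:
  fixes v :: "nat \<times> nat \<Rightarrow> complex"
  assumes "finite J" and J: "\<And>p. p \<in> J \<Longrightarrow> fst p \<in> {k..N} \<and> v p \<notin> S"
  defines "X \<equiv> \<lambda>p. array_stieltjes (\<lambda>y. y) (fst p) (v p)"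
  shows "((\<lambda>z. g z * (cumulant_with law X (loop_observable N k \<theta> V (\<lambda>y. y) z) J / 2
      + (\<Sum>p\<in>J. cumulant_with law X (array_stieltjes (\<lambda>y. y) (fst p) z) (J - {p}) / (z - v p)\<^sup>2)))
    has_contour_integral 0) \<Gamma>"
proof -
  let ?loop = "loop_observable N k \<theta> V (\<lambda>y. y)" and ?G = "array_stieltjes (\<lambda>y. y)"
  let ?T = "S - seg"
  have vseg: "v p \<in> - seg" if "p \<in> J" for p
    using J[OF that] seg_S by blast
  have Xm: "X p \<in> borel_measurable law" if "p \<in> J" for p
    unfolding X_def using J[OF that] vseg[OF that] by (intro holomorphic_familyD(2)[OF family_stieltjes]) auto
  have "\<exists>B. \<forall>y\<in>space law. norm (X p y) \<le> B" if "p \<in> J" for p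
    unfolding X_def using J[OF that] vseg[OF that] by (intro holomorphic_family_bounded[OF family_stieltjes]) auto
  then obtain B where B: "\<And>p y. p \<in> J \<Longrightarrow> y \<in> space law \<Longrightarrow> norm (X p y) \<le> B p"
    by metis
  have Xb: "norm (X p y) \<le> (\<Sum>q\<in>J. \<bar>B q\<bar>)" if "p \<in> J" "y \<in> space law" for p y
  proof -
    have "norm (X p y) \<le> \<bar>B p\<bar>" using B[OF that] by linarith
    also have "\<dots> \<le> (\<Sum>q\<in>J. \<bar>B q\<bar>)" using that \<open>finite J\<close> by (intro member_le_sum) auto
    finally show ?thesis .
  qed
  have sp: "(\<lambda>y. \<Prod>p\<in>I. X p y) = stieltjes_prod v I" for I
    by (simp add: stieltjes_prod_def X_def fun_eq_iff)
  have spf: "holomorphic_family law ?T (\<lambda>_. stieltjes_prod v I)" if "I \<subseteq> J" for I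
  proof -
    have "holomorphic_family law ?T (\<lambda>_ y. \<Prod>p\<in>I. X p y)"
      using that Xm Xb by (intro holomorphic_family_prod open_S_seg
          holomorphic_family_random[where B = "\<Sum>q\<in>J. \<bar>B q\<bar>"]) auto
    then show ?thesis by (simp only: sp)
  qed
  define b where "b I = (LINT y|law. stieltjes_prod v I y)" for I
  define mom where "mom \<xi> I = (LINT y|law. \<xi> y * stieltjes_prod v I y)" for \<xi> I
  have cumulant: "cumulant_with law X \<xi> I = cumulant_of_moments (mom \<xi>) b I"
    if IJ: "I \<subseteq> J" and "\<xi> \<in> borel_measurable law" and bd: "\<exists>C. \<forall>y\<in>space law. norm (\<xi> y) \<le> C" for \<xi> I
  proof -
    obtain C where C: "\<And>y. y \<in> space law \<Longrightarrow> norm (\<xi> y) \<le> C" using bd by metis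
    have "cumulant_with law X \<xi> I = cumulant_of_moments
        (\<lambda>I. LINT y|law. \<xi> y * (\<Prod>p\<in>I. X p y)) (\<lambda>I. LINT y|law. (\<Prod>p\<in>I. X p y)) I"
    proof (rule P.cumulant_with_eq_cumulant_of_moments[where B = "max C (\<Sum>q\<in>J. \<bar>B q\<bar>)"])
      show "finite I" using IJ \<open>finite J\<close> by (rule finite_subset)
      show "\<xi> \<in> borel_measurable law" by fact
      show "X p \<in> borel_measurable law" if "p \<in> I" for p
        using that \<open>I \<subseteq> J\<close> by (intro Xm) auto
      show "norm (\<xi> y) \<le> max C (\<Sum>q\<in>J. \<bar>B q\<bar>)" if "y \<in> space law" for y
        using C[OF that] by simp
      show "norm (X p y) \<le> max C (\<Sum>q\<in>J. \<bar>B q\<bar>)" if "p \<in> I" "y \<in> space law" for p y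
        using Xb[of p y] that \<open>I \<subseteq> J\<close> by auto
    qed
    then show ?thesis
      unfolding b_def[abs_def] mom_def[abs_def] sp[symmetric] .
  qed
  have g_family: "holomorphic_family law ?T (\<lambda>z _. g z * c z)" if "c holomorphic_on ?T" for c
    using that H_hol by (intro holomorphic_family_parameter open_S_seg holomorphic_intros) (rule holomorphic_on_subset, auto)

  \<comment> \<open>\<open>SH\<close> and \<open>DH\<close> are the values, sample by sample, of the
    contour integrals of the observable and of a Stieltjes transform, each times the remaining test
    function.\<close>
  define SH where "SH I y = ward_H y * stieltjes_prod v I y" for I y
  define DH where "DH p I y = stieltjes_derivative (\<lambda>x. H (complex_of_real x)) (fst p) (v p) y * stieltjes_prod v I y"
    for p I y
  have S1: "((\<lambda>z. g z * (1 / 2) * mom (?loop z) I) has_contour_integral (LINT y|law. SH I y)) \<Gamma>"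
    and S2: "integrable law (SH I)" if "I \<subseteq> J" for I
  proof -
    have fam: "holomorphic_family law ?T (\<lambda>z y. g z * (1 / 2) * (?loop z y * stieltjes_prod v I y))"
      by (intro holomorphic_family_mult g_family family_loop_observable spf that) auto
    have pt: "((\<lambda>z. g z * (1 / 2) * (?loop z y * stieltjes_prod v I y)) has_contour_integral SH I y) \<Gamma>"
      if "y \<in> space law" for y
    proof (rule has_contour_integral_eq)
      have y: "y \<in> good" using that by (simp add: space_law)
      show "((\<lambda>z. g z * ward_kernel z y * stieltjes_prod v I y) has_contour_integral SH I y) \<Gamma>"
        unfolding SH_def by (intro has_contour_integral_rmul contour_ward_kernel y)
      show "g z * ward_kernel z y * stieltjes_prod v I y = g z * (1 / 2) * (?loop z y * stieltjes_prod v I y)"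
        if "z \<in> path_image \<Gamma>" for z
      proof -
        have "z \<notin> seg" using path_\<Gamma>(3) that by blast
        then show ?thesis by (simp add: loop_observable_eq_ward_kernel[OF y] mult_ac)
      qed
    qed
    note * = P.holomorphic_family_contour[OF open_S_seg fam path_\<Gamma>(1,3) pt]
    show "((\<lambda>z. g z * (1 / 2) * mom (?loop z) I) has_contour_integral (LINT y|law. SH I y)) \<Gamma>"
      using *(1) unfolding mom_def by (simp only: integral_mult_right_zero)
    show "integrable law (SH I)" by (rule *(2))
  qed
  have D1: "((\<lambda>z. g z / (z - v p)\<^sup>2 * mom (?G (fst p) z) I) has_contour_integral (LINT y|law. DH p I y)) \<Gamma>"
    and D2: "integrable law (DH p I)" if p: "p \<in> J" and "I \<subseteq> J" for p I
  proof -
    have "(\<lambda>z. 1 / (z - v p)\<^sup>2) holomorphic_on ?T"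
      using J[OF p] by (intro holomorphic_intros) auto
    from g_family[OF this] have "holomorphic_family law ?T (\<lambda>z y. g z / (z - v p)\<^sup>2)" by simp
    then have fam: "holomorphic_family law ?T (\<lambda>z y. g z / (z - v p)\<^sup>2 * (?G (fst p) z y * stieltjes_prod v I y))"
      using J[OF p] \<open>I \<subseteq> J\<close>
      by (intro holomorphic_family_mult spf holomorphic_family_subset[OF family_stieltjes]) auto
    have pt: "((\<lambda>z. g z / (z - v p)\<^sup>2 * (?G (fst p) z y * stieltjes_prod v I y)) has_contour_integral DH p I y) \<Gamma>"
      if "y \<in> space law" for y
      using has_contour_integral_rmul[OF contour_stieltjes[of y "fst p" "v p"], of "stieltjes_prod v I y"] J[OF p] that
      by (simp add: DH_def space_law mult.assoc)
    note * = P.holomorphic_family_contour[OF open_S_seg fam path_\<Gamma>(1,3) pt]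
    show "((\<lambda>z. g z / (z - v p)\<^sup>2 * mom (?G (fst p) z) I) has_contour_integral (LINT y|law. DH p I y)) \<Gamma>"
      using *(1) unfolding mom_def by (simp only: integral_mult_right_zero)
    show "integrable law (DH p I)" by (rule *(2))
  qed
  \<comment> \<open>Needed for all \<open>I\<close> within \<open>J\<close>, not only for
    \<open>J\<close>, because the cumulant recursion uses the moment identities of all smaller index
    sets. In the second part the transform of \<open>p\<close> has been differentiated, so
    \<open>p\<close> leaves the product.\<close>
  have ward: "(LINT y|law. SH I y) + (\<Sum>p\<in>I. LINT y|law. DH p (I - {p}) y) = 0" if "I \<subseteq> J" for I
  proof -
    have "(LINT y|law. SH I y + (\<Sum>p\<in>I. DH p (I - {p}) y)) = 0"
      unfolding SH_def DH_def ward_H_def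
    proof (rule Ward_identity[OF open_S seg_S H_hol H_ends])
      show "finite I" using that \<open>finite J\<close> by (rule finite_subset)
      show "fst p \<in> {k..N} \<and> v p \<notin> seg" if "p \<in> I" for p
        using J[of p] vseg[of p] that \<open>I \<subseteq> J\<close> by blast
    qed
    moreover have "integrable law (DH p (I - {p}))" if "p \<in> I" for p
      using that \<open>I \<subseteq> J\<close> by (intro D2) auto
    ultimately show ?thesis
      using S2[OF that] by (simp add: Bochner_Integration.integral_add Bochner_Integration.integral_sum)
  qed
  have b1: "b {} \<noteq> 0"
    by (simp add: b_def stieltjes_prod_def P.prob_space)
  have hS: "((\<lambda>z. g z * (1 / 2) * cumulant_of_moments (mom (?loop z)) b J)
      has_contour_integral cumulant_of_moments (\<lambda>I. LINT y|law. SH I y) b J) \<Gamma>"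
    using \<open>finite J\<close> S1
    by (rule has_contour_integral_cumulant_of_moments[where g = "\<lambda>z. g z * (1 / 2)" and a = "\<lambda>z. mom (?loop z)"])
  have hD: "((\<lambda>z. g z / (z - v p)\<^sup>2 * cumulant_of_moments (mom (?G (fst p) z)) b (J - {p}))
      has_contour_integral cumulant_of_moments (\<lambda>I. LINT y|law. DH p I y) b (J - {p})) \<Gamma>" if p: "p \<in> J" for p
  proof (rule has_contour_integral_cumulant_of_moments[where g = "\<lambda>z. g z / (z - v p)\<^sup>2"
        and a = "\<lambda>z. mom (?G (fst p) z)"])
    show "finite (J - {p})" using \<open>finite J\<close> by simp
    show "((\<lambda>z. g z / (z - v p)\<^sup>2 * mom (?G (fst p) z) I) has_contour_integral (LINT y|law. DH p I y)) \<Gamma>"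
      if "I \<subseteq> J - {p}" for I
      using that by (intro D1[OF p]) blast
  qed
  have "((\<lambda>z. g z * (1 / 2) * cumulant_of_moments (mom (?loop z)) b J
      + (\<Sum>p\<in>J. g z / (z - v p)\<^sup>2 * cumulant_of_moments (mom (?G (fst p) z)) b (J - {p})))
    has_contour_integral cumulant_of_moments (\<lambda>I. LINT y|law. SH I y) b J
      + (\<Sum>p\<in>J. cumulant_of_moments (\<lambda>I. LINT y|law. DH p I y) b (J - {p}))) \<Gamma>"
    by (intro has_contour_integral_add has_contour_integral_sum hS hD \<open>finite J\<close>)
  also have "cumulant_of_moments (\<lambda>I. LINT y|law. SH I y) b J
      + (\<Sum>p\<in>J. cumulant_of_moments (\<lambda>I. LINT y|law. DH p I y) b (J - {p})) = 0"
    using \<open>finite J\<close> b1 ward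
    by (rule cumulant_of_moments_Ward[where a = "\<lambda>I. LINT y|law. SH I y"
          and d = "\<lambda>p I. LINT y|law. DH p I y"])
  finally show ?thesis
  proof (rule has_contour_integral_eq)
    fix z assume "z \<in> path_image \<Gamma>"
    then have z: "z \<in> ?T" "z \<in> - seg" using path_\<Gamma>(3) by auto
    have "cumulant_with law X (?loop z) J = cumulant_of_moments (mom (?loop z)) b J"
      by (rule cumulant[OF order_refl holomorphic_familyD(2)[OF family_loop_observable z(1)]
            holomorphic_family_bounded[OF family_loop_observable z(1)]])
    moreover have "cumulant_with law X (?G (fst p) z) (J - {p}) = cumulant_of_moments (mom (?G (fst p) z)) b (J - {p})"
      if "p \<in> J" for p
    proof -
      have r: "fst p \<in> {k..N}" using J[OF that] by blast
      show ?thesis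
        by (rule cumulant[OF Diff_subset holomorphic_familyD(2)[OF family_stieltjes[OF r] z(2)]
              holomorphic_family_bounded[OF family_stieltjes[OF r] z(2)]])
    qed
    ultimately show "g z * (1 / 2) * cumulant_of_moments (mom (?loop z)) b J
      + (\<Sum>p\<in>J. g z / (z - v p)\<^sup>2 * cumulant_of_moments (mom (?G (fst p) z)) b (J - {p}))
      = g z * (cumulant_with law X (?loop z) J / 2
      + (\<Sum>p\<in>J. cumulant_with law X (?G (fst p) z) (J - {p}) / (z - v p)\<^sup>2))"
      by (simp add: distrib_left sum_distrib_left cong: sum.cong)
  qed
qed

end

theorem theorem1p5:
  fixes N k :: nat and am ap \<theta> :: real
    and U :: "complex set" and V :: "complex \<Rightarrow> complex"
    and M :: "'w measure" and Y :: "'w \<Rightarrow> nat \<times> nat \<Rightarrow> real"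
    and m :: "nat \<Rightarrow> nat" and vs :: "nat \<times> nat \<Rightarrow> complex" and v :: complex
    and \<Gamma> :: "real \<Rightarrow> complex"
  defines "seg \<equiv> complex_of_real ` {am..ap}"
  defines "MM \<equiv> (SIGMA r:{k..N}. {1..m r})"
  defines "G \<equiv> array_stieltjes Y"
  defines "\<kappa> \<equiv> cumulant_with M (\<lambda>p. G (fst p) (vs p))"
  assumes "am < ap" and "\<theta> > 0"
    and "open U" and "seg \<subseteq> U" and "V holomorphic_on U"
    and "\<forall>x\<in>{am..ap}. V (complex_of_real x) \<in> \<real>"
    and "k \<in> {1..N}"
    and "prob_space M"
    and "distributed M (array_lebesgue k N) Y (\<lambda>y. ennreal (array_density N k am ap \<theta> V y))"
    and "\<forall>p\<in>MM. vs p \<notin> seg" and "v \<notin> seg"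
    and "valid_path \<Gamma>" and "pathfinish \<Gamma> = pathstart \<Gamma>"
    and "path_image \<Gamma> \<subseteq> U - seg - vs ` MM - {v}"
    and "\<forall>x\<in>seg. winding_number \<Gamma> x = 1"
    and "\<forall>w. w \<notin> U \<longrightarrow> winding_number \<Gamma> w = 0"
    and "\<forall>p\<in>MM. winding_number \<Gamma> (vs p) = 0" and "winding_number \<Gamma> v = 0"
  shows "((\<lambda>z. (z - complex_of_real am) * (z - complex_of_real ap)
                 / (2 * complex_of_real pi * \<i> * (z - v))
               * (\<kappa> (loop_observable N k \<theta> V Y z) MM / 2
                  + (\<Sum>p\<in>MM. \<kappa> (G (fst p) z) (MM - {p}) / (z - vs p)\<^sup>2)))
          has_contour_integral 0) \<Gamma>"
proof -
  interpret C: corners_process N k am ap \<theta> U V M Y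
  proof (intro corners_process.intro)
    show "complex_of_real ` {am..ap} \<subseteq> U" using assms(8) by (simp only: seg_def)
    show "V (complex_of_real x) \<in> \<real>" if "x \<in> {am..ap}" for x
      using assms(10) that by (rule bspec)
  qed fact+
  have fin: "finite MM" by (auto simp: MM_def)
  have MM: "fst p \<in> {k..N}" if "p \<in> MM" for p using that by (auto simp: MM_def)
  \<comment> \<open>Without \<open>v\<close> and the points \<open>vs p\<close>, both
    \<open>H\<close> and the factors with poles at \<open>vs p\<close> are holomorphic. The contour
    has winding number 0 about each removed point, so the global Cauchy formula holds on
    \<open>S\<close>; the interval stays inside because none of these points lies on it.\<close>
  define S where "S = U - {v} - vs ` MM"
  define H where "H z = (z - complex_of_real am) * (z - complex_of_real ap) / (z - v)" for z
  interpret D: corners_contour N k am ap \<theta> U V M Y S H \<Gamma>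
  proof
    show "open S"
      unfolding S_def using fin \<open>open U\<close> by (intro open_Diff finite_imp_closed) auto
    show "complex_of_real ` {am..ap} \<subseteq> S"
      using assms(8,14,15) unfolding S_def seg_def by blast
    show "H holomorphic_on S"
      unfolding H_def[abs_def] S_def by (intro holomorphic_intros) auto
    show "winding_number \<Gamma> w = 0" if "w \<notin> S" for w
      using that assms(20-22) unfolding S_def by blast
    show "winding_number \<Gamma> x = 1" if "x \<in> complex_of_real ` {am..ap}" for x
      using that assms(19) unfolding seg_def by blast
    show "path_image \<Gamma> \<subseteq> S - complex_of_real ` {am..ap}"
      using assms(18) unfolding S_def seg_def by blast
    show "S \<subseteq> U" unfolding S_def by blast
    show "H (complex_of_real am) = 0" "H (complex_of_real ap) = 0" by (simp_all add: H_def)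
  qed fact+
  let ?X = "\<lambda>p. array_stieltjes (\<lambda>y. y) (fst p) (vs p)"
  have G_comp: "G r z = (\<lambda>\<omega>. array_stieltjes (\<lambda>y. y) r z (Y \<omega>))" for r z
    by (simp add: G_def array_stieltjes_def fun_eq_iff)
  have loop_comp: "loop_observable N k \<theta> V Y z = (\<lambda>\<omega>. loop_observable N k \<theta> V (\<lambda>y. y) z (Y \<omega>))" for z
    by (simp add: loop_observable_def array_stieltjes_def fun_eq_iff)
  have \<kappa>: "\<kappa> (\<lambda>\<omega>. \<xi> (Y \<omega>)) J = cumulant_with C.law ?X \<xi> J"
    if "J \<subseteq> MM" "\<xi> \<in> borel_measurable (array_lebesgue k N)" for \<xi> J
    unfolding \<kappa>_def G_comp using that fin MM finite_subset
    by (intro C.cumulant_with_law measurable_array_stieltjes) auto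
  have \<kappa>_loop: "\<kappa> (loop_observable N k \<theta> V Y z) MM = cumulant_with C.law ?X (loop_observable N k \<theta> V (\<lambda>y. y) z) MM" for z
    unfolding loop_comp using assms(11) by (intro \<kappa> measurable_loop_observable) auto
  have \<kappa>_G: "\<kappa> (G (fst p) z) (MM - {p}) = cumulant_with C.law ?X (array_stieltjes (\<lambda>y. y) (fst p) z) (MM - {p})"
    if "p \<in> MM" for p z
    unfolding G_comp using MM[OF that] by (intro \<kappa> measurable_array_stieltjes) auto
  have "((\<lambda>z. H z / (2 * complex_of_real pi * \<i>) * (cumulant_with C.law ?X (loop_observable N k \<theta> V (\<lambda>y. y) z) MM / 2
      + (\<Sum>p\<in>MM. cumulant_with C.law ?X (array_stieltjes (\<lambda>y. y) (fst p) z) (MM - {p}) / (z - vs p)\<^sup>2)))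
    has_contour_integral 0) \<Gamma>"
    using fin MM by (intro D.loop_equation) (auto simp: S_def)
  then show ?thesis
    by (rule has_contour_integral_eq) (simp add: H_def \<kappa>_loop \<kappa>_G mult_ac)
qed

end
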